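(* There is a polynomial-time algorithm which, for every instance of bin packing with conflicts whose conflict graph is a split graph, returns a packing using at most $\left(1+\frac{2}{e}\right)\cdot \mathrm{OPT}$ bins, where $\mathrm{OPT}$ is the optimal number of bins.
   Context: Bin packing with conflicts: an instance is $(I,s,E)$ with a finite item set $I$, sizes $s:I\to[0,1]$ and a conflict graph $G=(I,E)$. A packing is a partition of $I$ into bins, each of which is an independent set of $G$ of total size at most $1$; $\mathrm{OPT}$ is the minimum number of bins of a packing. A graph is a split graph if its vertex set can be partitioned into a clique and an independent set.
   Formalization: Item sizes are taken to be rational numbers in [0,1], given as reduced binary fractions, since an irrational size has no finite encoding and polynomial time in the input length would be undefined for it. *)

theory Defs
  imports Complex_Main "HOL-Library.Ramsey" "HOL-Library.Disjoint_Sets" "HOL-Library.Log_Nat"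
    "HOL-Computational_Algebra.Polynomial"
begin

section \<open>Bin packing with conflicts\<close>

text \<open>Sizes are rational, so that an instance has a finite encoding. Conflict edges are two-element
  sets of items.\<close>

definition bpc_instance :: "'a set \<Rightarrow> ('a \<Rightarrow> rat) \<Rightarrow> 'a set set \<Rightarrow> bool" where
  "bpc_instance I s E \<longleftrightarrow> finite I \<and> (\<forall>x\<in>I. 0 \<le> s x \<and> s x \<le> 1) \<and> E \<subseteq> nsets I 2"

definition is_packing :: "'a set \<Rightarrow> ('a \<Rightarrow> rat) \<Rightarrow> 'a set set \<Rightarrow> 'a set set \<Rightarrow> bool" where
  "is_packing I s E P \<longleftrightarrow> partition_on I P \<and> (\<forall>B\<in>P. indep B E \<and> sum s B \<le> 1)"

definition bpc_OPT :: "'a set \<Rightarrow> ('a \<Rightarrow> rat) \<Rightarrow> 'a set set \<Rightarrow> nat" where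
  "bpc_OPT I s E = (LEAST k. \<exists>P. is_packing I s E P \<and> card P = k)"

definition split_graph :: "'a set \<Rightarrow> 'a set set \<Rightarrow> bool" where
  "split_graph V E \<longleftrightarrow> (\<exists>K S. K \<union> S = V \<and> K \<inter> S = {} \<and> clique K E \<and> indep S E)"

text \<open>The minimum in \<^const>\<open>bpc_OPT\<close> is over a nonempty set, so it is attained.\<close>

lemma is_packing_singletons:
  assumes "bpc_instance I s E"
  shows "is_packing I s E ((\<lambda>x. {x}) ` I)"
  using assms by (auto simp: bpc_instance_def is_packing_def partition_on_def disjoint_def indep_def)

lemma bpc_OPT_attained:
  assumes "bpc_instance I s E"
  shows "\<exists>P. is_packing I s E P \<and> card P = bpc_OPT I s E"
  unfolding bpc_OPT_def by (rule LeastI_ex) (use is_packing_singletons[OF assms] in blast)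


section \<open>Random access machines with logarithmic cost\<close>

text \<open>
  The model of computation is the random access machine under the logarithmic cost criterion
  (Cook and Reckhow; Aho, Hopcroft and Ullman), with structured control flow instead of jumps.
  A memory cell holds an arbitrary integer, and addresses are integers, too. Every evaluation of
  an expression node is charged the bit length of the integer it yields; in particular, a memory
  access is charged the length of both the address and the content. A machine of this kind and a
  Turing machine simulate each other with polynomial overhead.
\<close>

type_synonym memory = "int \<Rightarrow> int"

datatype binop = Add | Sub | Mul | Div | Less | Eq

datatype expr = Const int | Load expr | Op binop expr expr

datatype com =
    Skip
  | Store expr expr
  | Seq com com
  | Cond expr com com
  | While expr com

fun binop_val :: "binop \<Rightarrow> int \<Rightarrow> int \<Rightarrow> int" where
  "binop_val Add x y = x + y"
| "binop_val Sub x y = x - y"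
| "binop_val Mul x y = x * y"
| "binop_val Div x y = x div y"
| "binop_val Less x y = (if x < y then 1 else 0)"
| "binop_val Eq x y = (if x = y then 1 else 0)"

fun expr_val :: "expr \<Rightarrow> memory \<Rightarrow> int" where
  "expr_val (Const k) m = k"
| "expr_val (Load e) m = m (expr_val e m)"
| "expr_val (Op f e1 e2) m = binop_val f (expr_val e1 m) (expr_val e2 m)"

text \<open>One plus the number of binary digits of the absolute value, the extra unit being for the
  sign (0 has no digits here).\<close>

definition int_size :: "int \<Rightarrow> nat" where
  "int_size k = 1 + floorlog 2 (nat \<bar>k\<bar>)"

fun expr_cost :: "expr \<Rightarrow> memory \<Rightarrow> nat" where
  "expr_cost (Const k) m = int_size k"
| "expr_cost (Load e) m = expr_cost e m + int_size (expr_val (Load e) m)"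
| "expr_cost (Op f e1 e2) m = expr_cost e1 m + expr_cost e2 m + int_size (expr_val (Op f e1 e2) m)"

text \<open>\<open>exec c m t m'\<close>: started in memory \<open>m\<close>, the program \<open>c\<close> halts after time \<open>t\<close> with memory
  \<open>m'\<close>. In \<open>Store a e\<close>, the expression \<open>a\<close> yields the address.\<close>

inductive exec :: "com \<Rightarrow> memory \<Rightarrow> nat \<Rightarrow> memory \<Rightarrow> bool" where
  Skip: "exec Skip m 1 m"
| Store: "exec (Store a e) m (1 + expr_cost a m + expr_cost e m) (m(expr_val a m := expr_val e m))"
| Seq: "exec c1 m t1 m1 \<Longrightarrow> exec c2 m1 t2 m2 \<Longrightarrow> exec (Seq c1 c2) m (1 + t1 + t2) m2"
| CondT: "expr_val e m \<noteq> 0 \<Longrightarrow> exec c1 m t m1 \<Longrightarrow> exec (Cond e c1 c2) m (1 + expr_cost e m + t) m1"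
| CondF: "expr_val e m = 0 \<Longrightarrow> exec c2 m t m1 \<Longrightarrow> exec (Cond e c1 c2) m (1 + expr_cost e m + t) m1"
| WhileF: "expr_val e m = 0 \<Longrightarrow> exec (While e c) m (1 + expr_cost e m) m"
| WhileT: "expr_val e m \<noteq> 0 \<Longrightarrow> exec c m t1 m1 \<Longrightarrow> exec (While e c) m1 t2 m2 \<Longrightarrow>
    exec (While e c) m (1 + expr_cost e m + t1 + t2) m2"

inductive_cases exec_SkipE: "exec Skip m t m'"
inductive_cases exec_StoreE: "exec (Store a e) m t m'"
inductive_cases exec_SeqE: "exec (Seq c1 c2) m t m'"
inductive_cases exec_CondE: "exec (Cond e c1 c2) m t m'"
inductive_cases exec_WhileE: "exec (While e c) m t m'"

lemma exec_deterministic: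
  assumes "exec c m t m1" "exec c m t' m2"
  shows "t = t' \<and> m1 = m2"
  using assms
proof (induction arbitrary: t' m2 rule: exec.induct)
  case (Skip m)
  then show ?case by (rule exec_SkipE) simp
next
  case (Store a e m)
  then show ?case by (rule exec_StoreE) simp
next
  case (Seq c1 m t1 m1 c2 t2 m3)
  from Seq.prems show ?case
  proof (rule exec_SeqE)
    fix u1 n u2
    assume u: "t' = Suc (u1 + u2)" "exec c1 m u1 n" "exec c2 n u2 m2"
    from Seq.IH(1)[OF u(2)] have "t1 = u1" "m1 = n" by simp_all
    then show ?thesis using u(1) Seq.IH(2)[of u2 m2] u(3) by simp
  qed
next
  case (CondT e m c1 t m1 c2)
  from CondT.prems show ?case by (rule exec_CondE) (use CondT.hyps in \<open>auto dest: CondT.IH\<close>)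
next
  case (CondF e m c2 t m1 c1)
  from CondF.prems show ?case by (rule exec_CondE) (use CondF.hyps in \<open>auto dest: CondF.IH\<close>)
next
  case (WhileF e m c)
  from WhileF.prems show ?case by (rule exec_WhileE) (use WhileF.hyps in simp_all)
next
  case (WhileT e m c t1 m1 t2 m3)
  from WhileT.prems show ?case
  proof (rule exec_WhileE)
    assume "expr_val e m = 0"
    with WhileT.hyps show ?thesis by simp
  next
    fix u1 n u2
    assume u: "t' = Suc (expr_cost e m + u1 + u2)" "exec c m u1 n" "exec (While e c) n u2 m2"
    from WhileT.IH(1)[OF u(2)] have "t1 = u1" "m1 = n" by simp_all
    then show ?thesis using u(1) WhileT.IH(2)[of u2 m2] u(3) by simp
  qed
qed

text \<open>The input words occupy the cells from address 0 on, and all other cells are 0.\<close>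

definition input_memory :: "int list \<Rightarrow> memory" where
  "input_memory ws = (\<lambda>a. if 0 \<le> a \<and> nat a < length ws then ws ! nat a else 0)"

definition input_size :: "int list \<Rightarrow> nat" where
  "input_size ws = sum_list (map int_size ws)"


section \<open>Encoding of instances and packings\<close>

text \<open>
  For an enumeration \<open>xs\<close> of the items: the number of items; numerator and denominator of each
  size, in lowest terms; the adjacency matrix of the conflict graph, row by row.
\<close>

definition encode_instance :: "'a list \<Rightarrow> ('a \<Rightarrow> rat) \<Rightarrow> 'a set set \<Rightarrow> int list" where
  "encode_instance xs s E =
     [int (length xs)]
     @ concat (map (\<lambda>x. [fst (quotient_of (s x)), snd (quotient_of (s x))]) xs)
     @ [if {x, y} \<in> E then 1 else 0. x \<leftarrow> xs, y \<leftarrow> xs]"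

text \<open>On halting, cell \<open>i\<close> holds a label of the bin of the item \<open>xs ! i\<close>; two items share a bin
  iff their labels are equal.\<close>

definition output_bins :: "'a list \<Rightarrow> memory \<Rightarrow> 'a set set" where
  "output_bins xs m =
     (\<lambda>i. {xs ! j | j. j < length xs \<and> m (int j) = m (int i)}) ` {..<length xs}"

end

theory Submission
  imports Defs
begin

text \<open>
  Let \<open>K\<close> be the clique and \<open>S\<close> the independent set. For \<open>h = |K|, |K| + 1, \<dots>\<close> take \<open>h\<close> bins, the first
  \<open>|K|\<close> of which hold one clique item each, and cover the items of \<open>S\<close> by feasible configurations of
  the bins. A configuration is changed when this raises \<open>\<Sum>j. v j * (dd 0 + \<dots> + dd (c j - 1))\<close>, where
  \<open>v j\<close> is the profit of item \<open>j\<close>, \<open>c j\<close> the number of bins covering it, and \<open>dd\<close> a decreasing sequence; a best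
  response of a bin is a knapsack problem, solved by dynamic programming over the polynomially bounded
  profits. If a packing with \<open>h\<close> bins exists, its bins are no better responses in a local optimum, and
  hence at most the fraction \<open>24 / 65\<close> (close to \<open>1 / e\<close>) of the profit is uncovered.

  The uncovered items are packed by first fit into \<open>k\<close> new bins. With the weight \<open>38 * s + [s > 1 / 2]\<close>
  of an item of size \<open>s\<close>, a bin of any packing has weight at most 39, while \<open>k \<ge> 2\<close> bins of first fit
  have total weight more than \<open>20 * k - 2\<close>. With these weights as profits, \<open>k \<le> (25 / 34) * h\<close> for
  \<open>h = OPT\<close>, so that the first \<open>h\<close> passing this test is at most \<open>OPT\<close>, and \<open>25 / 34 \<le> 2 / e\<close>.

  On the machine side, if in every product one factor is short, then the bit length of the memory
  grows by a bounded amount per step. Polynomially many steps thus have polynomial logarithmic cost.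
\<close>


section \<open>Polynomial bounds\<close>

text \<open>Two clique items never share a bin, so the bins of any packing can be renumbered to put
  the i-th clique item in bin i. From then on a bin is restricted only by its capacity and its own
  clique item, as items of \<open>S\<close> do not conflict with each other; packing
  \<open>S\<close> becomes a cover by independent knapsacks. Rounding a linear relaxation would
  leave about 1/e of the profit uncovered; the local search comes close to this fraction
  deterministically and with integers only. The optimum being unknown, the test is made on the
  outcome: the labels form a valid packing for every \<open>h\<close> from \<open>|K|\<close> on,
  and only the bound on \<open>k\<close> presupposes a packing with \<open>h\<close> bins. In the
  limit the constants give (24/65) * (39/20) = 0.72, and the gap up to 25/34 = 0.735... pays for the
  additive errors of first fit and of rounding the profits, with integrality settling the small
  \<open>h\<close>. Profits have to be small, as they index the knapsack table and bound the number
  of improvements. Sizes are exact instead, over a common denominator that may be exponentially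
  large, and hence the running time is tracked by bit lengths.\<close>

definition poly_bounded :: "(nat \<Rightarrow> nat) \<Rightarrow> bool" where
  "poly_bounded f \<longleftrightarrow> (\<exists>p :: nat poly. \<forall>n. f n \<le> poly p n)"

lemma poly_bounded_const: "poly_bounded (\<lambda>n. c)"
  unfolding poly_bounded_def by (rule exI[of _ "[:c:]"]) simp

lemma poly_bounded_id: "poly_bounded (\<lambda>n. n)"
  unfolding poly_bounded_def by (rule exI[of _ "[:0, 1:]"]) simp

lemma poly_bounded_add:
  assumes "poly_bounded f" "poly_bounded g"
  shows "poly_bounded (\<lambda>n. f n + g n)"
proof -
  obtain p q where "\<forall>n. f n \<le> poly p n" "\<forall>n. g n \<le> poly q n"
    using assms unfolding poly_bounded_def by blast
  then show ?thesis unfolding poly_bounded_def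
    by (intro exI[of _ "p + q"]) (simp add: add_mono)
qed

lemma poly_bounded_mult:
  assumes "poly_bounded f" "poly_bounded g"
  shows "poly_bounded (\<lambda>n. f n * g n)"
proof -
  obtain p q where "\<forall>n. f n \<le> poly p n" "\<forall>n. g n \<le> poly q n"
    using assms unfolding poly_bounded_def by blast
  then show ?thesis unfolding poly_bounded_def
    by (intro exI[of _ "p * q"]) (simp add: mult_le_mono)
qed

lemmas poly_bounded_intros = poly_bounded_const poly_bounded_id poly_bounded_add poly_bounded_mult


section \<open>Integer sizes\<close>

lemma int_size_le_iff: "int_size k \<le> Suc w \<longleftrightarrow> \<bar>k\<bar> < 2 ^ w"
proof -
  have "int_size k \<le> Suc w \<longleftrightarrow> nat \<bar>k\<bar> < 2 ^ w"
    by (simp add: int_size_def floorlog_le_iff)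
  also have "\<dots> \<longleftrightarrow> \<bar>k\<bar> < 2 ^ w"
    by (simp add: nat_less_iff)
  finally show ?thesis .
qed

lemma int_size_pos: "1 \<le> int_size k"
  by (simp add: int_size_def)

lemma abs_less_int_size: "\<bar>k\<bar> < 2 ^ (int_size k - 1)"
  using int_size_le_iff[of k "int_size k - 1"] int_size_pos[of k] by simp

lemma int_size_small:
  assumes "\<bar>k\<bar> < 128" "8 \<le> g"
  shows "int_size k \<le> g"
proof -
  have "int_size k \<le> Suc 7" unfolding int_size_le_iff using assms(1) by simp
  then show ?thesis using assms(2) by simp
qed

lemma int_size_mono: "\<bar>j\<bar> \<le> \<bar>k\<bar> \<Longrightarrow> int_size j \<le> int_size k"
  unfolding int_size_def by (auto intro: floorlog_mono)

text \<open>Stated for every \<open>z\<close> dominated by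
  \<open>\<bar>x\<bar> + \<bar>y\<bar>\<close>, so that sums and differences share one estimate: a
  single extra bit.\<close>

lemma int_size_abs_add:
  assumes "\<bar>z\<bar> \<le> \<bar>x\<bar> + \<bar>y\<bar>"
  shows "int_size z \<le> max (int_size x) (int_size y) + 1"
proof -
  define w where "w = max (int_size x) (int_size y) - 1"
  have w: "max (int_size x) (int_size y) = Suc w"
    using int_size_pos[of x] by (simp add: w_def)
  then have "int_size x \<le> Suc w" "int_size y \<le> Suc w" by simp_all
  then have "\<bar>z\<bar> < 2 ^ Suc w" using assms unfolding int_size_le_iff by simp
  then show ?thesis using w int_size_le_iff[of z "Suc w"] by simp
qed

lemma int_size_mult: "int_size (x * y) \<le> int_size x + int_size y"
proof -
  have "\<bar>x * y\<bar> \<le> 2 ^ (int_size x - 1) * 2 ^ (int_size y - 1)"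
    unfolding abs_mult by (intro mult_mono less_imp_le[OF abs_less_int_size]) simp_all
  also have "\<dots> = 2 ^ (int_size x - 1 + (int_size y - 1))" by (simp add: power_add)
  also have "\<dots> < 2 ^ Suc (int_size x - 1 + (int_size y - 1))" by simp
  finally have "int_size (x * y) \<le> Suc (Suc (int_size x - 1 + (int_size y - 1)))"
    unfolding int_size_le_iff .
  then show ?thesis using int_size_pos[of x] int_size_pos[of y] by simp
qed

text \<open>The quotient is rounded down, so a negative dividend is treated apart; a negative
  divisor reduces to a positive one by negating both arguments, and division by 0 yields 0.\<close>

lemma abs_div_le: "\<bar>x div y\<bar> \<le> \<bar>x\<bar>" for x y :: int
proof -
  have pos: "\<bar>x div y\<bar> \<le> \<bar>x\<bar>" if "1 \<le> y" for x y :: int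
  proof (cases "0 \<le> x")
    case True
    then have "x * 1 \<le> x * y" using that by (intro mult_left_mono)
    then have "x div y \<le> x * y div y" using that by (intro zdiv_mono1) auto
    then show ?thesis using True that by (simp add: pos_imp_zdiv_nonneg_iff)
  next
    case False
    then have "x * y \<le> x * 1" using that by (intro mult_left_mono_neg) auto
    then have "x * y div y \<le> x div y" using that by (intro zdiv_mono1) auto
    moreover have "x div y < 0" using False that by (simp add: pos_imp_zdiv_neg_iff)
    ultimately show ?thesis using that by simp
  qed
  consider "y = 0" | "1 \<le> y" | "1 \<le> - y" by linarith
  then show ?thesis using pos[of y x] pos[of "- y" "- x"] by cases auto
qed


section \<open>Bounded runs\<close>

fun esize :: "expr \<Rightarrow> nat" where
  "esize (Const k) = 1"
| "esize (Load e) = esize e + 1"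
| "esize (Op f e1 e2) = esize e1 + esize e2 + 1"

text \<open>Constants and one factor of each product have at most \<open>g\<close> bits, so that the bit length of the
  values grows by at most \<open>g\<close> at every node.\<close>

fun expr_ok :: "nat \<Rightarrow> expr \<Rightarrow> memory \<Rightarrow> bool" where
  "expr_ok g (Const k) m \<longleftrightarrow> int_size k \<le> g"
| "expr_ok g (Load e) m \<longleftrightarrow> expr_ok g e m"
| "expr_ok g (Op f e1 e2) m \<longleftrightarrow> expr_ok g e1 m \<and> expr_ok g e2 m \<and>
     (f = Mul \<longrightarrow> int_size (expr_val e1 m) \<le> g \<or> int_size (expr_val e2 m) \<le> g)"

lemma int_size_binop_val:
  assumes "int_size x \<le> w" "int_size y \<le> v" "2 \<le> g"
    and "f = Mul \<Longrightarrow> int_size x \<le> g \<or> int_size y \<le> g"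
  shows "int_size (binop_val f x y) \<le> max w v + g"
proof (cases f)
  case Add
  then show ?thesis using int_size_abs_add[OF abs_triangle_ineq, of x y] assms by auto
next
  case Sub
  then show ?thesis using int_size_abs_add[OF abs_triangle_ineq4, of x y] assms by auto
next
  case Mul
  then show ?thesis using int_size_mult[of x y] assms by auto
next
  case Div
  then show ?thesis using int_size_mono[OF abs_div_le, of x y] assms by auto
next
  case Less
  then show ?thesis using int_size_le_iff[of 1 1] int_size_le_iff[of 0 1] assms by auto
next
  case Eq
  then show ?thesis using int_size_le_iff[of 1 1] int_size_le_iff[of 0 1] assms by auto
qed

text \<open>Costs have the shape \<open>n * (b + g * i)\<close>: \<open>n\<close> nodes, each
  producing a value of at most \<open>b + g * i\<close> bits. Relaxing \<open>i\<close> to a common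
  total lets the costs of subterms be added.\<close>

lemma cost_mono:
  fixes b g :: nat
  assumes "c \<le> n * (b + g * i)" "i \<le> j"
  shows "c \<le> n * (b + g * j)"
  using assms(1) by (rule order_trans) (use assms(2) in simp)

text \<open>A load yields a word of at most \<open>b\<close> bits whatever its address, and every
  operation yields at most \<open>g\<close> bits more than its longer operand; for a product this is
  the condition that one factor is short. Charging this size at each of the \<open>esize e\<close>
  nodes gives the cost.\<close>

lemma expr_bounds:
  assumes "\<forall>a. int_size (m a) \<le> b" "2 \<le> g" "expr_ok g e m"
  shows "int_size (expr_val e m) \<le> b + g * esize e \<and> expr_cost e m \<le> esize e * (b + g * esize e)"
  using assms(3)
proof (induction e)
  case (Load e)
  have "int_size (m (expr_val e m)) \<le> b + g * (esize e + 1)" using assms(1) trans_le_add1 by blast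
  moreover have "expr_cost e m \<le> esize e * (b + g * (esize e + 1))"
    by (rule cost_mono[of _ _ _ _ "esize e"]) (use Load in simp_all)
  ultimately show ?case by (simp add: algebra_simps)
next
  case (Op f e1 e2)
  let ?n = "esize e1 + esize e2 + 1"
  have v: "int_size (expr_val (Op f e1 e2) m) \<le> b + g * ?n"
  proof (cases "f = Mul")
    case True
    have "int_size (expr_val e1 m * expr_val e2 m) \<le> int_size (expr_val e1 m) + int_size (expr_val e2 m)"
      by (rule int_size_mult)
    moreover have "int_size (expr_val e1 m) \<le> b + g * esize e1" "int_size (expr_val e2 m) \<le> b + g * esize e2"
      using Op by auto
    moreover have "int_size (expr_val e1 m) \<le> g \<or> int_size (expr_val e2 m) \<le> g"
      using Op.prems True by simp
    ultimately show ?thesis using True by (auto simp: algebra_simps)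
  next
    case False
    have "int_size (expr_val (Op f e1 e2) m) \<le> max (b + g * esize e1) (b + g * esize e2) + g"
      unfolding expr_val.simps by (rule int_size_binop_val) (use Op False assms(2) in auto)
    also have "\<dots> \<le> b + g * ?n" by (auto simp: algebra_simps)
    finally show ?thesis .
  qed
  have "expr_cost e1 m \<le> esize e1 * (b + g * ?n)"
    by (rule cost_mono[of _ _ _ _ "esize e1"]) (use Op in simp_all)
  moreover have "expr_cost e2 m \<le> esize e2 * (b + g * ?n)"
    by (rule cost_mono[of _ _ _ _ "esize e2"]) (use Op in simp_all)
  ultimately show ?case using v by (simp add: algebra_simps)
qed (use assms in auto)

text \<open>Here \<open>k\<close> counts commands and expression nodes, not costs, and \<open>b\<close> bounds the sizes of the cells at the
  start.\<close>

definition runs :: "nat \<Rightarrow> com \<Rightarrow> memory \<Rightarrow> nat \<Rightarrow> (memory \<Rightarrow> bool) \<Rightarrow> bool" where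
  "runs g c m k Q \<longleftrightarrow> (\<forall>b. (\<forall>a. int_size (m a) \<le> b) \<longrightarrow>
     (\<exists>t m'. exec c m t m' \<and> t \<le> k * (b + g * k) \<and> (\<forall>a. int_size (m' a) \<le> b + g * k) \<and> Q m'))"

lemma runs_mono:
  assumes "runs g c m k Q" "k \<le> k'" "\<And>m'. Q m' \<Longrightarrow> Q' m'"
  shows "runs g c m k' Q'"
  unfolding runs_def
proof (intro allI impI)
  fix b assume "\<forall>a. int_size (m a) \<le> b"
  with assms(1) obtain t m' where *: "exec c m t m'" "t \<le> k * (b + g * k)"
    "\<forall>a. int_size (m' a) \<le> b + g * k" "Q m'" unfolding runs_def by blast
  have "k * (b + g * k) \<le> k' * (b + g * k')" "b + g * k \<le> b + g * k'"
    using assms(2) by (simp_all add: mult_le_mono)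
  then show "\<exists>t m'. exec c m t m' \<and> t \<le> k' * (b + g * k') \<and> (\<forall>a. int_size (m' a) \<le> b + g * k') \<and> Q' m'"
    using * assms(3) by (meson order_trans)
qed

text \<open>The second command starts from words of \<open>b + g * k1\<close> bits. Word lengths
  grow linearly in the number of steps and not geometrically, so the bounds compose by adding
  \<open>k1\<close> and \<open>k2\<close>; the extra 1 pays for the command itself.\<close>

lemma runs_Seq:
  assumes "runs g c1 m k1 Q1" "\<And>m1. Q1 m1 \<Longrightarrow> runs g c2 m1 k2 Q" "1 + k1 + k2 \<le> k"
  shows "runs g (Seq c1 c2) m k Q"
proof (rule runs_mono[OF _ assms(3)])
  show "runs g (Seq c1 c2) m (1 + k1 + k2) Q"
    unfolding runs_def
  proof (intro allI impI)
    fix b assume "\<forall>a. int_size (m a) \<le> b"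
    with assms(1) obtain t1 m1 where 1: "exec c1 m t1 m1" "t1 \<le> k1 * (b + g * k1)"
      "\<forall>a. int_size (m1 a) \<le> b + g * k1" "Q1 m1" unfolding runs_def by blast
    from assms(2)[OF 1(4)] 1(3) obtain t2 m2 where 2: "exec c2 m1 t2 m2"
      "t2 \<le> k2 * (b + g * k1 + g * k2)" "\<forall>a. int_size (m2 a) \<le> b + g * k1 + g * k2" "Q m2"
      unfolding runs_def by blast
    let ?B = "b + g * (1 + k1 + k2)"
    have "1 \<le> b + g * k1" using 1(3) int_size_pos order_trans by blast
    then have "1 \<le> ?B" by (simp add: algebra_simps)
    moreover have "t1 \<le> k1 * ?B" by (rule cost_mono[OF 1(2)]) simp
    moreover have "t2 \<le> k2 * ?B" by (rule order_trans[OF 2(2)]) (simp add: algebra_simps)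
    ultimately have "1 + t1 + t2 \<le> 1 * ?B + k1 * ?B + k2 * ?B"
      unfolding mult_1 by (intro add_mono)
    then have "1 + t1 + t2 \<le> (1 + k1 + k2) * ?B" by (simp add: algebra_simps)
    moreover have "\<forall>a. int_size (m2 a) \<le> ?B"
    proof
      fix a
      have "b + g * k1 + g * k2 \<le> ?B" by (simp add: algebra_simps)
      then show "int_size (m2 a) \<le> ?B" using 2(3) order_trans by blast
    qed
    ultimately show "\<exists>t m'. exec (Seq c1 c2) m t m' \<and> t \<le> (1 + k1 + k2) * ?B \<and>
      (\<forall>a. int_size (m' a) \<le> ?B) \<and> Q m'"
      using exec.Seq[OF 1(1) 2(1)] 2(4) by blast
  qed
qed

lemma runs_Store:
  assumes "2 \<le> g" "expr_ok g a m" "expr_ok g e m" "Q (m(expr_val a m := expr_val e m))"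
    and "1 + esize a + esize e \<le> k"
  shows "runs g (Store a e) m k Q"
proof (rule runs_mono[OF _ assms(5)])
  show "runs g (Store a e) m (1 + esize a + esize e) Q"
    unfolding runs_def
  proof (intro allI impI)
    fix b assume b: "\<forall>a. int_size (m a) \<le> b"
    let ?B = "b + g * (1 + esize a + esize e)"
    have "1 \<le> b" using b int_size_pos order_trans by blast
    moreover have "expr_cost a m \<le> esize a * ?B"
      by (rule cost_mono[OF conjunct2[OF expr_bounds[OF b assms(1,2)]]]) simp
    moreover have "expr_cost e m \<le> esize e * ?B"
      by (rule cost_mono[OF conjunct2[OF expr_bounds[OF b assms(1,3)]]]) simp
    ultimately have "1 + expr_cost a m + expr_cost e m \<le> 1 * ?B + esize a * ?B + esize e * ?B"
      by (intro add_mono) simp_all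
    then have "1 + expr_cost a m + expr_cost e m \<le> (1 + esize a + esize e) * ?B"
      by (simp add: algebra_simps)
    moreover have "int_size ((m(expr_val a m := expr_val e m)) a') \<le> ?B" for a'
    proof -
      have "b + g * esize e \<le> ?B" "b \<le> ?B" by (simp_all add: algebra_simps)
      then show ?thesis using b expr_bounds[OF b assms(1,3)]
        by (auto intro: order_trans)
    qed
    ultimately show "\<exists>t m'. exec (Store a e) m t m' \<and> t \<le> (1 + esize a + esize e) * ?B \<and>
      (\<forall>a. int_size (m' a) \<le> ?B) \<and> Q m'"
      using exec.Store[of a e m] assms(4) by blast
  qed
qed

lemma runs_Skip:
  assumes "Q m" "1 \<le> k"
  shows "runs g Skip m k Q"
proof (rule runs_mono[OF _ assms(2)])
  show "runs g Skip m 1 Q" unfolding runs_def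
  proof (intro allI impI)
    fix b assume b: "\<forall>a. int_size (m a) \<le> b"
    then have "1 \<le> b" using int_size_pos order_trans by blast
    then show "\<exists>t m'. exec Skip m t m' \<and> t \<le> 1 * (b + g * 1) \<and> (\<forall>a. int_size (m' a) \<le> b + g * 1) \<and> Q m'"
      using exec.Skip[of m] assms(1) b by (intro exI[of _ 1] exI[of _ m]) (auto intro: trans_le_add1)
  qed
qed

text \<open>Shared by conditionals and loops, which evaluate a guard and go on with a command.\<close>

lemma runs_guarded:
  assumes "2 \<le> g" "expr_ok g e m" "runs g c m k1 Q" "1 + esize e + k1 \<le> k"
    and "\<And>t m'. exec c m t m' \<Longrightarrow> \<exists>t'\<le>1 + expr_cost e m + t. exec c' m t' m'"
  shows "runs g c' m k Q"
proof (rule runs_mono[OF _ assms(4)])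
  show "runs g c' m (1 + esize e + k1) Q"
    unfolding runs_def
  proof (intro allI impI)
    fix b assume b: "\<forall>a. int_size (m a) \<le> b"
    with assms(3) obtain t m1 where 1: "exec c m t m1" "t \<le> k1 * (b + g * k1)"
      "\<forall>a. int_size (m1 a) \<le> b + g * k1" "Q m1" unfolding runs_def by blast
    let ?B = "b + g * (1 + esize e + k1)"
    have "1 \<le> b" using b int_size_pos order_trans by blast
    moreover have "expr_cost e m \<le> esize e * ?B"
      by (rule cost_mono[OF conjunct2[OF expr_bounds[OF b assms(1,2)]]]) simp
    moreover have "t \<le> k1 * ?B" by (rule cost_mono[OF 1(2)]) simp
    ultimately have "1 + expr_cost e m + t \<le> 1 * ?B + esize e * ?B + k1 * ?B"
      by (intro add_mono) simp_all
    then have "1 + expr_cost e m + t \<le> (1 + esize e + k1) * ?B" by (simp add: algebra_simps)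
    moreover have "b + g * k1 \<le> ?B" by (simp add: algebra_simps)
    ultimately show "\<exists>t m'. exec c' m t m' \<and> t \<le> (1 + esize e + k1) * ?B \<and>
      (\<forall>a. int_size (m' a) \<le> ?B) \<and> Q m'"
      using assms(5)[OF 1(1)] 1(3,4) order_trans by meson
  qed
qed

lemma runs_Cond:
  assumes "2 \<le> g" "expr_ok g e m"
    and "expr_val e m \<noteq> 0 \<Longrightarrow> runs g c1 m k1 Q" "expr_val e m = 0 \<Longrightarrow> runs g c2 m k1 Q"
    and "1 + esize e + k1 \<le> k"
  shows "runs g (Cond e c1 c2) m k Q"
proof (cases "expr_val e m = 0")
  case True
  show ?thesis
    by (rule runs_guarded[OF assms(1,2) assms(4)[OF True] assms(5)]) (use exec.CondF[OF True] in blast)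
next
  case False
  show ?thesis
    by (rule runs_guarded[OF assms(1,2) assms(3)[OF False] assms(5)]) (use exec.CondT[OF False] in blast)
qed

lemma runs_WhileF:
  assumes "2 \<le> g" "expr_ok g e m" "expr_val e m = 0" "Q m" "2 + esize e \<le> k"
  shows "runs g (While e c) m k Q"
proof (rule runs_guarded[OF assms(1,2)])
  show "runs g Skip m 1 Q" using assms(4) by (rule runs_Skip) simp
  show "\<exists>t'\<le>1 + expr_cost e m + t. exec (While e c) m t' m'" if "exec Skip m t m'" for t m'
    using exec.WhileF[OF assms(3), of c] that
    by (intro exI[of _ "1 + expr_cost e m"]) (auto elim!: exec_SkipE)
qed (use assms(5) in simp)

lemma runs_WhileT:
  assumes "2 \<le> g" "expr_ok g e m" "expr_val e m \<noteq> 0"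
    and "runs g c m k1 Q1" "\<And>m1. Q1 m1 \<Longrightarrow> runs g (While e c) m1 k2 Q"
    and "2 + esize e + k1 + k2 \<le> k"
  shows "runs g (While e c) m k Q"
proof (rule runs_guarded[OF assms(1,2)])
  show "runs g (Seq c (While e c)) m (1 + k1 + k2) Q"
    using assms(4,5) by (rule runs_Seq) simp_all
  show "\<exists>t'\<le>1 + expr_cost e m + t. exec (While e c) m t' m'"
    if "exec (Seq c (While e c)) m t m'" for t m'
    using that
  proof (rule exec_SeqE)
    fix t1 m1 t2
    assume "t = Suc (t1 + t2)" "exec c m t1 m1" "exec (While e c) m1 t2 m'"
    then show ?thesis using exec.WhileT[OF assms(3), of c t1 m1 t2 m']
      by (intro exI[of _ "1 + expr_cost e m + t1 + t2"]) simp
  qed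
qed (use assms(6) in simp)

text \<open>The invariant is indexed by a rank that every iteration lowers. The rank thus bounds the
  number of iterations, and termination and cost come out of one induction; the additional round in
  \<open>Suc i\<close> is the last evaluation of the guard.\<close>

lemma runs_While:
  assumes g: "2 \<le> g"
    and ok: "\<And>i m. Inv i m \<Longrightarrow> expr_ok g e m"
    and body: "\<And>i m. Inv i m \<Longrightarrow> expr_val e m \<noteq> 0 \<Longrightarrow> runs g c m k (\<lambda>m'. \<exists>j<i. Inv j m')"
    and "Inv i m" "Suc i * (2 + esize e + k) \<le> k'"
  shows "runs g (While e c) m k' (\<lambda>m'. expr_val e m' = 0 \<and> (\<exists>j. Inv j m'))"
  using assms(4,5)
proof (induction i arbitrary: m k' rule: less_induct)
  case (less i)
  show ?case
  proof (cases "expr_val e m = 0")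
    case True
    show ?thesis
      by (rule runs_WhileF[OF g ok[OF less.prems(1)] True]) (use True less.prems in auto)
  next
    case False
    show ?thesis
    proof (rule runs_WhileT[OF g ok[OF less.prems(1)] False body[OF less.prems(1) False]])
      fix m1 assume "\<exists>j<i. Inv j m1"
      then obtain j where j: "j < i" "Inv j m1" by blast
      have "Suc j * (2 + esize e + k) \<le> i * (2 + esize e + k)"
        using j(1) by (intro mult_le_mono1) simp
      then show "runs g (While e c) m1 (i * (2 + esize e + k)) (\<lambda>m'. expr_val e m' = 0 \<and> (\<exists>j. Inv j m'))"
        by (rule less.IH[OF j])
    qed (use less.prems(2) in simp)
  qed
qed


section \<open>Arrays and structured programs\<close>

text \<open>The negative cells hold 64 interleaved arrays; scalar variables are arrays of length 1.\<close>

definition adr :: "nat \<Rightarrow> int \<Rightarrow> int" where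
  "adr x u = - 1 - int x - 64 * u"

lemma adr_eq_iff [simp]:
  assumes "x < 64" "y < 64"
  shows "adr x u = adr y v \<longleftrightarrow> x = y \<and> u = v"
proof
  assume "adr x u = adr y v"
  then have eq: "int x + u * 64 = int y + v * 64" by (simp add: adr_def)
  have "int x = (int x + u * 64) mod 64" "int y = (int y + v * 64) mod 64" using assms by simp_all
  then show "x = y \<and> u = v" using eq by simp
qed simp

lemma adr_neg: "0 \<le> u \<Longrightarrow> adr x u < 0"
  by (simp add: adr_def)

lemma adr_neq_nonneg [simp]:
  "0 \<le> u \<Longrightarrow> 0 \<le> v \<Longrightarrow> adr x u \<noteq> v" "0 \<le> u \<Longrightarrow> 0 \<le> v \<Longrightarrow> v \<noteq> adr x u"
  using adr_neg[of u x] by linarith+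

text \<open>Address arithmetic multiplies only by a constant. As 64 has \<open>int_size\<close> 8,
  this is where the requirement \<open>8 \<le> g\<close> comes from.\<close>

definition Adr :: "nat \<Rightarrow> expr \<Rightarrow> expr" where
  "Adr x e = Op Sub (Const (- 1 - int x)) (Op Mul (Const 64) e)"

definition Arr :: "nat \<Rightarrow> expr \<Rightarrow> expr" where
  "Arr x e = Load (Adr x e)"

definition Var :: "nat \<Rightarrow> expr" where
  "Var x = Arr x (Const 0)"

definition Put :: "nat \<Rightarrow> expr \<Rightarrow> expr \<Rightarrow> com" where
  "Put x e1 e2 = Store (Adr x e1) e2"

definition Set :: "nat \<Rightarrow> expr \<Rightarrow> com" where
  "Set x e = Put x (Const 0) e"

definition For :: "nat \<Rightarrow> expr \<Rightarrow> com \<Rightarrow> com" where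
  "For x e c = Seq (Set x (Const 0))
     (While (Op Less (Var x) e) (Seq c (Set x (Op Add (Var x) (Const 1)))))"

lemma expr_val_arr [simp]:
  "expr_val (Adr x e) m = adr x (expr_val e m)"
  "expr_val (Arr x e) m = m (adr x (expr_val e m))"
  "expr_val (Var x) m = m (adr x 0)"
  by (simp_all add: Adr_def Arr_def Var_def adr_def)

lemma esize_arr [simp]:
  "esize (Adr x e) = esize e + 4" "esize (Arr x e) = esize e + 5" "esize (Var x) = 6"
  by (simp_all add: Adr_def Arr_def Var_def)

lemma int_size_127 [simp]: "8 \<le> g \<Longrightarrow> \<bar>k\<bar> < 128 \<Longrightarrow> int_size k \<le> g"
  using int_size_small by blast

lemma expr_ok_arr [simp]:
  assumes "8 \<le> g" "x < 64"
  shows "expr_ok g (Adr x e) m \<longleftrightarrow> expr_ok g e m"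
    "expr_ok g (Arr x e) m \<longleftrightarrow> expr_ok g e m"
    "expr_ok g (Var x) m"
  using assms by (simp_all add: Adr_def Arr_def Var_def)

text \<open>Loop-free code is executed symbolically: \<open>post\<close> computes the final memory
  and \<open>com_ok\<close> collects the side conditions along the branch taken, so that such a
  piece of program is verified by simplification. Only loops need invariants.\<close>

fun loop_free :: "com \<Rightarrow> bool" where
  "loop_free (Seq c1 c2) \<longleftrightarrow> loop_free c1 \<and> loop_free c2"
| "loop_free (Cond e c1 c2) \<longleftrightarrow> loop_free c1 \<and> loop_free c2"
| "loop_free (While e c) \<longleftrightarrow> False"
| "loop_free _ \<longleftrightarrow> True"

fun post :: "com \<Rightarrow> memory \<Rightarrow> memory" where
  "post (Store a e) m = m(expr_val a m := expr_val e m)"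
| "post (Seq c1 c2) m = post c2 (post c1 m)"
| "post (Cond e c1 c2) m = (if expr_val e m \<noteq> 0 then post c1 m else post c2 m)"
| "post _ m = m"

fun com_ok :: "nat \<Rightarrow> com \<Rightarrow> memory \<Rightarrow> bool" where
  "com_ok g (Store a e) m \<longleftrightarrow> expr_ok g a m \<and> expr_ok g e m"
| "com_ok g (Seq c1 c2) m \<longleftrightarrow> com_ok g c1 m \<and> com_ok g c2 (post c1 m)"
| "com_ok g (Cond e c1 c2) m \<longleftrightarrow> expr_ok g e m \<and> (if expr_val e m \<noteq> 0 then com_ok g c1 m else com_ok g c2 m)"
| "com_ok g _ m \<longleftrightarrow> True"

fun csize :: "com \<Rightarrow> nat" where
  "csize (Store a e) = 1 + esize a + esize e"
| "csize (Seq c1 c2) = 1 + csize c1 + csize c2"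
| "csize (Cond e c1 c2) = 1 + esize e + csize c1 + csize c2"
| "csize _ = 1"

lemma post_arr [simp]:
  "post (Put x e1 e2) m = m(adr x (expr_val e1 m) := expr_val e2 m)"
  "post (Set x e) m = m(adr x 0 := expr_val e m)"
  by (simp_all add: Put_def Set_def)

lemma com_ok_arr [simp]:
  assumes "8 \<le> g" "x < 64"
  shows "com_ok g (Put x e1 e2) m \<longleftrightarrow> expr_ok g e1 m \<and> expr_ok g e2 m"
    "com_ok g (Set x e) m \<longleftrightarrow> expr_ok g e m"
  using assms by (simp_all add: Put_def Set_def)

lemma csize_arr [simp]:
  "csize (Put x e1 e2) = 5 + esize e1 + esize e2" "csize (Set x e) = 6 + esize e"
  by (simp_all add: Put_def Set_def)

lemma loop_free_arr [simp]: "loop_free (Put x e1 e2)" "loop_free (Set x e)"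
  by (simp_all add: Put_def Set_def)

lemma runs_loop_free:
  assumes "2 \<le> g" "loop_free c" "com_ok g c m" "Q (post c m)" "csize c \<le> k"
  shows "runs g c m k Q"
proof -
  have "runs g c m (csize c) Q"
    using assms(2,3,4)
  proof (induction c arbitrary: m Q)
    case (Seq c1 c2)
    then show ?case by (intro runs_Seq[of g c1 m "csize c1" "\<lambda>m1. m1 = post c1 m"]) auto
  next
    case (Cond e c1 c2)
    show ?case
    proof (rule runs_Cond[of g e m c1 "csize c1 + csize c2"])
      show "runs g c1 m (csize c1 + csize c2) Q" if "expr_val e m \<noteq> 0"
        by (rule runs_mono[OF Cond.IH(1)]) (use Cond.prems that in auto)
      show "runs g c2 m (csize c1 + csize c2) Q" if "expr_val e m = 0"
        by (rule runs_mono[OF Cond.IH(2)]) (use Cond.prems that in auto)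
    qed (use assms(1) Cond.prems in auto)
  qed (use assms(1) in \<open>auto intro: runs_Store runs_Skip\<close>)
  then show ?thesis using assms(5) by (rule runs_mono)
qed

lemma runs_Seq_loop_free:
  assumes "2 \<le> g" "loop_free c1" "com_ok g c1 m" "runs g c2 (post c1 m) k Q"
  shows "runs g (Seq c1 c2) m (Suc (csize c1) + k) Q"
  using assms(4)
  by (intro runs_Seq[OF runs_loop_free[OF assms(1-3), where Q = "\<lambda>m1. m1 = post c1 m"]]) auto

text \<open>The loop counter is itself a memory cell, so the body has to leave it alone and the
  invariant has to survive its increment. The upper limit \<open>e\<close> is evaluated anew in
  every round; \<open>ub\<close> says that it keeps the value \<open>N\<close>.\<close>

lemma runs_For:
  assumes g: "8 \<le> g" "x < 64"
    and ub: "\<And>j m. Inv j m \<Longrightarrow> expr_ok g e m \<and> expr_val e m = int N"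
    and init: "Inv 0 (m(adr x 0 := 0))"
    and body: "\<And>j m. j < N \<Longrightarrow> Inv j m \<Longrightarrow> m (adr x 0) = int j \<Longrightarrow>
      runs g c m k (\<lambda>m'. m' (adr x 0) = int j \<and> Inv (Suc j) (m'(adr x 0 := int (Suc j))))"
    and k': "Suc N * (k + esize e + 40) \<le> k'"
  shows "runs g (For x e c) m k' (\<lambda>m'. m' (adr x 0) = int N \<and> Inv N m')"
  unfolding For_def
proof (rule runs_Seq)
  let ?Inv = "\<lambda>i m. \<exists>j\<le>N. i = N - j \<and> m (adr x 0) = int j \<and> Inv j m"
  show "runs g (Set x (Const 0)) m 7 (\<lambda>m1. m1 = m(adr x 0 := 0))"
    by (rule runs_loop_free) (use g in auto)
  fix m1 assume m1: "m1 = m(adr x 0 := 0)"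
  show "runs g (While (Op Less (Var x) e) (Seq c (Set x (Op Add (Var x) (Const 1))))) m1
    (Suc N * (2 + esize (Op Less (Var x) e) + (k + 15))) (\<lambda>m'. m' (adr x 0) = int N \<and> Inv N m')"
  proof (rule runs_mono[OF runs_While[where Inv = ?Inv and i = N]])
    fix i m assume "?Inv i m" and "expr_val (Op Less (Var x) e) m \<noteq> 0"
    then obtain j where j: "i = N - j" "m (adr x 0) = int j" "Inv j m" "j < N"
      using ub by (auto split: if_splits)
    show "runs g (Seq c (Set x (Op Add (Var x) (Const 1)))) m (k + 15) (\<lambda>m'. \<exists>j<i. ?Inv j m')"
    proof (rule runs_Seq[OF body[OF j(4,3,2)]])
      fix m1 assume m1: "m1 (adr x 0) = int j \<and> Inv (Suc j) (m1(adr x 0 := int (Suc j)))"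
      show "runs g (Set x (Op Add (Var x) (Const 1))) m1 14 (\<lambda>m'. \<exists>j<i. ?Inv j m')"
      proof (rule runs_loop_free)
        have inv: "?Inv (N - Suc j) (post (Set x (Op Add (Var x) (Const 1))) m1)"
          using m1 j(4) by (intro exI[of _ "Suc j"]) (simp add: add.commute)
        show "\<exists>j<i. ?Inv j (post (Set x (Op Add (Var x) (Const 1))) m1)"
          by (rule exI, rule conjI[OF _ inv]) (use j(1,4) in simp)
      qed (use g in auto)
    qed simp
  next
    show "?Inv N m1" using init m1 by auto
  next
    fix m' assume m': "expr_val (Op Less (Var x) e) m' = 0 \<and> (\<exists>i. ?Inv i m')"
    then obtain j where j: "j \<le> N" "m' (adr x 0) = int j" "Inv j m'" by auto
    moreover have "\<not> j < N" using m' ub[OF j(3)] j(2) by (auto split: if_splits)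
    ultimately show "m' (adr x 0) = int N \<and> Inv N m'" by auto
  qed (use g ub in auto)
next
  show "1 + 7 + Suc N * (2 + esize (Op Less (Var x) e) + (k + 15)) \<le> k'"
    using k' by (simp add: algebra_simps)
qed

text \<open>A frame condition: outside the arrays in \<open>X\<close> nothing has changed. The
  nonnegative cells hold the input and stay fixed until the output is written, so that sizes and
  adjacency can be read from them at any time.\<close>

definition agree :: "nat set \<Rightarrow> memory \<Rightarrow> memory \<Rightarrow> bool" where
  "agree X m m' \<longleftrightarrow> (\<forall>x u. x < 64 \<longrightarrow> x \<notin> X \<longrightarrow> 0 \<le> u \<longrightarrow> m' (adr x u) = m (adr x u)) \<and>
     (\<forall>u\<ge>0. m' u = m u)"

lemma agree_refl [simp]: "agree X m m"
  by (simp add: agree_def)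

lemma agree_trans: "agree X m m1 \<Longrightarrow> agree X' m1 m2 \<Longrightarrow> X \<subseteq> Y \<Longrightarrow> X' \<subseteq> Y \<Longrightarrow> agree Y m m2"
  unfolding agree_def by (simp add: subset_iff) metis

lemma agree_upd [simp]:
  "agree X m m' \<Longrightarrow> x \<in> X \<Longrightarrow> x < 64 \<Longrightarrow> 0 \<le> u \<Longrightarrow> agree X m (m'(adr x u := v))"
  unfolding agree_def by auto

lemma agreeD: "agree X m m' \<Longrightarrow> x \<notin> X \<Longrightarrow> x < 64 \<Longrightarrow> 0 \<le> u \<Longrightarrow> m' (adr x u) = m (adr x u)"
  unfolding agree_def by auto

lemma agree_input: "agree X m m' \<Longrightarrow> 0 \<le> u \<Longrightarrow> m' u = m u"
  unfolding agree_def by auto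


section \<open>Local search for covering with profits\<close>

text \<open>Since \<open>65 / 24\<close> is the truncation \<open>1 + 1/1! + 1/2! + 1/3! + 1/4!\<close> of \<open>e\<close>, the recursion
  \<open>dd (c + 1) = (c + 1) * dd c - 24\<close> started with 41 reaches 0 after four steps.\<close>

definition dd :: "nat \<Rightarrow> int" where
  "dd c = (if c = 0 then 41 else if c = 1 then 17 else if c = 2 then 10 else if c = 3 then 6 else 0)"

lemma dd_nonneg: "0 \<le> dd c" and dd_antimono: "b \<le> c \<Longrightarrow> dd c \<le> dd b"
  by (auto simp: dd_def)

text \<open>This is the recursion of \<open>dd\<close> read as an inequality, with
  \<open>65 = 41 + 24\<close>; it is tight for \<open>c \<le> 4\<close>, and from 5 on the
  right-hand side is 0.\<close>

lemma dd_step: "41 - (if c = 0 then 0 else 65) \<le> dd c - int c * dd (c - 1)"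
proof -
  consider "c = 0" | "c = 1" | "c = 2" | "c = 3" | "c = 4" | "5 \<le> c" by linarith
  then show ?thesis by cases (auto simp: dd_def)
qed

definition others :: "(nat \<Rightarrow> nat set) \<Rightarrow> nat \<Rightarrow> nat \<Rightarrow> nat \<Rightarrow> nat" where
  "others A h i j = card {i'. i' < h \<and> i' \<noteq> i \<and> j \<in> A i'}"

definition cover :: "(nat \<Rightarrow> nat set) \<Rightarrow> nat \<Rightarrow> nat \<Rightarrow> nat" where
  "cover A h j = card {i'. i' < h \<and> j \<in> A i'}"

lemma others_le_cover: "others A h i j \<le> cover A h j"
  unfolding others_def cover_def by (rule card_mono) auto

lemma cover_others:
  assumes "i < h"
  shows "cover A h j = others A h i j + (if j \<in> A i then 1 else 0)"
proof (cases "j \<in> A i")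
  case True
  have "{i'. i' < h \<and> j \<in> A i'} = insert i {i'. i' < h \<and> i' \<noteq> i \<and> j \<in> A i'}"
    using True assms by auto
  then show ?thesis using True by (simp add: cover_def others_def)
next
  case False
  then have "{i'. i' < h \<and> j \<in> A i'} = {i'. i' < h \<and> i' \<noteq> i \<and> j \<in> A i'}" by auto
  then show ?thesis using False by (simp add: cover_def others_def)
qed

definition gain :: "(nat \<Rightarrow> int) \<Rightarrow> (nat \<Rightarrow> nat set) \<Rightarrow> nat \<Rightarrow> nat \<Rightarrow> nat \<Rightarrow> int" where
  "gain v A h i j = v j * dd (others A h i j)"

text \<open>The assignment \<open>ob\<close> provides each bin with an alternative that is no better
  than its current configuration. Summed over the bins, an item occurs once among the alternatives,
  with \<open>others\<close> at most \<open>cover\<close>, and \<open>cover\<close> many times among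
  the configurations, with \<open>others\<close> one less than \<open>cover\<close>. By
  \<open>dd_step\<close> the difference per item is at least 41 times its profit, reduced by 65
  times its profit if it is covered.\<close>

lemma local_optimum_bound:
  assumes S: "finite S" "\<And>i. i < h \<Longrightarrow> A i \<subseteq> S" "\<And>j. j \<in> S \<Longrightarrow> ob j < h"
    and v: "\<And>j. j \<in> S \<Longrightarrow> 0 \<le> v j"
    and opt: "\<And>i. i < h \<Longrightarrow> (\<Sum>j | j \<in> S \<and> ob j = i. gain v A h i j) \<le> (\<Sum>j\<in>A i. gain v A h i j)"
  shows "65 * (\<Sum>j | j \<in> S \<and> (\<forall>i<h. j \<notin> A i). v j) \<le> 24 * (\<Sum>j\<in>S. v j)"
proof -
  have "(\<Sum>j\<in>S. v j * dd (cover A h j)) \<le> (\<Sum>j\<in>S. gain v A h (ob j) j)"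
    unfolding gain_def using v S(3)
    by (intro sum_mono mult_left_mono dd_antimono others_le_cover)
  also have "\<dots> = (\<Sum>i<h. \<Sum>j | j \<in> S \<and> ob j = i. gain v A h i j)"
    using S(1,3) by (subst sum.group[of S "{..<h}" ob, symmetric]) (auto intro!: sum.cong)
  also have "\<dots> \<le> (\<Sum>i<h. \<Sum>j\<in>A i. gain v A h i j)"
    using opt by (intro sum_mono) auto
  also have "\<dots> = (\<Sum>i<h. \<Sum>j\<in>S. if j \<in> A i then gain v A h i j else 0)"
    by (rule sum.cong[OF refl]) (use S(1,2) in \<open>simp add: sum.If_cases Int_absorb1\<close>)
  also have "\<dots> = (\<Sum>j\<in>S. \<Sum>i<h. if j \<in> A i then gain v A h i j else 0)"
    by (rule sum.swap)
  also have "\<dots> = (\<Sum>j\<in>S. v j * (int (cover A h j) * dd (cover A h j - 1)))"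
  proof (intro sum.cong refl)
    fix j
    have "(\<Sum>i<h. if j \<in> A i then gain v A h i j else 0) =
        (\<Sum>i<h. if j \<in> A i then v j * dd (cover A h j - 1) else 0)"
      unfolding gain_def by (intro sum.cong refl) (auto simp: cover_others)
    also have "\<dots> = int (card ({..<h} \<inter> {i. j \<in> A i})) * (v j * dd (cover A h j - 1))"
      by (simp add: sum.If_cases)
    also have "{..<h} \<inter> {i. j \<in> A i} = {i. i < h \<and> j \<in> A i}" by auto
    finally show "(\<Sum>i<h. if j \<in> A i then gain v A h i j else 0) =
        v j * (int (cover A h j) * dd (cover A h j - 1))"
      by (simp add: cover_def)
  qed
  finally have *: "(\<Sum>j\<in>S. v j * (dd (cover A h j) - int (cover A h j) * dd (cover A h j - 1))) \<le> 0"
    by (simp add: right_diff_distrib sum_subtractf)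
  have "(\<Sum>j\<in>S. v j * (41 - (if cover A h j = 0 then 0 else 65))) \<le> 0"
    by (rule order_trans[OF _ *]) (intro sum_mono mult_left_mono v dd_step)
  moreover have "(\<Sum>j\<in>S. v j * (41 - (if cover A h j = 0 then 0 else 65))) =
    (\<Sum>j\<in>S. (if cover A h j = 0 then 65 * v j else 0) - 24 * v j)"
    by (intro sum.cong) auto
  moreover have "(\<Sum>j\<in>S. if cover A h j = 0 then 65 * v j else 0) =
    65 * (\<Sum>j | j \<in> S \<and> (\<forall>i<h. j \<notin> A i). v j)"
    using S(1) by (auto simp: sum.If_cases sum_distrib_left cover_def Int_def intro!: sum.cong)
  ultimately show ?thesis by (simp add: sum_subtractf sum_distrib_left)
qed

text \<open>This is the Rosenthal potential of a congestion game in which bin \<open>i\<close> earns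
  \<open>gain v A h i j\<close> from an item \<open>j\<close> that it covers: if one bin changes its
  configuration, the potential changes by exactly the change of what this bin earns.\<close>

definition potential :: "(nat \<Rightarrow> int) \<Rightarrow> nat set \<Rightarrow> (nat \<Rightarrow> nat set) \<Rightarrow> nat \<Rightarrow> int" where
  "potential v S A h = (\<Sum>j\<in>S. v j * (\<Sum>c<cover A h j. dd c))"

text \<open>\<open>74 = 41 + 17 + 10 + 6\<close>, and later terms vanish. Hence the potential stays
  within a constant factor of the total profit, which keeps the search short.\<close>

lemma sum_dd_le: "(\<Sum>c<a. dd c) \<le> 74"
proof -
  have "(\<Sum>c<a. dd c) \<le> (\<Sum>c<a + 4. dd c)"
    by (intro sum_mono2) (auto simp: dd_nonneg)
  also have "\<dots> = (\<Sum>c<4. dd c)"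
    by (rule sum.mono_neutral_right) (auto simp: dd_def)
  also have "\<dots> = 74" by (simp add: dd_def numeral_eq_Suc)
  finally show ?thesis .
qed

lemma potential_bounds:
  assumes "\<And>j. j \<in> S \<Longrightarrow> 0 \<le> v j"
  shows "0 \<le> potential v S A h" "potential v S A h \<le> 74 * (\<Sum>j\<in>S. v j)"
proof -
  show "0 \<le> potential v S A h"
    unfolding potential_def by (intro sum_nonneg mult_nonneg_nonneg assms dd_nonneg)
  have "potential v S A h \<le> (\<Sum>j\<in>S. v j * 74)"
    unfolding potential_def by (intro sum_mono mult_left_mono assms sum_dd_le)
  then show "potential v S A h \<le> 74 * (\<Sum>j\<in>S. v j)"
    by (simp add: sum_distrib_right mult.commute)
qed

lemma others_upd [simp]: "others (A(i := C)) h i j = others A h i j"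
  unfolding others_def by (rule arg_cong[of _ _ card]) auto

text \<open>The first sum does not depend on \<open>A i\<close>, so the whole influence of bin
  \<open>i\<close> is in the second one.\<close>

lemma potential_split:
  assumes "finite S" "A i \<subseteq> S" "i < h"
  shows "potential v S A h =
    (\<Sum>j\<in>S. v j * (\<Sum>c<others A h i j. dd c)) + (\<Sum>j\<in>A i. gain v A h i j)"
proof -
  have "(\<Sum>j\<in>A i. gain v A h i j) = (\<Sum>j\<in>S. if j \<in> A i then gain v A h i j else 0)"
    using assms(1,2) by (simp add: sum.If_cases Int_absorb1)
  then show ?thesis
    unfolding potential_def
    by (auto simp: cover_others[OF assms(3)] gain_def distrib_left simp flip: sum.distrib
        intro!: sum.cong)
qed

lemma potential_upd:
  assumes "finite S" "A i \<subseteq> S" "C \<subseteq> S" "i < h"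
  shows "potential v S (A(i := C)) h =
    potential v S A h + (\<Sum>j\<in>C. gain v A h i j) - (\<Sum>j\<in>A i. gain v A h i j)"
proof -
  have "potential v S (A(i := C)) h =
    (\<Sum>j\<in>S. v j * (\<Sum>c<others A h i j. dd c)) + (\<Sum>j\<in>C. gain v A h i j)"
    using potential_split[of S "A(i := C)" i h v] assms by (simp add: gain_def)
  moreover have "potential v S A h =
    (\<Sum>j\<in>S. v j * (\<Sum>c<others A h i j. dd c)) + (\<Sum>j\<in>A i. gain v A h i j)"
    using assms by (intro potential_split) auto
  ultimately show ?thesis by linarith
qed


section \<open>First fit\<close>

text \<open>A bin weighs at least \<open>20 * D\<close> if it has an item above
  \<open>D / 2\<close>, because of the bonus, or if its load is at least \<open>20 * D / 38\<close>.
  At most two bins escape both cases. Any two bins together hold more than \<open>D\<close>, since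
  an item of the later one did not fit into the earlier one, and so weigh more than
  \<open>38 * D\<close>: a loss of \<open>2 * D\<close> in total.\<close>

lemma first_fit_bound:
  fixes w :: "nat \<Rightarrow> int"
  assumes R: "finite R" "\<And>j. j \<in> R \<Longrightarrow> lb j < k" "\<And>j. j \<in> R \<Longrightarrow> 0 \<le> w j"
    and D: "0 < D" and k: "2 \<le> k"
    and f: "\<And>b. b < k \<Longrightarrow> f b = (\<Sum>j | j \<in> R \<and> lb j = b. w j)"
    and ne: "\<And>b. b < k \<Longrightarrow> \<exists>j\<in>R. lb j = b"
    and ff: "\<And>b j. b < lb j \<Longrightarrow> j \<in> R \<Longrightarrow> D < f b + w j"
  shows "D * (20 * int k - 2) < (\<Sum>j\<in>R. 38 * w j + (if D < 2 * w j then D else 0))"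
proof -
  define W where "W = (\<lambda>b. \<Sum>j | j \<in> R \<and> lb j = b. 38 * w j + (if D < 2 * w j then D else 0))"
  have total: "(\<Sum>j\<in>R. 38 * w j + (if D < 2 * w j then D else 0)) = (\<Sum>b<k. W b)"
    unfolding W_def using R(1,2) by (subst sum.group[of R "{..<k}" lb, symmetric]) auto
  have fin: "finite {j. j \<in> R \<and> lb j = b}" for b using R(1) by simp
  have item: "w j \<le> f b" if "j \<in> R" "lb j = b" "b < k" for j b
    unfolding f[OF that(3)] using that R by (intro member_le_sum) auto
  have W_ge: "38 * f b \<le> W b" if "b < k" for b
    unfolding f[OF that] W_def sum_distrib_left using D by (intro sum_mono) auto
  have W_big: "38 * f b + D \<le> W b" if "b < k" "j \<in> R" "lb j = b" "D < 2 * w j" for b j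
  proof -
    have "(if D < 2 * w j then D else 0) \<le> (\<Sum>j | j \<in> R \<and> lb j = b. if D < 2 * w j then D else 0)"
      using fin D that(2,3) by (intro member_le_sum) auto
    then have "D \<le> (\<Sum>j | j \<in> R \<and> lb j = b. if D < 2 * w j then D else 0)" using that(4) by simp
    then show ?thesis unfolding f[OF that(1)] W_def sum.distrib by (simp flip: sum_distrib_left)
  qed
  have pair: "D < f b + f b'" if "b < b'" "b' < k" for b b'
    using ne[OF that(2)] ff[of b] item that by fastforce
  have small: "2 * w j \<le> D" if "b < k" "W b < 20 * D" "j \<in> R" "lb j = b" for b j
    using W_big[OF that(1,3,4)] item[OF that(3,4,1)] that(2) by linarith
  define T where "T = {b. b < k \<and> W b < 20 * D}"
  \<comment> \<open>The items of light bins are at most \<open>D / 2\<close>. Two items in the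
    middle bin would each exceed \<open>D - f b1\<close>, too much for light bins; so the middle bin
    has a single item, of size at most \<open>D / 2\<close>, and any item of the third bin would
    have fitted next to it.\<close>
  have no_three: False if "b1 \<in> T" "b2 \<in> T" "b3 \<in> T" "b1 < b2" "b2 < b3" for b1 b2 b3
  proof -
    have lt: "b1 < k" "b2 < k" "b3 < k" using that by (auto simp: T_def)
    have d: "W b1 < 20 * D" "W b2 < 20 * D" "W b3 < 20 * D" using that by (auto simp: T_def)
    obtain j where j: "j \<in> R" "lb j = b2" using ne[OF lt(2)] by blast
    have "l = j" if l: "l \<in> R" "lb l = b2" for l
    proof (rule ccontr)
      assume "l \<noteq> j"
      then have "w j + w l = (\<Sum>j\<in>{j, l}. w j)" by simp
      also have "\<dots> \<le> f b2"
        unfolding f[OF lt(2)] using fin j l R by (intro sum_mono2) auto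
      finally have "w j + w l \<le> f b2" .
      moreover have "D < f b1 + w j" "D < f b1 + w l" using ff j l \<open>b1 < b2\<close> by auto
      moreover have "38 * f b1 < 20 * D" "38 * f b2 < 20 * D"
        using W_ge[OF lt(1)] W_ge[OF lt(2)] d by linarith+
      ultimately show False using D by linarith
    qed
    then have "{l. l \<in> R \<and> lb l = b2} = {j}" using j by blast
    then have "f b2 = w j" using f[OF lt(2)] by simp
    moreover obtain i where i: "i \<in> R" "lb i = b3" using ne[OF lt(3)] by blast
    moreover have "D < f b2 + w i" using ff[of b2 i] i \<open>b2 < b3\<close> by simp
    ultimately show False using small[OF lt(2) d(2) j] small[OF lt(3) d(3) i] by linarith
  qed
  have "finite T" by (simp add: T_def)
  have "card T \<le> 2"
  proof (rule ccontr)
    assume "\<not> card T \<le> 2"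
    then obtain U where "U \<subseteq> T" "card U = 3" using obtain_subset_with_card_n[of 3 T] by force
    then obtain x y z where "U = {x, y, z}" "x \<noteq> y" "x \<noteq> z" "y \<noteq> z" unfolding card_3_iff by blast
    then have "{x, y, z} \<subseteq> T" using \<open>U \<subseteq> T\<close> by simp
    then show False using no_three \<open>x \<noteq> y\<close> \<open>x \<noteq> z\<close> \<open>y \<noteq> z\<close>
      by (metis insert_subset linorder_neqE_nat)
  qed
  moreover have "T \<subseteq> {..<k}" by (auto simp: T_def)
  \<comment> \<open>If fewer than two bins are light, \<open>T\<close> is padded to a pair; the
    bound for pairs holds for any two bins.\<close>
  ultimately obtain U where U: "T \<subseteq> U" "U \<subseteq> {..<k}" "card U = 2"
    using k exists_subset_between[of T 2 "{..<k}"] by auto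
  then obtain b b' where bb: "U = {b, b'}" "b < b'" unfolding card_2_iff
    by (metis insert_commute linorder_neqE_nat)
  then have "38 * D < W b + W b'" using W_ge[of b] W_ge[of b'] pair[of b b'] U(2) by auto
  moreover have "(\<Sum>b\<in>{..<k} - U. 20 * D) \<le> (\<Sum>b\<in>{..<k} - U. W b)"
    using U(1) by (intro sum_mono) (auto simp: T_def)
  moreover have "card ({..<k} - U) = k - 2" using U by (subst card_Diff_subset) (auto intro: finite_subset)
  moreover have "(\<Sum>b<k. W b) = W b + W b' + (\<Sum>b\<in>{..<k} - U. W b)"
    using U(2) bb by (subst sum.subset_diff[OF U(2)]) auto
  ultimately have "38 * D + int (k - 2) * (20 * D) < (\<Sum>b<k. W b)" by simp
  moreover have "38 * D + int (k - 2) * (20 * D) = D * (20 * int k - 2)"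
    using k by (simp add: of_nat_diff algebra_simps)
  ultimately show ?thesis using total by simp
qed


section \<open>Recognition of split graphs\<close>

text \<open>A vertex is \<open>good\<close> if its nonneighbours are independent. Vertices of
  \<open>K\<close> are good, as their nonneighbours lie in \<open>S\<close>; so a clique
  \<open>Q\<close> of good vertices that is maximal can replace \<open>K\<close>, even if it
  contains vertices of \<open>S\<close>. Of two adjacent vertices outside \<open>Q\<close>, one is
  in \<open>K\<close> and by maximality misses some \<open>a\<close> in \<open>Q\<close>. Then
  \<open>a\<close> misses the other one too, against the goodness of \<open>a\<close>.\<close>

lemma split_partition:
  fixes adj :: "nat \<Rightarrow> nat \<Rightarrow> bool" and n :: nat
  defines "good \<equiv> \<lambda>x. \<forall>a<n. \<forall>b<n. \<not> adj x a \<and> \<not> adj x b \<longrightarrow> \<not> adj a b"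
  assumes sym: "\<And>a b. adj a b \<longleftrightarrow> adj b a"
    and split: "K \<union> S = {..<n}"
      "\<And>a b. a \<in> K \<Longrightarrow> b \<in> K \<Longrightarrow> a \<noteq> b \<Longrightarrow> adj a b" "\<And>a b. a \<in> S \<Longrightarrow> b \<in> S \<Longrightarrow> a \<noteq> b \<Longrightarrow> \<not> adj a b"
    and irrefl: "\<And>a. \<not> adj a a"
    and Q: "Q \<subseteq> {..<n}" "\<And>a. a \<in> Q \<Longrightarrow> good a" "\<And>a b. a \<in> Q \<Longrightarrow> b \<in> Q \<Longrightarrow> a \<noteq> b \<Longrightarrow> adj a b"
    and max: "\<And>x. x < n \<Longrightarrow> x \<notin> Q \<Longrightarrow> good x \<Longrightarrow> \<exists>a\<in>Q. \<not> adj x a"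
    and xy: "x < n" "y < n" "x \<notin> Q" "y \<notin> Q"
  shows "\<not> adj x y"
proof
  assume "adj x y"
  have K_good: "good x" if "x \<in> K" for x
    unfolding good_def
  proof (intro allI impI notI)
    fix a b assume ab: "a < n" "b < n" "\<not> adj x a \<and> \<not> adj x b" "adj a b"
    have "a \<noteq> x" "b \<noteq> x" using ab sym by blast+
    then have "a \<in> S" "b \<in> S" using ab split(1,2) that by blast+
    then show False using split(3) irrefl ab(4) by metis
  qed
  have main: False if x: "x \<in> K" "x \<notin> Q" and y: "y < n" "y \<notin> Q" and "adj x y" for x y
  proof -
    have "x < n" using x split(1) by blast
    then obtain a where a: "a \<in> Q" "\<not> adj x a" using max[OF _ x(2) K_good[OF x(1)]] by blast
    have aS: "a \<in> S" using a x split(1,2) Q(1) by blast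
    have "\<not> adj a y"
    proof (cases "y \<in> K")
      case True
      then obtain b where b: "b \<in> Q" "\<not> adj y b" using max[OF y K_good] by blast
      then have "b \<in> S" using True y split(1,2) Q(1) by blast
      then have "a = b" using Q(3) split(3) a aS b by blast
      then show ?thesis using b sym by blast
    next
      case False
      then have "y \<in> S" using y split(1) by blast
      then show ?thesis using split(3) aS a(1) y(2) by blast
    qed
    then show False using Q(2)[OF a(1)] a(2) sym \<open>adj x y\<close> \<open>x < n\<close> y(1) unfolding good_def by blast
  qed
  show False
  proof (cases "x \<in> K")
    case True
    then show False using main xy \<open>adj x y\<close> by blast
  next
    case False
    then have "x \<in> S" using split(1) xy by blast
    then have "y \<in> K" using split(1,3) \<open>adj x y\<close> irrefl xy by blast
    then show False using main xy \<open>adj x y\<close> sym by blast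
  qed
qed


section \<open>Packings of split instances\<close>

locale bpc_data =
  fixes n :: nat and num den :: "nat \<Rightarrow> int" and adj :: "nat \<Rightarrow> nat \<Rightarrow> bool"
  assumes den_pos: "j < n \<Longrightarrow> 0 < den j"
    and num_nonneg: "j < n \<Longrightarrow> 0 \<le> num j"
    and num_le_den: "j < n \<Longrightarrow> num j \<le> den j"
    and adj_sym: "adj a b \<longleftrightarrow> adj b a"
    and adj_irrefl: "\<not> adj a a"
begin

text \<open>A common denominator, not the least one: the product takes one simple loop, and its bit
  length is at most the sum of the lengths of the denominators.\<close>

definition D :: int where "D = (\<Prod>j<n. den j)"

definition w :: "nat \<Rightarrow> int" where "w j = num j * (D div den j)"

text \<open>The profit of an item is \<open>n\<close> times its weight in the analysis of first fit, rounded up to a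
  positive integer.\<close>

definition v :: "nat \<Rightarrow> int" where
  "v j = (38 * (int n * num j)) div den j + (if den j < 2 * num j then int n else 0) + 1"

definition valid_labels :: "nat \<Rightarrow> (nat \<Rightarrow> nat) \<Rightarrow> bool" where
  "valid_labels h lab \<longleftrightarrow> (\<forall>j<n. lab j < h) \<and> (\<forall>i<n. \<forall>j<n. lab i = lab j \<longrightarrow> \<not> adj i j) \<and>
     (\<forall>b. (\<Sum>j | j < n \<and> lab j = b. w j) \<le> D)"

lemma D_pos: "0 < D"
  unfolding D_def by (intro prod_pos) (auto simp: den_pos)

lemma den_dvd: "j < n \<Longrightarrow> den j dvd D"
  unfolding D_def by (rule dvd_prodI) auto

lemma w_den: "j < n \<Longrightarrow> w j * den j = num j * D"
  by (simp add: w_def den_dvd mult.assoc)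

lemma w_nonneg: "j < n \<Longrightarrow> 0 \<le> w j"
  unfolding w_def using D_pos den_pos num_nonneg by (simp add: pos_imp_zdiv_nonneg_iff)

lemma w_le_D: 
  assumes "j < n"
  shows "w j \<le> D"
proof -
  have "w j * den j \<le> D * den j"
    unfolding w_den[OF assms] using mult_right_mono[OF num_le_den[OF assms], of D] D_pos
    by (simp add: mult.commute)
  then show ?thesis using den_pos[OF assms] by simp
qed

lemma big_iff:
  assumes "j < n"
  shows "den j < 2 * num j \<longleftrightarrow> D < 2 * w j"
proof -
  have "D < 2 * w j \<longleftrightarrow> D * den j < (2 * w j) * den j" using den_pos[OF assms] by simp
  also have "\<dots> \<longleftrightarrow> den j * D < (2 * num j) * D" by (simp add: mult.assoc w_den[OF assms] mult.commute[of D])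
  also have "\<dots> \<longleftrightarrow> den j < 2 * num j" using D_pos by simp
  finally show ?thesis by simp
qed

lemma v_pos: "j < n \<Longrightarrow> 1 \<le> v j"
  unfolding v_def using den_pos[of j] num_nonneg[of j] by (simp add: pos_imp_zdiv_nonneg_iff)

lemma v_le:
  assumes "j < n"
  shows "v j \<le> 40 * int n"
proof -
  have "(38 * (int n * num j)) div den j \<le> (38 * int n * den j) div den j"
    using num_le_den[OF assms] den_pos[OF assms] by (intro zdiv_mono1) (auto simp: mult_left_mono)
  also have "\<dots> = 38 * int n" using den_pos[OF assms] by simp
  finally show ?thesis using assms by (simp add: v_def)
qed

text \<open>Rounding costs at most one unit of profit per item, hence at most \<open>n\<close> units
  in total. As profits are weights scaled by \<open>n\<close>, this is the same as one unit of
  weight, the \<open>+ 1\<close> in \<open>39 * int h + 1\<close> below.\<close>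

lemma v_bounds:
  assumes "j < n"
  defines "W \<equiv> 38 * w j + (if D < 2 * w j then D else 0)"
  shows "int n * W \<le> D * v j" "D * v j \<le> int n * W + D"
proof -
  let ?q = "(38 * (int n * num j)) div den j"
  have d: "0 < den j" by (rule den_pos[OF assms(1)])
  have e: "38 * (int n * w j) * den j = 38 * (int n * num j) * D"
    using w_den[OF assms(1)] by simp
  have q: "?q * den j \<le> 38 * (int n * num j)" "38 * (int n * num j) \<le> (?q + 1) * den j"
  proof -
    define X where "X = 38 * (int n * num j)"
    have "X div den j * den j + X mod den j = X" "0 \<le> X mod den j" "X mod den j < den j"
      using d by simp_all
    then show "X div den j * den j \<le> X" "X \<le> (X div den j + 1) * den j"
      unfolding distrib_right by linarith+
  qed
  have "38 * (int n * w j) * den j \<le> (D * (?q + 1)) * den j"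
    unfolding e using mult_right_mono[OF q(2), of D] D_pos by (simp add: ac_simps)
  then have 1: "38 * (int n * w j) \<le> D * (?q + 1)" using d by simp
  have "(D * ?q) * den j \<le> 38 * (int n * w j) * den j"
    unfolding e using mult_right_mono[OF q(1), of D] D_pos by (simp add: ac_simps)
  then have 2: "D * ?q \<le> 38 * (int n * w j)" using d by simp
  show "int n * W \<le> D * v j" "D * v j \<le> int n * W + D"
    unfolding W_def v_def big_iff[OF assms(1)] using 1 2 by (auto simp: algebra_simps)
qed

text \<open>Two items above \<open>D / 2\<close> do not fit together, so a bin collects the bonus
  \<open>D\<close> at most once.\<close>

lemma bin_weight:
  assumes "finite B" "B \<subseteq> {..<n}" "(\<Sum>j\<in>B. w j) \<le> D"
  shows "(\<Sum>j\<in>B. 38 * w j + (if D < 2 * w j then D else 0)) \<le> 39 * D"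
proof -
  have "card {j \<in> B. D < 2 * w j} \<le> 1"
  proof (rule ccontr)
    assume "\<not> ?thesis"
    then obtain U where "U \<subseteq> {j \<in> B. D < 2 * w j}" "card U = 2"
      using obtain_subset_with_card_n[of 2 "{j \<in> B. D < 2 * w j}"] by force
    then obtain i j where ij: "i \<in> B" "j \<in> B" "i \<noteq> j" "D < 2 * w i" "D < 2 * w j"
      unfolding card_2_iff by blast
    then have "w i + w j = (\<Sum>l\<in>{i, j}. w l)" by simp
    also have "\<dots> \<le> (\<Sum>l\<in>B. w l)" using assms(1,2) ij w_nonneg by (intro sum_mono2) auto
    finally show False using ij assms(3) by linarith
  qed
  moreover have "(\<Sum>j\<in>B. if D < 2 * w j then D else 0) = int (card {j \<in> B. D < 2 * w j}) * D"
    using assms(1) by (simp add: sum.If_cases Int_def conj_commute)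
  ultimately have "(\<Sum>j\<in>B. if D < 2 * w j then D else 0) \<le> 1 * D"
    using D_pos by (simp only: mult_le_cancel_right) linarith
  then show ?thesis using assms(3) by (simp add: sum.distrib flip: sum_distrib_left)
qed

end

locale bpc_split = bpc_data +
  fixes ks :: "nat list"
  assumes ks: "distinct ks" "set ks \<subseteq> {..<n}"
    and ks_clique: "a \<in> set ks \<Longrightarrow> b \<in> set ks \<Longrightarrow> a \<noteq> b \<Longrightarrow> adj a b"
    and ks_indep: "a < n \<Longrightarrow> b < n \<Longrightarrow> a \<notin> set ks \<Longrightarrow> b \<notin> set ks \<Longrightarrow> \<not> adj a b"
begin

definition S :: "nat set" where "S = {..<n} - set ks"

definition base :: "nat \<Rightarrow> int" where
  "base i = (if i < length ks then w (ks ! i) else 0)"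

definition allowed :: "nat \<Rightarrow> nat \<Rightarrow> bool" where
  "allowed i j \<longleftrightarrow> j \<in> S \<and> \<not> (i < length ks \<and> adj (ks ! i) j)"

text \<open>There is no condition on pairs of items: \<open>S\<close> is independent, and conflicts
  with the clique item of the bin are filtered item by item. This makes a best response a plain
  knapsack problem.\<close>

definition config :: "nat \<Rightarrow> nat set \<Rightarrow> bool" where
  "config i C \<longleftrightarrow> (\<forall>j\<in>C. allowed i j) \<and> base i + (\<Sum>j\<in>C. w j) \<le> D"

lemma S_n: "S \<subseteq> {..<n}" and finite_S: "finite S" and card_S: "card S \<le> n"
proof -
  show S: "S \<subseteq> {..<n}" by (auto simp: S_def)
  then show "finite S" by (rule finite_subset) simp
  show "card S \<le> n" using card_mono[OF _ S] by simp
qed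

lemma ks_nth: "i < length ks \<Longrightarrow> ks ! i < n"
  using ks(2) nth_mem by blast

lemma base_bounds: "0 \<le> base i" "base i \<le> D"
  using w_nonneg w_le_D ks_nth D_pos by (auto simp: base_def)

lemma config_S: "config i C \<Longrightarrow> C \<subseteq> S"
  by (auto simp: config_def allowed_def)

lemma config_empty: "config i {}"
  by (simp add: config_def base_bounds)

text \<open>The clique items carry distinct labels, so \<open>pos\<close> can permute the labels to
  put \<open>ks ! i\<close> in bin \<open>i\<close>; the bins without a clique item are distributed
  by \<open>g\<close> over the remaining indices. Since \<open>pos\<close> is injective, the
  contents of the bins do not change.\<close>

lemma valid_labels_assignment:
  assumes "valid_labels h lab"
  obtains ob where "length ks \<le> h" "\<And>j. j \<in> S \<Longrightarrow> ob j < h"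
    "\<And>i. i < h \<Longrightarrow> config i {j. j \<in> S \<and> ob j = i}"
proof -
  let ?c = "length ks"
  have lab: "lab j < h" if "j < n" for j using assms that by (simp add: valid_labels_def)
  have inj: "inj_on (\<lambda>i. lab (ks ! i)) {..<?c}"
  proof (rule inj_onI)
    fix i i' assume i: "i \<in> {..<?c}" "i' \<in> {..<?c}" and eq: "lab (ks ! i) = lab (ks ! i')"
    then have "\<not> adj (ks ! i) (ks ! i')" using assms ks_nth by (simp add: valid_labels_def)
    then have "ks ! i = ks ! i'" using ks_clique i by (metis lessThan_iff nth_mem)
    then show "i = i'" using i ks(1) by (simp add: nth_eq_iff_index_eq)
  qed
  let ?F = "(\<lambda>i. lab (ks ! i)) ` {..<?c}"
  have F: "?F \<subseteq> {..<h}" using lab ks_nth by auto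
  have cF: "card ?F = ?c" using card_image[OF inj] by simp
  have ch: "?c \<le> h" using card_mono[OF _ F] cF by simp
  have "card ({..<h} - ?F) = card {?c..<h}"
    using F cF by (simp add: card_Diff_subset)
  then obtain g where g: "bij_betw g ({..<h} - ?F) {?c..<h}"
    using finite_same_card_bij[of "{..<h} - ?F" "{?c..<h}"] by auto
  define pos where "pos = (\<lambda>b. if b \<in> ?F then inv_into {..<?c} (\<lambda>i. lab (ks ! i)) b else g b)"
  have pos_F: "pos (lab (ks ! i)) = i" if "i < ?c" for i
    using inv_into_f_f[OF inj, of i] that by (auto simp: pos_def)
  have pos_G: "?c \<le> pos b \<and> pos b < h" if "b < h" "b \<notin> ?F" for b
    using bij_betwE[OF g] that by (auto simp: pos_def)
  have pos_lt: "pos b < h" if "b < h" for b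
  proof (cases "b \<in> ?F")
    case True
    then show ?thesis using pos_F ch by force
  qed (use pos_G that in blast)
  have pos_inj: "b = b'" if "b < h" "b' < h" "pos b = pos b'" for b b'
  proof (cases "b \<in> ?F")
    case True
    then obtain i where i: "i < ?c" "b = lab (ks ! i)" by auto
    then have "pos b' < ?c" using pos_F that(3) by simp
    then have "b' \<in> ?F" using pos_G[of b'] that(2) by force
    then show ?thesis using i pos_F that(3) by auto
  next
    case False
    then have "b' \<notin> ?F" using pos_G[of b] pos_F that by force
    then show ?thesis using False g that by (auto simp: pos_def bij_betw_def inj_on_def)
  qed
  show ?thesis
  proof
    show "?c \<le> h" by (rule ch)
    show "pos (lab j) < h" if "j \<in> S" for j using pos_lt lab S_n that by auto
    fix i assume "i < h"
    define B where "B = {j. j \<in> S \<and> pos (lab j) = i}"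
    have fin: "finite B" using finite_S by (simp add: B_def)
    have same: "lab j = lab l" if "j < n" "l < n" "pos (lab j) = pos (lab l)" for j l
      using pos_inj lab that by blast
    \<comment> \<open>Items of equal position have equal old labels, so that \<open>X\<close> is
      part of one bin of the given packing. The empty set belongs to no bin and is treated
      apart.\<close>
    have w0: "(\<Sum>j\<in>X. w j) \<le> D" if X: "X \<subseteq> {..<n}" "\<And>j. j \<in> X \<Longrightarrow> pos (lab j) = i" for X
    proof (cases "X = {}")
      case False
      then obtain x where x: "x \<in> X" by blast
      have "X \<subseteq> {j. j < n \<and> lab j = lab x}" using X x same by blast
      then have "(\<Sum>j\<in>X. w j) \<le> (\<Sum>j | j < n \<and> lab j = lab x. w j)"
        using w_nonneg by (intro sum_mono2) auto
      also have "\<dots> \<le> D" using assms by (simp add: valid_labels_def)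
      finally show ?thesis .
    qed (use D_pos in simp)
    show "config i {j. j \<in> S \<and> pos (lab j) = i}"
    proof (cases "i < ?c")
      case True
      then have k: "ks ! i < n" "pos (lab (ks ! i)) = i" using pos_F ks_nth by auto
      have kB: "ks ! i \<notin> B" using True by (simp add: B_def S_def)
      have "(\<Sum>j\<in>insert (ks ! i) B. w j) \<le> D"
        using k S_n by (intro w0) (auto simp: B_def)
      then have "base i + (\<Sum>j\<in>B. w j) \<le> D" using True fin kB by (simp add: base_def)
      moreover have "\<not> adj (ks ! i) j" if "j \<in> B" for j
      proof -
        have "j < n" "lab (ks ! i) = lab j" using that S_n k by (auto simp: B_def intro: same)
        then show ?thesis using assms k(1) by (simp add: valid_labels_def)
      qed
      ultimately show ?thesis by (auto simp: config_def allowed_def B_def)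
    next
      case False
      have "(\<Sum>j\<in>B. w j) \<le> D" using S_n by (intro w0) (auto simp: B_def)
      then show ?thesis using False by (auto simp: config_def allowed_def base_def B_def)
    qed
  qed
qed

definition locally_optimal :: "nat \<Rightarrow> (nat \<Rightarrow> nat set) \<Rightarrow> bool" where
  "locally_optimal h A \<longleftrightarrow> (\<forall>i<h. \<forall>C. config i C \<longrightarrow>
     (\<Sum>j\<in>C. gain v A h i j) \<le> (\<Sum>j\<in>A i. gain v A h i j))"

definition uncovered :: "nat \<Rightarrow> (nat \<Rightarrow> nat set) \<Rightarrow> nat set" where
  "uncovered h A = {j. j \<in> S \<and> (\<forall>i<h. j \<notin> A i)}"

definition first_fit :: "nat set \<Rightarrow> (nat \<Rightarrow> nat) \<Rightarrow> nat \<Rightarrow> bool" where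
  "first_fit R lb k \<longleftrightarrow> (\<forall>j\<in>R. lb j < k) \<and> (\<forall>b<k. \<exists>j\<in>R. lb j = b) \<and>
     (\<forall>j\<in>R. \<forall>b<lb j. D < (\<Sum>i | i \<in> R \<and> lb i = b. w i) + w j) \<and>
     (\<forall>b. (\<Sum>i | i \<in> R \<and> lb i = b. w i) \<le> D)"

text \<open>The total profit of \<open>S\<close> is at most \<open>n * (39 * h + 1)\<close>, the
  uncovered profit is more than \<open>n * (20 * k - 2)\<close>, and local optimality compares the
  two at the rate of 24 to 65. For \<open>2 \<le> k\<close> this gives
  \<open>1300 * k < 936 * h + 154\<close>, where \<open>154 = 24 + 130\<close> comes from the
  additive errors.\<close>

theorem first_fit_count:
  assumes lab: "valid_labels h lab" and A: "\<And>i. i < h \<Longrightarrow> config i (A i)"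
    and opt: "locally_optimal h A" and ff: "first_fit (uncovered h A) lb k"
  shows "34 * k \<le> 25 * h"
proof -
  define R where "R = uncovered h A"
  have R: "finite R" "R \<subseteq> S" using finite_S by (auto simp: R_def uncovered_def)
  from valid_labels_assignment[OF lab] obtain ob where ob: "\<And>j. j \<in> S \<Longrightarrow> ob j < h"
    "\<And>i. i < h \<Longrightarrow> config i {j. j \<in> S \<and> ob j = i}" by blast
  have vS: "1 \<le> v j" if "j \<in> S" for j using v_pos S_n that by auto
  have AS: "A i \<subseteq> S" if "i < h" for i using A config_S that by blast
  have k0: "k = 0" if "R = {}"
    using ff that by (fastforce simp: first_fit_def R_def)
  consider "h = 0" | "h = 1" | "2 \<le> h" by linarith
  then show ?thesis
  proof cases
    case 1
    then have "S = {}" using ob by auto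
    then show ?thesis using k0 R by simp
  next
    \<comment> \<open>With one bin already \<open>k = 1\<close> would violate the claim, and the
      weight bound says nothing about it. But here all of \<open>S\<close> is a configuration of the
      only bin, and as every profit is at least 1, a best response leaves nothing uncovered.\<close>
    case 2
    have "{j. j \<in> S \<and> ob j = 0} = S" using ob(1) 2 by auto
    then have "(\<Sum>j\<in>S. gain v A h 0 j) \<le> (\<Sum>j\<in>A 0. gain v A h 0 j)"
      using opt ob(2)[of 0] 2 by (auto simp: locally_optimal_def)
    moreover have "gain v A h 0 j = v j * 41" for j
      using 2 by (simp add: gain_def others_def dd_def)
    ultimately have "(\<Sum>j\<in>S. v j) \<le> (\<Sum>j\<in>A 0. v j)" by (simp flip: sum_distrib_right)
    moreover have "(\<Sum>j\<in>S. v j) = (\<Sum>j\<in>S - A 0. v j) + (\<Sum>j\<in>A 0. v j)"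
      using sum.subset_diff[of "A 0" S v] AS[of 0] finite_S 2 by simp
    moreover have "(\<Sum>j\<in>S - A 0. 1) \<le> (\<Sum>j\<in>S - A 0. v j)" using vS by (intro sum_mono) auto
    ultimately have "card (S - A 0) = 0" by simp
    then have "S - A 0 = {}" using finite_S by simp
    then have "R = {}" using 2 by (auto simp: R_def uncovered_def)
    then show ?thesis using k0 by simp
  next
    case 3
    show ?thesis
    proof (cases "2 \<le> k")
      case False
      then show ?thesis using 3 by simp
    next
      case True
      define W where "W = (\<lambda>j. 38 * w j + (if D < 2 * w j then D else 0))"
      have "(\<Sum>j\<in>S. W j) = (\<Sum>i<h. \<Sum>j | j \<in> S \<and> ob j = i. W j)"
        using ob(1) finite_S by (subst sum.group[of S "{..<h}" ob, symmetric]) auto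
      also have "\<dots> \<le> (\<Sum>i<h. 39 * D)"
      proof (rule sum_mono)
        fix i assume "i \<in> {..<h}"
        then have "config i {j. j \<in> S \<and> ob j = i}" using ob(2) by simp
        then have "(\<Sum>j | j \<in> S \<and> ob j = i. w j) \<le> D"
          using base_bounds(1)[of i] by (simp add: config_def)
        then show "(\<Sum>j | j \<in> S \<and> ob j = i. W j) \<le> 39 * D"
          unfolding W_def using S_n finite_S by (intro bin_weight) auto
      qed
      finally have WS: "(\<Sum>j\<in>S. W j) \<le> int h * (39 * D)" by simp
      have "D * (\<Sum>j\<in>S. v j) \<le> (\<Sum>j\<in>S. int n * W j + D)"
        unfolding sum_distrib_left W_def using S_n by (intro sum_mono v_bounds(2)) auto
      also have "\<dots> = int n * (\<Sum>j\<in>S. W j) + int (card S) * D"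
        by (simp add: sum.distrib sum_distrib_left)
      also have "\<dots> \<le> int n * (int h * (39 * D)) + int n * D"
        using WS card_S D_pos by (intro add_mono mult_left_mono mult_right_mono) auto
      also have "\<dots> = D * (int n * (39 * int h + 1))" by (simp add: algebra_simps)
      finally have vS': "(\<Sum>j\<in>S. v j) \<le> int n * (39 * int h + 1)" using D_pos by simp
      have "D * (20 * int k - 2) < (\<Sum>j\<in>R. W j)"
        unfolding W_def
      proof (rule first_fit_bound[where lb = lb and f = "\<lambda>b. \<Sum>i | i \<in> R \<and> lb i = b. w i"])
        show "0 \<le> w j" if "j \<in> R" for j using that R S_n w_nonneg by auto
      qed (use True D_pos R ff in \<open>auto simp: first_fit_def R_def\<close>)
      moreover have "int n \<noteq> 0"
      proof
        assume "int n = 0"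
        then have "R = {}" using R S_n by auto
        then show False using k0 True by simp
      qed
      ultimately have "int n * (D * (20 * int k - 2)) < int n * (\<Sum>j\<in>R. W j)" by simp
      also have "\<dots> \<le> (\<Sum>j\<in>R. D * v j)"
        unfolding sum_distrib_left W_def using R S_n by (intro sum_mono v_bounds(1)) auto
      also have "\<dots> = D * (\<Sum>j\<in>R. v j)" by (simp add: sum_distrib_left)
      finally have "D * (int n * (20 * int k - 2)) < D * (\<Sum>j\<in>R. v j)" by (simp add: ac_simps)
      then have "int n * (20 * int k - 2) < (\<Sum>j\<in>R. v j)" using D_pos by simp
      moreover have "65 * (\<Sum>j\<in>R. v j) \<le> 24 * (\<Sum>j\<in>S. v j)"
        unfolding R_def uncovered_def
      proof (rule local_optimum_bound[OF finite_S AS])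
        show "(\<Sum>j | j \<in> S \<and> ob j = i. gain v A h i j) \<le> (\<Sum>j\<in>A i. gain v A h i j)" if "i < h" for i
          using opt ob(2) that by (simp add: locally_optimal_def)
      qed (use ob(1) vS in \<open>force+\<close>)
      ultimately have "65 * (int n * (20 * int k - 2)) < 24 * (int n * (39 * int h + 1))"
        using vS' by linarith
      then have "int n * (65 * (20 * int k - 2)) < int n * (24 * (39 * int h + 1))"
        by (simp add: ac_simps)
      then have "65 * (20 * int k - 2) < 24 * (39 * int h + 1)"
        by (rule mult_less_cancel_left_pos[THEN iffD1, rotated]) (use \<open>int n \<noteq> 0\<close> in simp)
      then have "1300 * int k < 936 * int h + 154" by (simp add: algebra_simps)
      then have *: "1300 * k < 936 * h + 154" by linarith
      \<comment> \<open>Multiplied by 34, the bound on \<open>k\<close> reads about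
        \<open>24.48 * h + 4.03\<close>, which is below \<open>25 * h\<close> from
        \<open>h = 8\<close> on. For smaller \<open>h\<close> it suffices that \<open>k\<close> is
        an integer.\<close>
      show ?thesis
      proof (cases "h < 8")
        case True
        then consider "h = 2" | "h = 3" | "h = 4" | "h = 5" | "h = 6" | "h = 7" using 3 by linarith
        then show ?thesis
        proof cases
          case 1
          then have "k \<le> 1" using * by linarith
          then show ?thesis using 1 by linarith
        next
          case 2
          then have "k \<le> 2" using * by linarith
          then show ?thesis using 2 by linarith
        next
          case 3
          then have "k \<le> 2" using * by linarith
          then show ?thesis using 3 by linarith
        next
          case 4
          then have "k \<le> 3" using * by linarith
          then show ?thesis using 4 by linarith
        next
          case 5
          then have "k \<le> 4" using * by linarith
          then show ?thesis using 5 by linarith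
        next
          case 6
          then have "k \<le> 5" using * by linarith
          then show ?thesis using 6 by linarith
        qed
      next
        case False
        then show ?thesis using * by linarith
      qed
    qed
  qed
qed

text \<open>Optimality plays no part, so the labels are safe for every \<open>h\<close> that is
  tried. An item covered several times may take any of its bins, as dropping the other copies only
  lowers loads; bins from \<open>h\<close> on contain items of \<open>S\<close> only and hence no
  conflicts.\<close>

theorem first_fit_valid:
  assumes A: "\<And>i. i < h \<Longrightarrow> config i (A i)" and h: "length ks \<le> h"
    and ff: "first_fit (uncovered h A) lb k"
    and lab_ks: "\<And>i. i < length ks \<Longrightarrow> lab (ks ! i) = i"
    and lab_cov: "\<And>j. j \<in> S \<Longrightarrow> j \<notin> uncovered h A \<Longrightarrow> lab j < h \<and> j \<in> A (lab j)"
    and lab_unc: "\<And>j. j \<in> uncovered h A \<Longrightarrow> lab j = h + lb j"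
  shows "valid_labels (h + k) lab"
proof -
  have cases_j: "(\<exists>i<length ks. j = ks ! i \<and> lab j = i) \<or> (j \<in> S \<and> lab j < h \<and> j \<in> A (lab j)) \<or>
      (j \<in> uncovered h A \<and> lab j = h + lb j)" if "j < n" for j
  proof (cases "j \<in> set ks")
    case True
    then show ?thesis using lab_ks by (auto simp: in_set_conv_nth)
  next
    case False
    then have "j \<in> S" using that by (simp add: S_def)
    then show ?thesis using lab_cov lab_unc by blast
  qed
  have nadj: "\<not> adj a b" if "a \<in> S" "b \<in> S" for a b
    using ks_indep that by (auto simp: S_def)
  have U: "uncovered h A \<subseteq> S" by (auto simp: uncovered_def)
  show ?thesis
    unfolding valid_labels_def
  proof (intro conjI allI impI)
    fix j assume "j < n"
    then show "lab j < h + k" using cases_j[of j] h ff by (auto simp: first_fit_def)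
  next
    fix i j assume ij: "i < n" "j < n" "lab i = lab j"
    have key: "\<not> adj (ks ! a) l" if "a < length ks" "l < n" "lab l = a" for a l
      using cases_j[OF that(2)] A[of a] h that adj_irrefl
      by (auto simp: config_def allowed_def)
    consider "i \<in> S" "j \<in> S" | a where "a < length ks" "i = ks ! a" | a where "a < length ks" "j = ks ! a"
      using ij unfolding S_def by (auto simp: in_set_conv_nth)
    then show "\<not> adj i j"
    proof cases
      case 2
      then show ?thesis using key[of a j] lab_ks ij by simp
    next
      case 3
      then show ?thesis using key[of a i] lab_ks ij adj_sym by simp
    qed (rule nadj)
  next
    fix b
    show "(\<Sum>j | j < n \<and> lab j = b. w j) \<le> D"
    proof (cases "b < h")
      case True
      have fin: "finite (A b)" using A[OF True] config_S finite_S finite_subset by blast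
      have An: "\<And>j. j \<in> A b \<Longrightarrow> j < n" using A[OF True] config_S S_n by blast
      show ?thesis
      proof (cases "b < length ks")
        case b: True
        have "(\<Sum>j | j < n \<and> lab j = b. w j) \<le> (\<Sum>j\<in>insert (ks ! b) (A b). w j)"
          using cases_j True fin An w_nonneg ks_nth[OF b] by (intro sum_mono2) fastforce+
        also have "\<dots> = base b + (\<Sum>j\<in>A b. w j)"
        proof -
          have "ks ! b \<notin> A b" using A[OF True] b by (auto simp: config_def allowed_def S_def)
          then show ?thesis using fin b by (simp add: base_def)
        qed
        finally show ?thesis using A[OF True] by (simp add: config_def)
      next
        case b: False
        have "(\<Sum>j | j < n \<and> lab j = b. w j) \<le> (\<Sum>j\<in>A b. w j)"
          using cases_j True b fin An w_nonneg by (intro sum_mono2) fastforce+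
        then show ?thesis using A[OF True] base_bounds(1)[of b] by (simp add: config_def)
      qed
    next
      case False
      have "(\<Sum>j | j < n \<and> lab j = b. w j) \<le> (\<Sum>j | j \<in> uncovered h A \<and> lb j = b - h. w j)"
        using cases_j False h U S_n finite_S w_nonneg
        by (intro sum_mono2) (fastforce intro: finite_subset[of _ S])+
      also have "\<dots> \<le> D" using ff by (simp add: first_fit_def)
      finally show ?thesis .
    qed
  qed
qed

end


section \<open>The program\<close>

abbreviation (input) op_add (infixl \<open>\<oplus>\<close> 65) where "e1 \<oplus> e2 \<equiv> Op Add e1 e2"
abbreviation (input) op_sub (infixl \<open>\<ominus>\<close> 65) where "e1 \<ominus> e2 \<equiv> Op Sub e1 e2"
abbreviation (input) op_mul (infixl \<open>\<otimes>\<close> 70) where "e1 \<otimes> e2 \<equiv> Op Mul e1 e2"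
abbreviation (input) op_div (infixl \<open>\<oslash>\<close> 70) where "e1 \<oslash> e2 \<equiv> Op Div e1 e2"
abbreviation (input) op_less (infix \<open>\<prec>\<close> 50) where "e1 \<prec> e2 \<equiv> Op Less e1 e2"
abbreviation (input) op_eq (infix \<open>\<doteq>\<close> 50) where "e1 \<doteq> e2 \<equiv> Op Eq e1 e2"
abbreviation (input) seq (infixr \<open>;;\<close> 60) where "c1 ;; c2 \<equiv> Seq c1 c2"

text \<open>Names of arrays and variables: \<open>cKIT\<close> lists the \<open>cC\<close> clique items and \<open>cINK\<close> is the characteristic
  vector of the clique; \<open>cSZ\<close> and \<open>cVAL\<close> are the sizes (for the capacity \<open>cD\<close>) and profits of the items;
  \<open>cBIN\<close> holds the configurations of the \<open>cH\<close> bins, \<open>cFILL\<close> the loads of the \<open>cK\<close> bins of first fit, and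
  \<open>cLAB\<close> the labels of the items.\<close>

abbreviation (input) "cN \<equiv> (2::nat)"
abbreviation (input) "cD \<equiv> (3::nat)"
abbreviation (input) "cC \<equiv> (4::nat)"
abbreviation (input) "cH \<equiv> (5::nat)"
abbreviation (input) "cI \<equiv> (6::nat)"
abbreviation (input) "cJ \<equiv> (7::nat)"
abbreviation (input) "cA \<equiv> (8::nat)"
abbreviation (input) "cB \<equiv> (9::nat)"
abbreviation (input) "cS \<equiv> (10::nat)"
abbreviation (input) "cPW \<equiv> (11::nat)"
abbreviation (input) "cCNT \<equiv> (12::nat)"
abbreviation (input) "cCUR \<equiv> (13::nat)"
abbreviation (input) "cP \<equiv> (14::nat)"
abbreviation (input) "cQ \<equiv> (15::nat)"
abbreviation (input) "cBEST \<equiv> (16::nat)"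
abbreviation (input) "cK \<equiv> (17::nat)"
abbreviation (input) "cGO \<equiv> (18::nat)"
abbreviation (input) "cU \<equiv> (19::nat)"
abbreviation (input) "cSZ \<equiv> (20::nat)"
abbreviation (input) "cVAL \<equiv> (21::nat)"
abbreviation (input) "cINK \<equiv> (22::nat)"
abbreviation (input) "cKIT \<equiv> (23::nat)"
abbreviation (input) "cBIN \<equiv> (24::nat)"
abbreviation (input) "cGAIN \<equiv> (25::nat)"
abbreviation (input) "cTT \<equiv> (26::nat)"
abbreviation (input) "cMK \<equiv> (27::nat)"
abbreviation (input) "cFILL \<equiv> (28::nat)"
abbreviation (input) "cLAB \<equiv> (29::nat)"

definition num_expr :: "expr \<Rightarrow> expr" where
  "num_expr j = Load (Const 1 \<oplus> Const 2 \<otimes> j)"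

definition den_expr :: "expr \<Rightarrow> expr" where
  "den_expr j = Load (Const 2 \<oplus> Const 2 \<otimes> j)"

definition adj_expr :: "expr \<Rightarrow> expr \<Rightarrow> expr" where
  "adj_expr a b = Load (Const 1 \<oplus> Const 2 \<otimes> Var cN \<oplus> a \<otimes> Var cN \<oplus> b)"

text \<open>Sets of items are represented by bit masks; \<open>cPW\<close> holds \<open>2 ^ j\<close> while item \<open>j\<close> is treated.\<close>

definition bit_expr :: "expr \<Rightarrow> expr" where
  "bit_expr e = e \<oslash> Var cPW \<ominus> Const 2 \<otimes> (e \<oslash> Var cPW \<oslash> Const 2)"

definition dd_expr :: "expr \<Rightarrow> expr" where
  "dd_expr e = Const 41 \<otimes> (e \<doteq> Const 0) \<oplus> Const 17 \<otimes> (e \<doteq> Const 1)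
     \<oplus> Const 10 \<otimes> (e \<doteq> Const 2) \<oplus> Const 6 \<otimes> (e \<doteq> Const 3)"

definition scale_com :: com where
  "scale_com =
     Set cN (Load (Const 0));; Set cD (Const 1);; Set cC (Const 0);;
     For cJ (Var cN) (Set cD (Var cD \<otimes> den_expr (Var cJ)));;
     For cJ (Var cN)
       (Put cSZ (Var cJ) (num_expr (Var cJ) \<otimes> (Var cD \<oslash> den_expr (Var cJ)));;
        Put cVAL (Var cJ) ((Const 38 \<otimes> (Var cN \<otimes> num_expr (Var cJ))) \<oslash> den_expr (Var cJ)
          \<oplus> Var cN \<otimes> (den_expr (Var cJ) \<prec> Const 2 \<otimes> num_expr (Var cJ)) \<oplus> Const 1))"

text \<open>With 0-1 values, products express conjunctions and sums disjunctions. The item is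
  rejected if it misses a chosen clique item, or if two of its nonneighbours are adjacent.\<close>

definition check_com :: com where
  "check_com =
     For cA (Var cN) (For cB (Var cN)
       (Cond ((adj_expr (Var cJ) (Var cA) \<doteq> Const 0) \<otimes> (Arr cINK (Var cA) \<oplus>
           (adj_expr (Var cJ) (Var cB) \<doteq> Const 0) \<otimes> adj_expr (Var cA) (Var cB)))
         (Set cS (Const 0)) Skip))"

definition split_com :: com where
  "split_com =
     For cJ (Var cN)
       (Set cS (Const 1);; check_com;;
        Cond (Var cS)
          (Put cKIT (Var cC) (Var cJ);; Put cINK (Var cJ) (Const 1);; Set cC (Var cC \<oplus> Const 1))
          Skip)"

definition count_com :: com where
  "count_com =
     Set cCNT (Const 0);;
     For cA (Var cH)
       (Cond (Var cA \<doteq> Var cI) Skip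
         (Set cCNT (Var cCNT \<oplus> bit_expr (Arr cBIN (Var cA)))))"

definition value_com :: com where
  "value_com =
     Put cGAIN (Var cJ) (Arr cVAL (Var cJ) \<otimes> dd_expr (Var cCNT));;
     Cond (Arr cINK (Var cJ)) (Put cGAIN (Var cJ) (Const 0))
       (Cond (Var cI \<prec> Var cC)
         (Cond (adj_expr (Arr cKIT (Var cI)) (Var cJ)) (Put cGAIN (Var cJ) (Const 0)) Skip) Skip)"

definition accumulate_com :: com where
  "accumulate_com =
     Cond (bit_expr (Arr cBIN (Var cI))) (Set cCUR (Var cCUR \<oplus> Arr cGAIN (Var cJ))) Skip;;
     Set cP (Var cP \<oplus> Arr cGAIN (Var cJ));;
     Set cPW (Var cPW \<oplus> Var cPW)"

definition gains_com :: com where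
  "gains_com =
     Set cPW (Const 1);; Set cCUR (Const 0);; Set cP (Const 0);;
     For cJ (Var cN) (count_com;; value_com;; accumulate_com)"

text \<open>\<open>cTT\<close> and \<open>cMK\<close> hold, for every total gain, the least size of a configuration with that gain
  (or the capacity plus 1) and its bit mask.\<close>

definition table_com :: com where
  "table_com =
     For cQ (Var cP \<oplus> Const 1) (Put cTT (Var cQ) (Var cD \<oplus> Const 1));;
     Put cTT (Const 0) (Const 0);;
     Cond (Var cI \<prec> Var cC) (Put cTT (Const 0) (Arr cSZ (Arr cKIT (Var cI)))) Skip;;
     Put cMK (Const 0) (Const 0);; Set cPW (Const 1)"

text \<open>Gains are visited in descending order, as usual for a knapsack with a single array;
  otherwise an item could enter a configuration twice.\<close>

definition item_com :: com where
  "item_com =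
     For cQ (Var cP \<oplus> Const 1 \<ominus> Arr cGAIN (Var cJ))
       (Set cU (Var cP \<ominus> Var cQ);; Set cA (Var cU \<ominus> Arr cGAIN (Var cJ));;
        Cond (Arr cTT (Var cA) \<oplus> Arr cSZ (Var cJ) \<prec> Arr cTT (Var cU))
          (Put cTT (Var cU) (Arr cTT (Var cA) \<oplus> Arr cSZ (Var cJ));;
           Put cMK (Var cU) (Arr cMK (Var cA) \<oplus> Var cPW))
          Skip)"

definition knapsack_com :: com where
  "knapsack_com =
     table_com;;
     For cJ (Var cN)
       (Cond (Const 0 \<prec> Arr cGAIN (Var cJ)) item_com Skip;; Set cPW (Var cPW \<oplus> Var cPW))"

definition best_com :: com where
  "best_com =
     Set cBEST (Const 0);;
     For cQ (Var cP \<oplus> Const 1) (Cond (Arr cTT (Var cQ) \<prec> Var cD \<oplus> Const 1) (Set cBEST (Var cQ)) Skip)"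

text \<open>An improvement restarts the scan at bin 0, because it changes the gains of the other
  bins. When \<open>cI\<close> reaches \<open>cH\<close>, all bins have been tested against the same
  configurations.\<close>

definition respond_com :: com where
  "respond_com =
     gains_com;; knapsack_com;; best_com;;
     Cond (Var cCUR \<prec> Var cBEST)
       (Put cBIN (Var cI) (Arr cMK (Var cBEST));; Set cI (Const 0))
       (Set cI (Var cI \<oplus> Const 1))"

definition search_com :: com where
  "search_com =
     For cI (Var cH) (Put cBIN (Var cI) (Const 0));;
     Set cI (Const 0);;
     While (Var cI \<prec> Var cH) respond_com"

definition place_com :: com where
  "place_com =
     Set cA (Const 0);;
     While (Var cD \<prec> Arr cFILL (Var cA) \<oplus> Arr cSZ (Var cJ)) (Set cA (Var cA \<oplus> Const 1));;
     Put cFILL (Var cA) (Arr cFILL (Var cA) \<oplus> Arr cSZ (Var cJ));;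
     Put cLAB (Var cJ) (Var cH \<oplus> Var cA);;
     Cond (Var cA \<doteq> Var cK) (Set cK (Var cK \<oplus> Const 1)) Skip"

text \<open>The label -1 is a sentinel for items that no bin covers. Among several bins covering an
  item, the last one wins.\<close>

definition find_com :: com where
  "find_com =
     Put cLAB (Var cJ) (Const (- 1));;
     For cA (Var cH)
       (Cond ((Var cA \<prec> Var cC) \<otimes> (Arr cKIT (Var cA) \<doteq> Var cJ)) (Put cLAB (Var cJ) (Var cA))
         (Cond (bit_expr (Arr cBIN (Var cA))) (Put cLAB (Var cJ) (Var cA)) Skip))"

definition assign_com :: com where
  "assign_com =
     Set cK (Const 0);;
     For cJ (Var cN \<oplus> Const 1) (Put cFILL (Var cJ) (Const 0));;
     Set cPW (Const 1);;
     For cJ (Var cN)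
       (find_com;; Cond (Arr cLAB (Var cJ) \<prec> Const 0) place_com Skip;;
        Set cPW (Var cPW \<oplus> Var cPW))"

definition main_com :: com where
  "main_com =
     Set cH (Var cC);; Set cGO (Const 1);;
     While (Var cGO)
       (search_com;; assign_com;;
        Cond (Const 25 \<otimes> Var cH \<prec> Const 34 \<otimes> Var cK) (Set cH (Var cH \<oplus> Const 1)) (Set cGO (Const 0)))"

definition output_com :: com where
  "output_com = For cJ (Var cN) (Store (Var cJ) (Arr cLAB (Var cJ)))"

definition split_packing :: com where
  "split_packing = scale_com;; split_com;; main_com;; output_com"


section \<open>Bit masks\<close>

definition code :: "nat set \<Rightarrow> int" where
  "code C = (\<Sum>j\<in>C. 2 ^ j)"

lemma code_empty [simp]: "code {} = 0"
  by (simp add: code_def)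

lemma code_insert: "finite C \<Longrightarrow> j \<notin> C \<Longrightarrow> code (insert j C) = code C + 2 ^ j"
  by (simp add: code_def)

lemma code_less: "C \<subseteq> {..<j} \<Longrightarrow> code C < 2 ^ j"
proof -
  assume "C \<subseteq> {..<j}"
  then have "code C \<le> (\<Sum>i<j. 2 ^ i)" unfolding code_def by (intro sum_mono2) auto
  also have "\<dots> < 2 ^ j" by (induction j) auto
  finally show ?thesis .
qed

text \<open>The members below \<open>j\<close> contribute less than \<open>2 ^ j\<close>, which the
  division removes, and those above \<open>j\<close> contribute a multiple of
  \<open>2 * 2 ^ j\<close>, which stays even.\<close>

lemma code_bit:
  assumes "finite C"
  shows "code C div 2 ^ j mod 2 = (if j \<in> C then 1 else 0)"
proof -
  define L where "L = {i \<in> C. i < j}"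
  define U where "U = {i \<in> C. j < i}"
  have C: "C = L \<union> (C \<inter> {j}) \<union> U" by (auto simp: L_def U_def)
  have fin: "finite L" "finite U" using assms by (auto simp: L_def U_def)
  have "code C = code L + code (C \<inter> {j}) + code U"
  proof -
    have "(\<Sum>i\<in>L \<union> (C \<inter> {j}) \<union> U. 2 ^ i) = (\<Sum>i\<in>L \<union> (C \<inter> {j}). 2 ^ i) + (\<Sum>i\<in>U. 2 ^ i :: int)"
      by (rule sum.union_disjoint) (auto simp: fin L_def U_def assms)
    moreover have "(\<Sum>i\<in>L \<union> (C \<inter> {j}). 2 ^ i) = (\<Sum>i\<in>L. 2 ^ i) + (\<Sum>i\<in>C \<inter> {j}. 2 ^ i :: int)"
      by (rule sum.union_disjoint) (auto simp: fin L_def assms)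
    ultimately show ?thesis unfolding code_def using C by simp
  qed
  moreover have "code (C \<inter> {j}) = (if j \<in> C then 1 else 0) * 2 ^ j"
    by (auto simp: code_def)
  moreover have "\<exists>q. code U = q * 2 * 2 ^ j"
  proof -
    have "2 * 2 ^ j dvd code U"
      unfolding code_def
    proof (rule dvd_sum)
      fix i assume "i \<in> U"
      then have "Suc j \<le> i" by (simp add: U_def)
      then show "(2 * 2 ^ j :: int) dvd 2 ^ i" using le_imp_power_dvd[of "Suc j" i "2::int"] by simp
    qed
    then show ?thesis by (auto simp: dvd_def ac_simps)
  qed
  moreover have "0 \<le> code L" unfolding code_def by (rule sum_nonneg) simp
  moreover have "code L < 2 ^ j" by (rule code_less) (auto simp: L_def)
  ultimately obtain q where "code C = code L + ((if j \<in> C then 1 else 0) + 2 * q) * 2 ^ j"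
    by (auto simp: algebra_simps)
  then have "code C div 2 ^ j = (if j \<in> C then 1 else 0) + 2 * q"
    using \<open>0 \<le> code L\<close> \<open>code L < 2 ^ j\<close> by simp
  then show ?thesis by auto
qed


section \<open>Best responses\<close>

lemma expr_val_bit [simp]: "expr_val (bit_expr e) m = expr_val e m div m (adr cPW 0) mod 2"
  by (simp add: bit_expr_def minus_mult_div_eq_mod)

lemma expr_ok_bit [simp]: "8 \<le> g \<Longrightarrow> expr_ok g (bit_expr e) m \<longleftrightarrow> expr_ok g e m"
  by (auto simp: bit_expr_def)

lemma expr_val_dd [simp]: "0 \<le> expr_val e m \<Longrightarrow> expr_val (dd_expr e) m = dd (nat (expr_val e m))"
  by (auto simp: dd_expr_def dd_def nat_eq_iff)

lemma expr_ok_dd [simp]: "8 \<le> g \<Longrightarrow> expr_ok g (dd_expr e) m \<longleftrightarrow> expr_ok g e m"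
  by (auto simp: dd_expr_def)

lemma abs_dd [simp]: "\<bar>dd c\<bar> < 128"
  by (simp add: dd_def)

lemma int_size_bool [simp]: "8 \<le> g \<Longrightarrow> int_size (if b then 1 else 0) \<le> g"
  by simp

lemma esize_exprs [simp]:
  "esize (num_expr e) = esize e + 5" "esize (den_expr e) = esize e + 5"
  "esize (adj_expr a b) = esize a + esize b + 20" "esize (bit_expr e) = 2 * esize e + 19"
  "esize (dd_expr e) = 4 * esize e + 19"
  by (simp_all add: num_expr_def den_expr_def adj_expr_def bit_expr_def dd_expr_def)

lemma agree_ext: "agree X m m1 \<Longrightarrow> agree Y m1 m2 \<Longrightarrow> Y \<subseteq> X \<Longrightarrow> agree X m m2"
  using agree_trans by blast

text \<open>The bound \<open>g\<close> covers the input words, the number of items and the small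
  constants. These are the short factors of all products; capacity, sizes and bit masks may be
  longer, and are only added, compared, divided or multiplied by a short factor.\<close>

locale ram_data = bpc_data +
  fixes g :: nat
  assumes g [simp]: "8 \<le> g"
    and size_n [simp]: "int_size (int n) \<le> g"
    and size_num [simp]: "j < n \<Longrightarrow> int_size (num j) \<le> g"
    and size_den [simp]: "j < n \<Longrightarrow> int_size (den j) \<le> g"
begin

lemma g2 [simp]: "2 \<le> g"
  using g by linarith

definition input_ok :: "memory \<Rightarrow> bool" where
  "input_ok m \<longleftrightarrow> (\<forall>j<n. m (1 + 2 * int j) = num j \<and> m (2 + 2 * int j) = den j) \<and>
     (\<forall>a<n. \<forall>b<n. m (1 + 2 * int n + int a * int n + int b) = (if adj a b then 1 else 0))"

lemma input_exprs:
  assumes "input_ok m" "m (adr cN 0) = int n" "0 \<le> expr_val a m" "expr_val a m < int n"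
  shows "expr_val (num_expr a) m = num (nat (expr_val a m))"
    "expr_val (den_expr a) m = den (nat (expr_val a m))"
    "0 \<le> expr_val b m \<Longrightarrow> expr_val b m < int n \<Longrightarrow>
      expr_val (adj_expr a b) m = (if adj (nat (expr_val a m)) (nat (expr_val b m)) then 1 else 0)"
proof -
  obtain x where x: "expr_val a m = int x"
    using assms zero_le_imp_eq_int by metis
  then show "expr_val (num_expr a) m = num (nat (expr_val a m))"
    "expr_val (den_expr a) m = den (nat (expr_val a m))"
    using assms by (simp_all add: input_ok_def num_expr_def den_expr_def)
  assume b: "0 \<le> expr_val b m" "expr_val b m < int n"
  then obtain y where "expr_val b m = int y"
    using zero_le_imp_eq_int by metis
  then show "expr_val (adj_expr a b) m = (if adj (nat (expr_val a m)) (nat (expr_val b m)) then 1 else 0)"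
    using x b assms by (simp add: input_ok_def adj_expr_def)
qed

lemma expr_ok_input:
  assumes "m (adr cN 0) = int n" 
  shows "expr_ok g (num_expr a) m \<longleftrightarrow> expr_ok g a m" "expr_ok g (den_expr a) m \<longleftrightarrow> expr_ok g a m"
    "expr_ok g (adj_expr a b) m \<longleftrightarrow> expr_ok g a m \<and> expr_ok g b m"
  using assms by (auto simp: num_expr_def den_expr_def adj_expr_def)

lemma input_ok_agree: "input_ok m \<Longrightarrow> agree X m m' \<Longrightarrow> input_ok m'"
  by (simp add: input_ok_def agree_input)

end

locale ram_split = ram_data + bpc_split
begin

definition prepared :: "memory \<Rightarrow> bool" where
  "prepared m \<longleftrightarrow> input_ok m \<and> m (adr cN 0) = int n \<and> m (adr cD 0) = D \<and>
     m (adr cC 0) = int (length ks) \<and> (\<forall>i<length ks. m (adr cKIT (int i)) = int (ks ! i)) \<and>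
     (\<forall>j<n. m (adr cSZ (int j)) = w j) \<and> (\<forall>j<n. m (adr cVAL (int j)) = v j) \<and>
     (\<forall>j<n. m (adr cINK (int j)) = (if j \<in> set ks then 1 else 0))"

lemma prepared_agree:
  assumes "prepared m" "agree X m m'" "X \<inter> {cN, cD, cC, cKIT, cSZ, cVAL, cINK} = {}"
  shows "prepared m'"
proof -
  have X: "cN \<notin> X" "cD \<notin> X" "cC \<notin> X" "cKIT \<notin> X" "cSZ \<notin> X" "cVAL \<notin> X" "cINK \<notin> X"
    using assms(3) by blast+
  show ?thesis
    using assms(1) input_ok_agree[OF _ assms(2)] unfolding prepared_def
    by (simp add: agreeD[OF assms(2)] X)
qed

definition searching :: "nat \<Rightarrow> nat \<Rightarrow> (nat \<Rightarrow> nat set) \<Rightarrow> memory \<Rightarrow> bool" where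
  "searching h i A m \<longleftrightarrow> prepared m \<and> m (adr cH 0) = int h \<and> m (adr cI 0) = int i \<and>
     (\<forall>a<h. config a (A a) \<and> m (adr cBIN (int a)) = code (A a))"

lemma searching_agree:
  assumes "searching h i A m" "agree X m m'"
    "X \<inter> {cN, cD, cC, cKIT, cSZ, cVAL, cINK, cH, cI, cBIN} = {}"
  shows "searching h i A m'"
proof -
  have X: "cH \<notin> X" "cI \<notin> X" "cBIN \<notin> X" using assms(3) by blast+
  have "prepared m'" using assms by (auto simp: searching_def intro: prepared_agree)
  then show ?thesis using assms(1) unfolding searching_def by (simp add: agreeD[OF assms(2)] X)
qed

lemma config_finite: "config i C \<Longrightarrow> finite C"
  using config_S finite_S finite_subset by blast

lemma count_run:
  assumes s: "searching h i A m" and pw: "m (adr cPW 0) = 2 ^ j"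
  shows "runs g count_com m (10 + Suc h * 200)
    (\<lambda>m'. agree {cA, cCNT} m m' \<and> m' (adr cCNT 0) = int (others A h i j))" (is "runs _ _ _ _ ?Q")
proof -
  define Inv where "Inv = (\<lambda>a m'. agree {cA, cCNT} m m' \<and>
    m' (adr cCNT 0) = int (card {i'. i' < a \<and> i' \<noteq> i \<and> j \<in> A i'}))"
  show ?thesis
    unfolding count_com_def
  proof (rule runs_Seq)
    show "runs g (Set cCNT (Const 0)) m 7 (\<lambda>m1. m1 = m(adr cCNT 0 := 0))"
      by (rule runs_loop_free) auto
    fix m1 assume m1: "m1 = m(adr cCNT 0 := 0)"
    show "runs g (For cA (Var cH) (Cond (Var cA \<doteq> Var cI) Skip
        (Set cCNT (Var cCNT \<oplus> bit_expr (Arr cBIN (Var cA)))))) m1 (Suc h * 200)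
        ?Q"
    proof (rule runs_mono[OF runs_For[where Inv = Inv and N = h and k = 100]])
      show "Inv 0 (m1(adr cA 0 := 0))" by (simp add: Inv_def m1)
    next
      fix a m' assume "Inv a m'"
      then have ag: "agree {cA, cCNT} m m'" by (simp add: Inv_def)
      show "expr_ok g (Var cH) m' \<and> expr_val (Var cH) m' = int h"
        using s by (simp add: agreeD[OF ag] searching_def)
    next
      fix a m' assume a: "a < h" "Inv a m'" "m' (adr cA 0) = int a"
      then have ag: "agree {cA, cCNT} m m'" by (simp add: Inv_def)
      have f: "m (adr cI 0) = int i" "m (adr cBIN (int a)) = code (A a)" "finite (A a)"
        using s a(1) config_finite by (auto simp: searching_def)
      have "{i'. i' < Suc a \<and> i' \<noteq> i \<and> j \<in> A i'} =
          (if a \<noteq> i \<and> j \<in> A a then {a} else {}) \<union> {i'. i' < a \<and> i' \<noteq> i \<and> j \<in> A i'}"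
        by (auto simp: less_Suc_eq)
      then have "int (card {i'. i' < Suc a \<and> i' \<noteq> i \<and> j \<in> A i'}) =
          int (card {i'. i' < a \<and> i' \<noteq> i \<and> j \<in> A i'}) + (if a \<noteq> i \<and> j \<in> A a then 1 else 0)"
        by auto
      then show "runs g (Cond (Var cA \<doteq> Var cI) Skip
          (Set cCNT (Var cCNT \<oplus> bit_expr (Arr cBIN (Var cA))))) m' 100
          (\<lambda>m''. m'' (adr cA 0) = int a \<and> Inv (Suc a) (m''(adr cA 0 := int (Suc a))))"
        using a by (intro runs_loop_free) (auto simp: agreeD[OF ag] f pw Inv_def code_bit)
    qed (auto simp: Inv_def others_def)
  qed simp
qed

text \<open>Forbidden items get gain 0, and items of gain 0 never enter the knapsack table; this is
  how conflicts with the clique item of bin \<open>i\<close> are respected.\<close>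

definition G :: "nat \<Rightarrow> (nat \<Rightarrow> nat set) \<Rightarrow> nat \<Rightarrow> nat \<Rightarrow> int" where
  "G h A i j = (if allowed i j then gain v A h i j else 0)"

lemma G_nonneg: "0 \<le> G h A i j"
  using v_pos[of j] dd_nonneg S_n by (auto simp: G_def gain_def allowed_def)

lemma G_le:
  assumes "j < n"
  shows "G h A i j \<le> 1640 * int n"
proof -
  have "v j * dd (others A h i j) \<le> (40 * int n) * 41"
    using v_le[OF assms] v_pos[OF assms] dd_antimono[of 0] dd_nonneg
    by (intro mult_mono) (auto simp: dd_def)
  then show ?thesis by (auto simp: G_def gain_def)
qed

lemma config_G: "config i C \<Longrightarrow> (\<Sum>j\<in>C. G h A i j) = (\<Sum>j\<in>C. gain v A h i j)"
  by (auto simp: config_def G_def intro!: sum.cong)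

lemma value_run:
  assumes s: "searching h i A m" and i: "i < h"
    and j: "j < n" "m (adr cJ 0) = int j" and cnt: "m (adr cCNT 0) = int (others A h i j)"
  shows "runs g value_com m 300
    (\<lambda>m'. agree {cGAIN} m m' \<and> m' (adr cGAIN (int j)) = G h A i j \<and>
       (\<forall>l. l \<noteq> j \<longrightarrow> m' (adr cGAIN (int l)) = m (adr cGAIN (int l))))"
proof -
  have f: "m (adr cI 0) = int i" "m (adr cVAL (int j)) = v j"
    "m (adr cINK (int j)) = (if j \<in> set ks then 1 else 0)"
    "m (adr cC 0) = int (length ks)" "m (adr cN 0) = int n" "input_ok m"
    and kit: "i < length ks \<Longrightarrow> m (adr cKIT (int i)) = int (ks ! i)"
    using s i j(1) by (auto simp: searching_def prepared_def)
  have io: "input_ok (m(adr x u := c))" if "0 \<le> u" for x u c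
    using f(6) that by (simp add: input_ok_def)
  have G: "G h A i j = (if j \<in> set ks \<or> i < length ks \<and> adj (ks ! i) j then 0
      else v j * dd (others A h i j))"
    using j(1) by (auto simp: G_def gain_def allowed_def S_def)
  note exec = f kit ks_nth j cnt input_exprs expr_ok_input io
  show ?thesis
    unfolding value_com_def G
    by (rule runs_loop_free; cases "j \<in> set ks"; cases "i < length ks"; cases "adj (ks ! i) j")
      (simp_all add: exec)
qed

lemma accumulate_run:
  assumes s: "searching h i A m" and i: "i < h" and pw: "m (adr cPW 0) = 2 ^ j"
    and j: "j < n" "m (adr cJ 0) = int j"
  shows "runs g accumulate_com m 300
    (\<lambda>m'. agree {cCUR, cP, cPW} m m' \<and> m' (adr cPW 0) = 2 ^ Suc j \<and>
       m' (adr cP 0) = m (adr cP 0) + m (adr cGAIN (int j)) \<and>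
       m' (adr cCUR 0) = m (adr cCUR 0) + (if j \<in> A i then m (adr cGAIN (int j)) else 0))"
proof -
  have f: "m (adr cI 0) = int i" "m (adr cBIN (int i)) = code (A i)" "finite (A i)"
    using s i j(1) config_finite by (auto simp: searching_def prepared_def)
  show ?thesis
    unfolding accumulate_com_def
    by (rule runs_loop_free; cases "j \<in> A i") (simp_all add: f j pw code_bit)
qed

lemma gains_run:
  assumes s: "searching h i A m" and i: "i < h"
  shows "runs g gains_com m (50 + Suc n * (Suc h * 200 + 710))
    (\<lambda>m'. agree {cJ, cA, cCNT, cGAIN, cCUR, cP, cPW} m m' \<and>
       m' (adr cP 0) = (\<Sum>l<n. G h A i l) \<and> m' (adr cCUR 0) = (\<Sum>l\<in>A i. gain v A h i l) \<and>
       (\<forall>l<n. m' (adr cGAIN (int l)) = G h A i l))" (is "runs _ _ _ _ ?Q")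
proof -
  define X where "X = {cJ, cA, cCNT, cGAIN, cCUR, cP, cPW}"
  define Inv where "Inv = (\<lambda>j m'. agree X m m' \<and> m' (adr cPW 0) = 2 ^ j \<and>
    m' (adr cP 0) = (\<Sum>l<j. G h A i l) \<and>
    m' (adr cCUR 0) = (\<Sum>l<j. if l \<in> A i then G h A i l else 0) \<and>
    (\<forall>l<j. m' (adr cGAIN (int l)) = G h A i l))"
  have cfg: "config i (A i)" using s i by (simp add: searching_def)
  have cur: "(\<Sum>l<n. if l \<in> A i then G h A i l else 0) = (\<Sum>l\<in>A i. gain v A h i l)"
  proof -
    have "A i \<subseteq> {..<n}" using config_S[OF cfg] S_n by blast
    then have "(\<Sum>l<n. if l \<in> A i then G h A i l else 0) = (\<Sum>l\<in>A i. G h A i l)"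
      by (simp add: sum.If_cases Int_absorb1)
    then show ?thesis using config_G[OF cfg] by simp
  qed
  have tr: "searching h i A m'" if "agree X m m'" for m'
    by (rule searching_agree[OF s that]) (simp add: X_def)
  let ?m = "post (Set cP (Const 0)) (post (Set cCUR (Const 0)) (post (Set cPW (Const 1)) m))"
  have "runs g (For cJ (Var cN) (count_com;; value_com;; accumulate_com)) ?m
      (Suc n * (Suc h * 200 + 710)) (\<lambda>m'. m' (adr cJ 0) = int n \<and> Inv n m')"
  proof (rule runs_For)
    show "Inv 0 (?m(adr cJ 0 := 0))" by (simp add: Inv_def X_def)
  next
    fix j m' assume "Inv j m'"
    then have "prepared m'" using tr by (auto simp: Inv_def searching_def)
    then show "expr_ok g (Var cN) m' \<and> expr_val (Var cN) m' = int n"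
      by (simp add: prepared_def)
  next
    fix j m' assume j: "j < n" "Inv j m'" "m' (adr cJ 0) = int j"
    then have ag: "agree X m m'" and pw: "m' (adr cPW 0) = 2 ^ j" by (auto simp: Inv_def)
    note s' = tr[OF ag]
    show "runs g (count_com;; value_com;; accumulate_com) m' (Suc h * 200 + 650)
      (\<lambda>m''. m'' (adr cJ 0) = int j \<and> Inv (Suc j) (m''(adr cJ 0 := int (Suc j))))"
    proof (rule runs_Seq[OF count_run[OF s' pw]])
      fix m1 assume 1: "agree {cA, cCNT} m' m1 \<and> m1 (adr cCNT 0) = int (others A h i j)"
      then have ag1: "agree {cA, cCNT} m' m1" and c1: "m1 (adr cCNT 0) = int (others A h i j)"
        by auto
      have s1: "searching h i A m1" by (rule searching_agree[OF s' ag1]) simp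
      have j1: "m1 (adr cJ 0) = int j" by (simp add: agreeD[OF ag1] j)
      show "runs g (value_com;; accumulate_com) m1 601
        (\<lambda>m''. m'' (adr cJ 0) = int j \<and> Inv (Suc j) (m''(adr cJ 0 := int (Suc j))))"
      proof (rule runs_Seq[OF value_run[OF s1 i j(1) j1 c1]])
        fix m2 assume 2: "agree {cGAIN} m1 m2 \<and> m2 (adr cGAIN (int j)) = G h A i j \<and>
          (\<forall>l. l \<noteq> j \<longrightarrow> m2 (adr cGAIN (int l)) = m1 (adr cGAIN (int l)))"
        then have ag2: "agree {cGAIN} m1 m2" by blast
        have s2: "searching h i A m2" by (rule searching_agree[OF s1 ag2]) simp
        have j2: "m2 (adr cJ 0) = int j" "m2 (adr cPW 0) = 2 ^ j"
          by (simp_all add: agreeD[OF ag2] agreeD[OF ag1] j pw)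
        show "runs g accumulate_com m2 300
          (\<lambda>m''. m'' (adr cJ 0) = int j \<and> Inv (Suc j) (m''(adr cJ 0 := int (Suc j))))"
        proof (rule runs_mono[OF accumulate_run[OF s2 i j2(2) j(1) j2(1)]])
          fix m3 assume 3: "agree {cCUR, cP, cPW} m2 m3 \<and> m3 (adr cPW 0) = 2 ^ Suc j \<and>
            m3 (adr cP 0) = m2 (adr cP 0) + m2 (adr cGAIN (int j)) \<and>
            m3 (adr cCUR 0) = m2 (adr cCUR 0) + (if j \<in> A i then m2 (adr cGAIN (int j)) else 0)"
          then have ag3: "agree {cCUR, cP, cPW} m2 m3" by blast
          note ags = agreeD[OF ag1] agreeD[OF ag2] agreeD[OF ag3]
          have "agree X m m3"
            by (rule agree_ext[OF agree_ext[OF agree_ext[OF ag ag1] ag2] ag3]) (simp_all add: X_def)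
          then have X3: "agree X m (m3(adr cJ 0 := c))" for c by (simp add: X_def)
          show "m3 (adr cJ 0) = int j \<and> Inv (Suc j) (m3(adr cJ 0 := int (Suc j)))"
            using 2 3 X3 j unfolding Inv_def by (auto simp: ags less_Suc_eq)
        qed simp
      qed simp
    qed simp
  qed (simp_all add: algebra_simps)
  then have main: "runs g (For cJ (Var cN) (count_com;; value_com;; accumulate_com)) ?m
      (Suc n * (Suc h * 200 + 710)) ?Q"
    by (rule runs_mono) (auto simp: Inv_def X_def cur)
  show ?thesis
    unfolding gains_com_def
    by (rule runs_mono[OF runs_Seq_loop_free[OF _ _ _
        runs_Seq_loop_free[OF _ _ _ runs_Seq_loop_free[OF _ _ _ main]]]])
      simp_all
qed

section \<open>Knapsack by dynamic programming over the total gain\<close>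

definition table_ok :: "nat \<Rightarrow> (nat \<Rightarrow> int) \<Rightarrow> int \<Rightarrow> nat set \<Rightarrow> (int \<Rightarrow> int) \<Rightarrow> (int \<Rightarrow> int) \<Rightarrow> bool" where
  "table_ok i f P X T M \<longleftrightarrow> (\<forall>p. 0 \<le> p \<longrightarrow> p \<le> P \<longrightarrow> T p \<le> D + 1 \<and>
     (T p \<le> D \<longrightarrow> (\<exists>C\<subseteq>X. T p = base i + sum w C \<and> M p = code C \<and> sum f C = p)) \<and>
     (\<forall>C\<subseteq>X. sum f C = p \<longrightarrow> base i + sum w C \<le> D \<longrightarrow> T p \<le> base i + sum w C))"

text \<open>Without items only gain 0 is attained, at the size \<open>base i\<close> of the clique
  item. The value \<open>D + 1\<close> plays the role of infinity: being above the capacity, it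
  promises no configuration.\<close>

lemma table_ok_empty:
  assumes "\<And>p. 0 < p \<Longrightarrow> p \<le> P \<Longrightarrow> T p = D + 1" "T 0 = base i" "M 0 = 0"
  shows "table_ok i f P {} T M"
  unfolding table_ok_def
proof (intro allI impI)
  fix p :: int assume p: "0 \<le> p" "p \<le> P"
  show "T p \<le> D + 1 \<and>
     (T p \<le> D \<longrightarrow> (\<exists>C\<subseteq>{}. T p = base i + sum w C \<and> M p = code C \<and> sum f C = p)) \<and>
     (\<forall>C\<subseteq>{}. sum f C = p \<longrightarrow> base i + sum w C \<le> D \<longrightarrow> T p \<le> base i + sum w C)"
  proof (cases "p = 0")
    case True
    then show ?thesis using assms base_bounds(2)[of i] by auto
  next
    case False
    then show ?thesis using assms(1)[of p] p by auto
  qed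
qed

lemma table_ok_insert:
  assumes ok: "table_ok i f P X T M" and X: "X \<subseteq> {..<j}" and j: "j < n" "0 < f j"
    and f: "\<And>l. l \<in> X \<Longrightarrow> 0 \<le> f l"
    and T': "\<And>p. 0 \<le> p \<Longrightarrow> p \<le> P \<Longrightarrow>
      T' p = (if f j \<le> p \<and> T (p - f j) + w j < T p then T (p - f j) + w j else T p)"
    and M': "\<And>p. 0 \<le> p \<Longrightarrow> p \<le> P \<Longrightarrow>
      M' p = (if f j \<le> p \<and> T (p - f j) + w j < T p then M (p - f j) + 2 ^ j else M p)"
  shows "table_ok i f P (insert j X) T' M'"
  unfolding table_ok_def
proof (intro allI impI conjI)
  fix p :: int assume p: "0 \<le> p" "p \<le> P"
  let ?a = "p - f j"
  have finX: "finite X" "j \<notin> X" using X finite_subset by auto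
  have okp: "T p \<le> D + 1" using ok p by (simp add: table_ok_def)
  show "T' p \<le> D + 1" using T'[OF p] okp by auto
  show "\<exists>C\<subseteq>insert j X. T' p = base i + sum w C \<and> M' p = code C \<and> sum f C = p" if le: "T' p \<le> D"
  proof (cases "f j \<le> p \<and> T ?a + w j < T p")
    case True
    then have a: "0 \<le> ?a" "?a \<le> P" using p j by auto
    \<comment> \<open>A strict improvement on an entry that is at most \<open>D + 1\<close> must
      start from an entry within the capacity, which a configuration realizes.\<close>
    have "T ?a \<le> D" using True okp w_nonneg[OF j(1)] by linarith
    then obtain C where C: "C \<subseteq> X" "T ?a = base i + sum w C" "M ?a = code C" "sum f C = ?a"
      using ok a unfolding table_ok_def by blast
    have fin: "finite C" "j \<notin> C" using C(1) finX finite_subset by auto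
    then show ?thesis using C T'[OF p] M'[OF p] True
      by (intro exI[of _ "insert j C"]) (auto simp: code_insert)
  next
    case False
    then have "T' p = T p" "M' p = M p" using T'[OF p] M'[OF p] by auto
    then obtain C where "C \<subseteq> X" "T' p = base i + sum w C" "M' p = code C" "sum f C = p"
      using ok p le unfolding table_ok_def by metis
    then show ?thesis by (intro exI[of _ C]) auto
  qed
  fix C assume C: "C \<subseteq> insert j X" "sum f C = p" "base i + sum w C \<le> D"
  have T'p: "T' p \<le> T p" using T'[OF p] by auto
  show "T' p \<le> base i + sum w C"
  proof (cases "j \<in> C")
    case True
    define C' where "C' = C - {j}"
    have C': "C' \<subseteq> X" "finite C'" using C(1) finX finite_subset by (auto simp: C'_def)
    have "C = insert j C'" "j \<notin> C'" using True by (auto simp: C'_def)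
    then have s: "sum f C = f j + sum f C'" "sum w C = w j + sum w C'" using C'(2) by auto
    have "0 \<le> sum f C'" using f C'(1) by (intro sum_nonneg) auto
    then have a: "0 \<le> ?a" "?a \<le> P" "sum f C' = ?a" using s C(2) p j by auto
    moreover have "base i + sum w C' \<le> D" using s C(3) w_nonneg[OF j(1)] by linarith
    ultimately have "T ?a \<le> base i + sum w C'" using ok C'(1) unfolding table_ok_def by blast
    moreover have "T' p \<le> T ?a + w j" using T'[OF p] a(1) by auto
    ultimately show ?thesis using s by linarith
  next
    case False
    then have "C \<subseteq> X" using C(1) by auto
    then have "T p \<le> base i + sum w C" using ok p C unfolding table_ok_def by blast
    then show ?thesis using T'p by linarith
  qed
qed

definition responding :: "nat \<Rightarrow> nat \<Rightarrow> (nat \<Rightarrow> nat set) \<Rightarrow> nat \<Rightarrow> memory \<Rightarrow> bool" where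
  "responding h i A N m \<longleftrightarrow> searching h i A m \<and> m (adr cP 0) = int N \<and>
     (\<forall>l<n. m (adr cGAIN (int l)) = G h A i l)"

lemma responding_agree:
  assumes "responding h i A N m" "agree X m m'"
    "X \<inter> {cN, cD, cC, cKIT, cSZ, cVAL, cINK, cH, cI, cBIN, cP, cGAIN} = {}"
  shows "responding h i A N m'"
proof -
  have X: "cP \<notin> X" "cGAIN \<notin> X" using assms(3) by blast+
  have "searching h i A m'" using assms by (auto simp: responding_def intro: searching_agree)
  then show ?thesis using assms(1) unfolding responding_def by (simp add: agreeD[OF assms(2)] X)
qed

lemma respondingD:
  assumes "responding h i A N m"
  shows "m (adr cP 0) = int N" "l < n \<Longrightarrow> m (adr cGAIN (int l)) = G h A i l" "m (adr cN 0) = int n"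
    "m (adr cD 0) = D" "l < n \<Longrightarrow> m (adr cSZ (int l)) = w l" "m (adr cC 0) = int (length ks)"
    "l < length ks \<Longrightarrow> m (adr cKIT (int l)) = int (ks ! l)"  "m (adr cI 0) = int i"
  using assms by (simp_all add: responding_def searching_def prepared_def)

lemma table_run:
  assumes s: "responding h i A N m"
  shows "runs g table_com m (400 + Suc (Suc N) * 100) (\<lambda>m'. agree {cQ, cTT, cMK, cPW} m m' \<and>
    m' (adr cPW 0) = 1 \<and> table_ok i f (int N) {} (\<lambda>p. m' (adr cTT p)) (\<lambda>p. m' (adr cMK p)))" (is "runs _ _ _ _ ?Q")
  unfolding table_com_def
proof (rule runs_Seq)
  define Inv where "Inv = (\<lambda>q m'. agree {cQ, cTT, cMK, cPW} m m' \<and>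
    (\<forall>p::int. 0 \<le> p \<longrightarrow> p < int q \<longrightarrow> m' (adr cTT p) = D + 1))"
  show "runs g (For cQ (Var cP \<oplus> Const 1) (Put cTT (Var cQ) (Var cD \<oplus> Const 1))) m
    (Suc (Suc N) * 100) (\<lambda>m'. m' (adr cQ 0) = int (Suc N) \<and> Inv (Suc N) m')"
  proof (rule runs_For)
    show "Inv 0 (m(adr cQ 0 := 0))" by (simp add: Inv_def)
  next
    fix q m' assume "Inv q m'"
    then have "responding h i A N m'" by (auto simp: Inv_def intro: responding_agree[OF s])
    then show "expr_ok g (Var cP \<oplus> Const 1) m' \<and> expr_val (Var cP \<oplus> Const 1) m' = int (Suc N)"
      by (simp add: respondingD)
  next
    fix q m' assume q: "q < Suc N" "Inv q m'" "m' (adr cQ 0) = int q"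
    then have r: "responding h i A N m'" by (auto simp: Inv_def intro: responding_agree[OF s])
    show "runs g (Put cTT (Var cQ) (Var cD \<oplus> Const 1)) m' 30
      (\<lambda>m''. m'' (adr cQ 0) = int q \<and> Inv (Suc q) (m''(adr cQ 0 := int (Suc q))))"
      using q(2,3) by (intro runs_loop_free) (auto simp: Inv_def respondingD[OF r])
  qed simp_all
  fix m1 assume m1: "m1 (adr cQ 0) = int (Suc N) \<and> Inv (Suc N) m1"
  then have r: "responding h i A N m1" and ag: "agree {cQ, cTT, cMK, cPW} m m1"
    by (auto simp: Inv_def intro: responding_agree[OF s])
  have T: "m1 (adr cTT p) = D + 1" if "0 < p" "p \<le> int N" for p
    using m1 that by (simp add: Inv_def)
  show "runs g (Put cTT (Const 0) (Const 0);;
     Cond (Var cI \<prec> Var cC) (Put cTT (Const 0) (Arr cSZ (Arr cKIT (Var cI)))) Skip;;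
     Put cMK (Const 0) (Const 0);; Set cPW (Const 1)) m1 300
     ?Q"
  proof (rule runs_loop_free)
    let ?c = "Put cTT (Const 0) (Const 0);;
     Cond (Var cI \<prec> Var cC) (Put cTT (Const 0) (Arr cSZ (Arr cKIT (Var cI)))) Skip;;
     Put cMK (Const 0) (Const 0);; Set cPW (Const 1)"
    have "table_ok i f (int N) {} (\<lambda>p. post ?c m1 (adr cTT p)) (\<lambda>p. post ?c m1 (adr cMK p))"
      by (rule table_ok_empty; cases "i < length ks")
        (simp_all add: T respondingD[OF r] base_def ks_nth)
    then show "agree {cQ, cTT, cMK, cPW} m (post ?c m1) \<and> post ?c m1 (adr cPW 0) = 1 \<and>
       table_ok i f (int N) {} (\<lambda>p. post ?c m1 (adr cTT p)) (\<lambda>p. post ?c m1 (adr cMK p))"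
      using ag by simp
  qed simp_all
qed simp

text \<open>After \<open>q\<close> rounds exactly the entries above \<open>int N - int q\<close> are
  new. The entry read at \<open>u - c\<close> lies strictly below \<open>u\<close>, since
  \<open>c\<close> is positive, so that every new entry is computed from the old table, as
  \<open>table_ok_insert\<close> requires.\<close>

lemma item_run:
  assumes s: "responding h i A N m" and j: "j < n" "m (adr cJ 0) = int j" "0 < G h A i j"
    and pw: "m (adr cPW 0) = 2 ^ j" and X: "X \<subseteq> {..<j}" and GN: "G h A i j \<le> int N"
    and ok: "table_ok i (G h A i) (int N) X (\<lambda>p. m (adr cTT p)) (\<lambda>p. m (adr cMK p))"
  shows "runs g item_com m (Suc (Suc N) * 400) (\<lambda>m'. agree {cQ, cTT, cMK, cU, cA} m m' \<and>
    table_ok i (G h A i) (int N) (insert j X) (\<lambda>p. m' (adr cTT p)) (\<lambda>p. m' (adr cMK p)))"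
proof -
  define c where "c = G h A i j"
  define imp where "imp = (\<lambda>p. c \<le> p \<and> m (adr cTT (p - c)) + w j < m (adr cTT p))"
  define T' where "T' = (\<lambda>p. if imp p then m (adr cTT (p - c)) + w j else m (adr cTT p))"
  define M' where "M' = (\<lambda>p. if imp p then m (adr cMK (p - c)) + 2 ^ j else m (adr cMK p))"
  define Inv where "Inv = (\<lambda>q m'. agree {cQ, cTT, cMK, cU, cA} m m' \<and>
    (\<forall>p. m' (adr cTT p) = (if int N - int q < p \<and> p \<le> int N then T' p else m (adr cTT p))) \<and>
    (\<forall>p. m' (adr cMK p) = (if int N - int q < p \<and> p \<le> int N then M' p else m (adr cMK p))))"
  \<comment> \<open>Entries below the gain \<open>c\<close> of the item cannot change, which leaves
    \<open>N + 1 - c\<close> rounds.\<close>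
  define L where "L = nat (int N + 1 - c)"
  have L: "int L = int N + 1 - c" using GN by (simp add: L_def c_def)
  have c: "0 < c" using j by (simp add: c_def)
  have "runs g item_com m (Suc (Suc N) * 400) (\<lambda>m'. m' (adr cQ 0) = int L \<and> Inv L m')"
    unfolding item_com_def
  proof (rule runs_For)
    show "Inv 0 (m(adr cQ 0 := 0))" by (simp add: Inv_def)
  next
    fix q m' assume "Inv q m'"
    then have r: "responding h i A N m'" and ag: "agree {cQ, cTT, cMK, cU, cA} m m'"
      by (auto simp: Inv_def intro: responding_agree[OF s])
    show "expr_ok g (Var cP \<oplus> Const 1 \<ominus> Arr cGAIN (Var cJ)) m' \<and>
      expr_val (Var cP \<oplus> Const 1 \<ominus> Arr cGAIN (Var cJ)) m' = int L"
      by (simp add: agreeD[OF ag] j respondingD[OF s] L c_def)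
  next
    fix q m' assume q: "q < L" "Inv q m'" "m' (adr cQ 0) = int q"
    then have ag: "agree {cQ, cTT, cMK, cU, cA} m m'" by (simp add: Inv_def)
    note r = responding_agree[OF s ag]
    define u where "u = int N - int q"
    have u: "c \<le> u" "u \<le> int N" using q(1) L by (auto simp: u_def)
    have T: "m' (adr cTT u) = m (adr cTT u)" "m' (adr cTT (u - c)) = m (adr cTT (u - c))"
      "m' (adr cMK (u - c)) = m (adr cMK (u - c))"
      using q(2) c by (auto simp: Inv_def u_def)
    have m': "m' (adr cP 0) = int N" "m' (adr cGAIN (int j)) = c" "m' (adr cJ 0) = int j"
      "m' (adr cSZ (int j)) = w j" "m' (adr cPW 0) = 2 ^ j"
      using j pw by (simp_all add: agreeD[OF ag] respondingD[OF s] c_def)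
    have T'u: "T' u = (if m (adr cTT (u - c)) + w j < m (adr cTT u) then m (adr cTT (u - c)) + w j
        else m (adr cTT u))"
      and M'u: "M' u = (if m (adr cTT (u - c)) + w j < m (adr cTT u) then m (adr cMK (u - c)) + 2 ^ j
        else m (adr cMK u))"
      using u by (auto simp: T'_def M'_def imp_def)
    have IT: "\<forall>p. m' (adr cTT p) = (if int N - int q < p \<and> p \<le> int N then T' p else m (adr cTT p))"
      "\<forall>p. m' (adr cMK p) = (if int N - int q < p \<and> p \<le> int N then M' p else m (adr cMK p))"
      using q(2) by (auto simp: Inv_def)
    let ?c = "Set cU (Var cP \<ominus> Var cQ);; Set cA (Var cU \<ominus> Arr cGAIN (Var cJ));;
        Cond (Arr cTT (Var cA) \<oplus> Arr cSZ (Var cJ) \<prec> Arr cTT (Var cU))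
          (Put cTT (Var cU) (Arr cTT (Var cA) \<oplus> Arr cSZ (Var cJ));;
           Put cMK (Var cU) (Arr cMK (Var cA) \<oplus> Var cPW))
          Skip"
    have nq: "int N - int q = u" by (simp add: u_def)
    show "runs g ?c m' 250
      (\<lambda>m''. m'' (adr cQ 0) = int q \<and> Inv (Suc q) (m''(adr cQ 0 := int (Suc q))))"
    proof (rule runs_loop_free)
      show "com_ok g ?c m'"
        by (simp add: m' q(3))
      show "post ?c m' (adr cQ 0) = int q \<and> Inv (Suc q) ((post ?c m')(adr cQ 0 := int (Suc q)))"
      proof (cases "m (adr cTT (u - c)) + w j < m (adr cTT u)")
        case True
        have "post ?c m' = m'(adr cU 0 := u, adr cA 0 := u - c, adr cTT u := T' u, adr cMK u := M' u)"
          using True by (simp add: m' q(3) nq T T'u M'u)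
        moreover have "Inv (Suc q) (m'(adr cU 0 := u, adr cA 0 := u - c, adr cTT u := T' u,
            adr cMK u := M' u, adr cQ 0 := int (Suc q)))"
          unfolding Inv_def
        proof (intro conjI)
          show "agree {cQ, cTT, cMK, cU, cA} m (m'(adr cU 0 := u, adr cA 0 := u - c,
              adr cTT u := T' u, adr cMK u := M' u, adr cQ 0 := int (Suc q)))"
            using ag u c by simp
        qed (use u in \<open>auto simp: IT u_def\<close>)
        ultimately show ?thesis by (simp only: fun_upd_apply adr_eq_iff) (simp add: q(3))
      next
        case False
        have "post ?c m' = m'(adr cU 0 := u, adr cA 0 := u - c)"
          using False by (simp add: m' q(3) nq T)
        moreover have "T' u = m (adr cTT u)" "M' u = m (adr cMK u)" using False T'u M'u by auto
        then have "Inv (Suc q) (m'(adr cU 0 := u, adr cA 0 := u - c, adr cQ 0 := int (Suc q)))"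
          unfolding Inv_def
        proof (intro conjI)
          show "agree {cQ, cTT, cMK, cU, cA} m (m'(adr cU 0 := u, adr cA 0 := u - c, adr cQ 0 := int (Suc q)))"
            using ag by simp
          have eq: "p = u" if "int N - int (Suc q) < p" "\<not> int N - int q < p" for p
            using that by (simp add: u_def)
          show "\<forall>p. (m'(adr cU 0 := u, adr cA 0 := u - c, adr cQ 0 := int (Suc q))) (adr cTT p) =
              (if int N - int (Suc q) < p \<and> p \<le> int N then T' p else m (adr cTT p))"
            using eq \<open>T' u = m (adr cTT u)\<close> by (auto simp: IT)
          show "\<forall>p. (m'(adr cU 0 := u, adr cA 0 := u - c, adr cQ 0 := int (Suc q))) (adr cMK p) =
              (if int N - int (Suc q) < p \<and> p \<le> int N then M' p else m (adr cMK p))"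
            using eq \<open>M' u = m (adr cMK u)\<close> by (auto simp: IT)
        qed
        ultimately show ?thesis by (simp only: fun_upd_apply adr_eq_iff) (simp add: q(3))
      qed
    qed simp_all
  qed (use L c in \<open>simp_all add: algebra_simps\<close>)
  then show ?thesis
  proof (rule runs_mono)
    fix m' assume "m' (adr cQ 0) = int L \<and> Inv L m'"
    then have m': "agree {cQ, cTT, cMK, cU, cA} m m'"
      "\<forall>p. m' (adr cTT p) = (if c - 1 < p \<and> p \<le> int N then T' p else m (adr cTT p))"
      "\<forall>p. m' (adr cMK p) = (if c - 1 < p \<and> p \<le> int N then M' p else m (adr cMK p))"
      using L by (auto simp: Inv_def)
    have "table_ok i (G h A i) (int N) (insert j X) (\<lambda>p. m' (adr cTT p)) (\<lambda>p. m' (adr cMK p))"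
      by (rule table_ok_insert[OF ok X j(1,3) G_nonneg])
        (auto simp: m' T'_def M'_def imp_def c_def)
    then show "agree {cQ, cTT, cMK, cU, cA} m m' \<and>
      table_ok i (G h A i) (int N) (insert j X) (\<lambda>p. m' (adr cTT p)) (\<lambda>p. m' (adr cMK p))"
      using m' by blast
  qed simp
qed

end


text \<open>\<open>1640 = 40 * 41\<close>: a profit is at most \<open>40 * n\<close> by
  \<open>v_le\<close>, the factor is at most \<open>dd 0\<close>, and there are \<open>n\<close>
  items.\<close>

definition max_gain :: "nat \<Rightarrow> nat" where "max_gain n = 1640 * n * n"

definition respond_bound :: "nat \<Rightarrow> nat" where
  "respond_bound n = 1000 + Suc n * (Suc n * 200 + 710) +
     (600 + Suc (Suc (max_gain n)) * 100 + Suc n * (Suc (Suc (max_gain n)) * 400 + 200)) +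
     (20 + Suc (Suc (max_gain n)) * 200)"

text \<open>\<open>2960 = 74 * 40\<close>: the potential is at most 74 times the total profit, which
  is at most \<open>40 * n * n\<close>. Every level of the potential allows at most
  \<open>Suc h\<close> best responses.\<close>

definition search_bound :: "nat \<Rightarrow> nat" where
  "search_bound n = 60 + Suc n * 100 + Suc (2960 * n * n * Suc n + n) * (30 + respond_bound n)"

context ram_split
begin

lemma knapsack_run:
  assumes s: "responding h i A N m" and N: "int N = (\<Sum>l<n. G h A i l)"
  shows "runs g knapsack_com m (600 + Suc (Suc N) * 100 + Suc n * (Suc (Suc N) * 400 + 200))
    (\<lambda>m'. agree {cQ, cTT, cMK, cPW, cU, cA, cJ} m m' \<and>
      table_ok i (G h A i) (int N) {l. l < n \<and> 0 < G h A i l} (\<lambda>p. m' (adr cTT p)) (\<lambda>p. m' (adr cMK p)))"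
  unfolding knapsack_com_def
proof (rule runs_Seq[OF table_run[OF s, of "G h A i"]])
  let ?G = "G h A i"
  define Y where "Y = {cQ, cTT, cMK, cPW, cU, cA, cJ}"
  define Inv where "Inv = (\<lambda>j m'. agree Y m m' \<and> m' (adr cPW 0) = 2 ^ j \<and>
    table_ok i ?G (int N) {l. l < j \<and> 0 < ?G l} (\<lambda>p. m' (adr cTT p)) (\<lambda>p. m' (adr cMK p)))"
  have tr: "responding h i A N m'" if "agree Y m m'" for m'
    by (rule responding_agree[OF s that]) (simp add: Y_def)
  let ?body = "Cond (Const 0 \<prec> Arr cGAIN (Var cJ)) item_com Skip;; Set cPW (Var cPW \<oplus> Var cPW)"
  fix m1 assume m1: "agree {cQ, cTT, cMK, cPW} m m1 \<and> m1 (adr cPW 0) = 1 \<and>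
    table_ok i ?G (int N) {} (\<lambda>p. m1 (adr cTT p)) (\<lambda>p. m1 (adr cMK p))"
  have "runs g (For cJ (Var cN) ?body) m1 (Suc n * (Suc (Suc N) * 400 + 200))
    (\<lambda>m'. m' (adr cJ 0) = int n \<and> Inv n m')"
  proof (rule runs_For)
    have "agree Y m m1" using m1 by (auto simp: Y_def intro: agree_trans[of "{cQ, cTT, cMK, cPW}" _ _ "{}"])
    then show "Inv 0 (m1(adr cJ 0 := 0))" using m1 by (simp add: Inv_def Y_def)
  next
    fix j m' assume "Inv j m'"
    then show "expr_ok g (Var cN) m' \<and> expr_val (Var cN) m' = int n"
      using respondingD(3)[OF tr] by (simp add: Inv_def)
  next
    fix j m' assume j: "j < n" "Inv j m'" "m' (adr cJ 0) = int j"
    then have ag: "agree Y m m'" and pw: "m' (adr cPW 0) = 2 ^ j"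
      and ok: "table_ok i ?G (int N) {l. l < j \<and> 0 < ?G l} (\<lambda>p. m' (adr cTT p)) (\<lambda>p. m' (adr cMK p))"
      by (auto simp: Inv_def)
    note r = tr[OF ag]
    let ?Q = "\<lambda>m''. agree {cQ, cTT, cMK, cU, cA} m' m'' \<and>
      table_ok i ?G (int N) {l. l < Suc j \<and> 0 < ?G l} (\<lambda>p. m'' (adr cTT p)) (\<lambda>p. m'' (adr cMK p))"
    show "runs g ?body m' (Suc (Suc N) * 400 + 100)
      (\<lambda>m''. m'' (adr cJ 0) = int j \<and> Inv (Suc j) (m''(adr cJ 0 := int (Suc j))))"
    proof (rule runs_Seq)
      show "runs g (Cond (Const 0 \<prec> Arr cGAIN (Var cJ)) item_com Skip) m' (Suc (Suc N) * 400 + 30) ?Q"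
      proof (rule runs_Cond)
        assume "expr_val (Const 0 \<prec> Arr cGAIN (Var cJ)) m' \<noteq> 0"
        then have pos: "0 < ?G j" using respondingD(2)[OF r j(1)] j(3) by (auto split: if_splits)
        have eq: "{l. l < Suc j \<and> 0 < ?G l} = insert j {l. l < j \<and> 0 < ?G l}"
          using pos by (auto simp: less_Suc_eq)
        have "?G j \<le> int N" unfolding N using j(1) G_nonneg by (intro member_le_sum) auto
        then show "runs g item_com m' (Suc (Suc N) * 400) ?Q"
          unfolding eq by (intro item_run[OF r j(1,3) pos pw _ _ ok]) auto
      next
        assume "expr_val (Const 0 \<prec> Arr cGAIN (Var cJ)) m' = 0"
        then have "\<not> 0 < ?G j" using respondingD(2)[OF r j(1)] j(3) by (auto split: if_splits)
        then have eq: "{l. l < Suc j \<and> 0 < ?G l} = {l. l < j \<and> 0 < ?G l}"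
          by (auto simp: less_Suc_eq)
        show "runs g Skip m' (Suc (Suc N) * 400) ?Q"
          unfolding eq using ok by (intro runs_Skip) simp_all
      qed simp_all
      fix m2 assume m2: "?Q m2"
      then have ag2: "agree {cQ, cTT, cMK, cU, cA} m' m2" by blast
      have "agree Y m m2" by (rule agree_ext[OF ag ag2]) (simp add: Y_def)
      then show "runs g (Set cPW (Var cPW \<oplus> Var cPW)) m2 30
        (\<lambda>m''. m'' (adr cJ 0) = int j \<and> Inv (Suc j) (m''(adr cJ 0 := int (Suc j))))"
        using m2 by (intro runs_loop_free) (simp_all add: Inv_def agreeD[OF ag2] j pw Y_def)
    qed simp
  qed (simp_all add: algebra_simps)
  then show "runs g (For cJ (Var cN) ?body) m1 (Suc n * (Suc (Suc N) * 400 + 200))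
    (\<lambda>m'. agree {cQ, cTT, cMK, cPW, cU, cA, cJ} m m' \<and>
      table_ok i ?G (int N) {l. l < n \<and> 0 < ?G l} (\<lambda>p. m' (adr cTT p)) (\<lambda>p. m' (adr cMK p)))"
    by (rule runs_mono) (auto simp: Inv_def Y_def)
qed simp

text \<open>The scan ascends, so the last entry within the capacity is the largest gain. Starting
  with 0 is sound, because the empty configuration is feasible.\<close>

lemma best_run:
  assumes s: "responding h i A N m" and T: "m (adr cTT 0) \<le> D"
  shows "runs g best_com m (20 + Suc (Suc N) * 200) (\<lambda>m'. agree {cQ, cBEST} m m' \<and>
    (\<exists>b. m' (adr cBEST 0) = b \<and> 0 \<le> b \<and> b \<le> int N \<and> m (adr cTT b) \<le> D \<and>
      (\<forall>p. 0 \<le> p \<longrightarrow> p \<le> int N \<longrightarrow> m (adr cTT p) \<le> D \<longrightarrow> p \<le> b)))" (is "runs _ _ _ _ ?Q")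
  unfolding best_com_def
proof (rule runs_Seq)
  show "runs g (Set cBEST (Const 0)) m 7 (\<lambda>m1. m1 = m(adr cBEST 0 := 0))"
    by (rule runs_loop_free) simp_all
  define Inv where "Inv = (\<lambda>q m'. agree {cQ, cBEST} m m' \<and>
    (\<exists>b. m' (adr cBEST 0) = b \<and> 0 \<le> b \<and> b \<le> int N \<and> m (adr cTT b) \<le> D \<and>
      (\<forall>p. 0 \<le> p \<longrightarrow> p < int q \<longrightarrow> m (adr cTT p) \<le> D \<longrightarrow> p \<le> b)))"
  fix m1 assume m1: "m1 = m(adr cBEST 0 := 0)"
  have "runs g (For cQ (Var cP \<oplus> Const 1)
      (Cond (Arr cTT (Var cQ) \<prec> Var cD \<oplus> Const 1) (Set cBEST (Var cQ)) Skip)) m1 (Suc (Suc N) * 200)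
    (\<lambda>m'. m' (adr cQ 0) = int (Suc N) \<and> Inv (Suc N) m')"
  proof (rule runs_For)
    show "Inv 0 (m1(adr cQ 0 := 0))" using T by (simp add: Inv_def m1)
  next
    fix q m' assume "Inv q m'"
    then have "responding h i A N m'" by (auto simp: Inv_def intro: responding_agree[OF s])
    then show "expr_ok g (Var cP \<oplus> Const 1) m' \<and> expr_val (Var cP \<oplus> Const 1) m' = int (Suc N)"
      by (simp add: respondingD)
  next
    fix q m' assume q: "q < Suc N" "Inv q m'" "m' (adr cQ 0) = int q"
    then obtain b where ag: "agree {cQ, cBEST} m m'" and b: "m' (adr cBEST 0) = b" "0 \<le> b" "b \<le> int N"
      "m (adr cTT b) \<le> D" "\<And>p. 0 \<le> p \<Longrightarrow> p < int q \<Longrightarrow> m (adr cTT p) \<le> D \<Longrightarrow> p \<le> b"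
      by (auto simp: Inv_def)
    have m': "m' (adr cTT (int q)) = m (adr cTT (int q))" "m' (adr cD 0) = D"
      by (simp_all add: agreeD[OF ag] respondingD[OF s])
    let ?c = "Cond (Arr cTT (Var cQ) \<prec> Var cD \<oplus> Const 1) (Set cBEST (Var cQ)) Skip"
    show "runs g ?c m' 50 (\<lambda>m''. m'' (adr cQ 0) = int q \<and> Inv (Suc q) (m''(adr cQ 0 := int (Suc q))))"
    proof (rule runs_loop_free)
      show "post ?c m' (adr cQ 0) = int q \<and> Inv (Suc q) ((post ?c m')(adr cQ 0 := int (Suc q)))"
      proof (cases "m (adr cTT (int q)) \<le> D")
        case True
        then have "post ?c m' = m'(adr cBEST 0 := int q)" by (simp add: q m')
        then show ?thesis using True q(1,3) ag by (simp add: Inv_def)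
      next
        case False
        have "p \<le> b" if p: "0 \<le> p" "p < 1 + int q" "m (adr cTT p) \<le> D" for p
        proof (cases "p = int q")
          case True
          then show ?thesis using p False by simp
        next
          case False
          then show ?thesis using p by (intro b(5)) auto
        qed
        moreover have "post ?c m' = m'" using False by (simp add: q m')
        ultimately show ?thesis using q(1,3) ag b by (simp add: Inv_def)
      qed
    qed simp_all
  qed simp_all
  then show "runs g (For cQ (Var cP \<oplus> Const 1)
      (Cond (Arr cTT (Var cQ) \<prec> Var cD \<oplus> Const 1) (Set cBEST (Var cQ)) Skip)) m1 (Suc (Suc N) * 200)
    ?Q"
    by (rule runs_mono) (auto simp: Inv_def)
qed simp

lemma respond_run:
  assumes s: "searching h i A m" and i: "i < h" and hn: "h \<le> n"
  shows "runs g respond_com m (respond_bound n) (\<lambda>m'.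
    agree {cJ, cA, cCNT, cGAIN, cCUR, cP, cPW, cQ, cTT, cMK, cU, cBEST, cI, cBIN} m m' \<and>
    ((\<exists>C. config i C \<and> (\<Sum>l\<in>A i. gain v A h i l) < (\<Sum>l\<in>C. gain v A h i l) \<and>
        searching h 0 (A(i := C)) m') \<or>
     (\<forall>C. config i C \<longrightarrow> (\<Sum>l\<in>C. gain v A h i l) \<le> (\<Sum>l\<in>A i. gain v A h i l)) \<and>
        searching h (Suc i) A m'))"
proof -
  let ?G = "G h A i"
  let ?X = "{cJ, cA, cCNT, cGAIN, cCUR, cP, cPW, cQ, cTT, cMK, cU, cBEST, cI, cBIN}"
  define cur where "cur = (\<Sum>l\<in>A i. gain v A h i l)"
  define N where "N = nat (\<Sum>l<n. ?G l)"
  have N: "int N = (\<Sum>l<n. ?G l)" using G_nonneg by (simp add: N_def sum_nonneg)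
  have "int N \<le> (\<Sum>l<n. 1640 * int n)" unfolding N using G_le by (intro sum_mono) auto
  then have "int N \<le> int (max_gain n)" by (simp add: max_gain_def)
  then have NN: "N \<le> (max_gain n)" by simp
  let ?k1 = "50 + Suc n * (Suc h * 200 + 710)"
  let ?k2 = "600 + Suc (Suc N) * 100 + Suc n * (Suc (Suc N) * 400 + 200)"
  let ?k3 = "20 + Suc (Suc N) * 200"
  let ?tail = "Cond (Var cCUR \<prec> Var cBEST)
       (Put cBIN (Var cI) (Arr cMK (Var cBEST));; Set cI (Const 0)) (Set cI (Var cI \<oplus> Const 1))"
  let ?Q = "\<lambda>m'. agree ?X m m' \<and>
    ((\<exists>C. config i C \<and> cur < (\<Sum>l\<in>C. gain v A h i l) \<and> searching h 0 (A(i := C)) m') \<or>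
     (\<forall>C. config i C \<longrightarrow> (\<Sum>l\<in>C. gain v A h i l) \<le> cur) \<and> searching h (Suc i) A m')"
  have "runs g respond_com m (?k1 + ?k2 + ?k3 + 300) ?Q"
    unfolding respond_com_def
  proof (rule runs_Seq[OF gains_run[OF s i]])
    fix m1 assume "agree {cJ, cA, cCNT, cGAIN, cCUR, cP, cPW} m m1 \<and>
       m1 (adr cP 0) = (\<Sum>l<n. ?G l) \<and> m1 (adr cCUR 0) = (\<Sum>l\<in>A i. gain v A h i l) \<and>
       (\<forall>l<n. m1 (adr cGAIN (int l)) = ?G l)"
    then have ag1: "agree {cJ, cA, cCNT, cGAIN, cCUR, cP, cPW} m m1" and P: "m1 (adr cP 0) = int N"
      and cur1: "m1 (adr cCUR 0) = cur" and gs: "\<forall>l<n. m1 (adr cGAIN (int l)) = ?G l"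
      by (simp_all add: N cur_def)
    have s1: "searching h i A m1" by (rule searching_agree[OF s ag1]) simp
    then have r1: "responding h i A N m1" using P gs by (simp add: responding_def)
    show "runs g (knapsack_com;; best_com;; ?tail) m1 (?k2 + ?k3 + 290) ?Q"
    proof (rule runs_Seq[OF knapsack_run[OF r1 N]])
      fix m2 assume 2: "agree {cQ, cTT, cMK, cPW, cU, cA, cJ} m1 m2 \<and>
        table_ok i ?G (int N) {l. l < n \<and> 0 < ?G l} (\<lambda>p. m2 (adr cTT p)) (\<lambda>p. m2 (adr cMK p))"
      then have ag2: "agree {cQ, cTT, cMK, cPW, cU, cA, cJ} m1 m2"
        and ok: "table_ok i ?G (int N) {l. l < n \<and> 0 < ?G l} (\<lambda>p. m2 (adr cTT p)) (\<lambda>p. m2 (adr cMK p))"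
        by auto
      have r2: "responding h i A N m2" by (rule responding_agree[OF r1 ag2]) simp
      have opt: "m2 (adr cTT (sum ?G C)) \<le> base i + sum w C \<and> sum ?G C \<le> int N"
        if "C \<subseteq> {l. l < n \<and> 0 < ?G l}" "base i + sum w C \<le> D" for C
      proof -
        have "sum ?G C \<le> int N"
          unfolding N using that(1) G_nonneg by (intro sum_mono2) auto
        moreover have "0 \<le> sum ?G C" using G_nonneg by (intro sum_nonneg)
        ultimately show ?thesis using ok that unfolding table_ok_def by blast
      qed
      have T0: "m2 (adr cTT 0) \<le> D"
        using opt[of "{}"] base_bounds(2)[of i] by simp
      show "runs g (best_com;; ?tail) m2 (?k3 + 280) ?Q"
      proof (rule runs_Seq[OF best_run[OF r2 T0]])
        fix m3 assume "agree {cQ, cBEST} m2 m3 \<and> (\<exists>b. m3 (adr cBEST 0) = b \<and> 0 \<le> b \<and> b \<le> int N \<and>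
          m2 (adr cTT b) \<le> D \<and> (\<forall>p. 0 \<le> p \<longrightarrow> p \<le> int N \<longrightarrow> m2 (adr cTT p) \<le> D \<longrightarrow> p \<le> b))"
        then obtain b where ag3: "agree {cQ, cBEST} m2 m3" and b: "m3 (adr cBEST 0) = b" "0 \<le> b"
          "b \<le> int N" "m2 (adr cTT b) \<le> D" "\<And>p. 0 \<le> p \<Longrightarrow> p \<le> int N \<Longrightarrow> m2 (adr cTT p) \<le> D \<Longrightarrow> p \<le> b"
          by blast
        have r3: "responding h i A N m3" by (rule responding_agree[OF r2 ag3]) simp
        then have s3: "searching h i A m3" by (simp add: responding_def)
        obtain C0 where C0: "C0 \<subseteq> {l. l < n \<and> 0 < ?G l}" "m2 (adr cTT b) = base i + sum w C0"
          "m2 (adr cMK b) = code C0" "sum ?G C0 = b"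
          using ok b unfolding table_ok_def by meson
        \<comment> \<open>The table combines items of positive gain only, and \<open>G\<close>
          vanishes on forbidden items; hence every set that it encodes is a configuration.\<close>
        have "allowed i l" if "0 < ?G l" for l using that by (auto simp: G_def split: if_splits)
        then have cfg: "config i C0" using C0 b(4) by (auto simp: config_def)
        have best: "(\<Sum>l\<in>C. gain v A h i l) \<le> b" if C: "config i C" for C
        proof -
          \<comment> \<open>An arbitrary competitor may contain items of gain 0. Dropping them keeps
            the gain and cannot raise the size, and what is left is accounted for in the
            table.\<close>
          define C' where "C' = {l \<in> C. 0 < ?G l}"
          have sub: "C' \<subseteq> C" and fin: "finite C" using config_finite[OF C] by (auto simp: C'_def)
          have Cn: "C \<subseteq> {..<n}" using config_S[OF C] S_n by blast
          have "sum w C' \<le> sum w C" using fin sub Cn w_nonneg by (intro sum_mono2) auto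
          then have le: "base i + sum w C' \<le> D" using C by (simp add: config_def)
          have "sum ?G C = sum ?G C'"
            using fin sub G_nonneg by (intro sum.mono_neutral_right) (auto simp: C'_def not_less intro: antisym)
          moreover have "sum ?G C' \<le> b"
          proof (rule b(5))
            show "0 \<le> sum ?G C'" using G_nonneg by (intro sum_nonneg)
            have "C' \<subseteq> {l. l < n \<and> 0 < ?G l}" using Cn by (auto simp: C'_def)
            from opt[OF this le] le show "sum ?G C' \<le> int N" "m2 (adr cTT (sum ?G C')) \<le> D" by auto
          qed
          ultimately show ?thesis using config_G[OF C] by simp
        qed
        have m3: "m3 (adr cCUR 0) = cur" "m3 (adr cI 0) = int i" "m3 (adr cMK b) = code C0"
          using cur1 C0(3) b(2) by (simp_all add: agreeD[OF ag3] agreeD[OF ag2] respondingD[OF r3])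
        have ag: "agree ?X m m1" by (rule agree_trans[OF agree_refl[of "{}"] ag1]) simp_all
        have "agree ?X m m3" by (rule agree_ext[OF agree_ext[OF ag ag2] ag3]) simp_all
        then have agX: "agree ?X m (m3(adr cBIN (int i) := a, adr cI 0 := c))"
          "agree ?X m (m3(adr cI 0 := c))" for a c
          by simp_all
        show "runs g ?tail m3 100 ?Q"
        proof (rule runs_loop_free)
          show "?Q (post ?tail m3)"
          proof (cases "cur < b")
            case True
            have "post ?tail m3 = m3(adr cBIN (int i) := code C0, adr cI 0 := 0)"
              using True b(1) m3 by simp
            moreover have "searching h 0 (A(i := C0)) (m3(adr cBIN (int i) := code C0, adr cI 0 := 0))"
            proof -
              have "prepared (m3(adr cBIN (int i) := code C0, adr cI 0 := 0))"
                by (rule prepared_agree[of m3 "{cBIN, cI}"]) (use s3 in \<open>simp_all add: searching_def\<close>)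
              then show ?thesis using s3 cfg by (simp add: searching_def)
            qed
            moreover have "cur < (\<Sum>l\<in>C0. gain v A h i l)"
              using True C0(4) config_G[OF cfg] by simp
            ultimately show ?thesis using agX cfg by metis
          next
            case False
            have "post ?tail m3 = m3(adr cI 0 := int i + 1)"
              using False b(1) m3 by simp
            moreover have "searching h (Suc i) A (m3(adr cI 0 := int i + 1))"
            proof -
              have "prepared (m3(adr cI 0 := int i + 1))"
                by (rule prepared_agree[of m3 "{cI}"]) (use s3 in \<open>simp_all add: searching_def\<close>)
              then show ?thesis using s3 by (simp add: searching_def)
            qed
            moreover have "\<forall>C. config i C \<longrightarrow> (\<Sum>l\<in>C. gain v A h i l) \<le> cur"
              using best False by force
            ultimately show ?thesis using agX by metis
          qed
        qed (use m3 b(1) in simp_all)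
      qed simp
    qed simp
  qed simp
  then show ?thesis
    unfolding cur_def
  proof (rule runs_mono)
    have "Suc n * (Suc h * 200 + 710) \<le> Suc n * (Suc n * 200 + 710)"
      using hn by (intro mult_le_mono2) simp
    moreover have "Suc n * (Suc (Suc N) * 400 + 200) \<le> Suc n * (Suc (Suc (max_gain n)) * 400 + 200)"
      using NN by (intro mult_le_mono2) simp
    moreover have "50 + a + (600 + Suc (Suc N) * 100 + b) + (20 + Suc (Suc N) * 200) + 300 \<le>
        1000 + a' + (600 + Suc (Suc (max_gain n)) * 100 + b') + (20 + Suc (Suc (max_gain n)) * 200)"
      if "a \<le> a'" "b \<le> b'" for a a' b b' :: nat
      using that NN by simp
    ultimately show "?k1 + ?k2 + ?k3 + 300 \<le> respond_bound n"
      unfolding respond_bound_def by blast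
  qed
qed


section \<open>Termination of the local search in polynomially many responses\<close>

lemma search_run:
  assumes p: "prepared m" and h: "m (adr cH 0) = int h" "h \<le> n"
  shows "runs g search_com m (search_bound n) (\<lambda>m'.
    agree {cJ, cA, cCNT, cGAIN, cCUR, cP, cPW, cQ, cTT, cMK, cU, cBEST, cI, cBIN} m m' \<and>
    (\<exists>A. searching h h A m' \<and> locally_optimal h A))"
  unfolding search_com_def
proof (rule runs_Seq)
  let ?X = "{cJ, cA, cCNT, cGAIN, cCUR, cP, cPW, cQ, cTT, cMK, cU, cBEST, cI, cBIN}"
  define Inv0 where "Inv0 = (\<lambda>a m'. agree {cI, cBIN} m m' \<and> (\<forall>b<a. m' (adr cBIN (int b)) = 0))"
  show "runs g (For cI (Var cH) (Put cBIN (Var cI) (Const 0))) m (Suc h * 100)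
    (\<lambda>m'. m' (adr cI 0) = int h \<and> Inv0 h m')"
  proof (rule runs_For)
    show "Inv0 0 (m(adr cI 0 := 0))" by (simp add: Inv0_def)
  next
    fix a m' assume "Inv0 a m'"
    then have "agree {cI, cBIN} m m'" by (simp add: Inv0_def)
    from agreeD[OF this] show "expr_ok g (Var cH) m' \<and> expr_val (Var cH) m' = int h"
      by (simp add: h)
  next
    fix a m' assume "a < h" "Inv0 a m'" "m' (adr cI 0) = int a"
    then show "runs g (Put cBIN (Var cI) (Const 0)) m' 30
      (\<lambda>m''. m'' (adr cI 0) = int a \<and> Inv0 (Suc a) (m''(adr cI 0 := int (Suc a))))"
      by (intro runs_loop_free) (auto simp: Inv0_def less_Suc_eq)
  qed simp_all
  fix m1 assume m1: "m1 (adr cI 0) = int h \<and> Inv0 h m1"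
  then have ag1: "agree {cI, cBIN} m m1" by (simp add: Inv0_def)
  have "prepared m1" by (rule prepared_agree[OF p ag1]) simp
  then have "prepared (m1(adr cI 0 := 0))" by (rule prepared_agree[of _ "{cI}"]) simp_all
  then have s2: "searching h 0 (\<lambda>_. {}) (m1(adr cI 0 := 0))"
    using m1 by (simp add: searching_def config_empty Inv0_def agreeD[OF ag1] h)
  have ag2: "agree ?X m (m1(adr cI 0 := 0))"
  proof -
    have "agree ?X m m1" by (rule agree_trans[OF agree_refl[of "{}"] ag1]) simp_all
    then show ?thesis by simp
  qed
  define F where "F = 74 * (\<Sum>j\<in>S. v j)"
  have v0: "0 \<le> v j" if "j \<in> S" for j using v_pos[of j] S_n that by auto
  have "(\<Sum>j\<in>S. v j) \<le> (\<Sum>j\<in>S. 40 * int n)" using v_le S_n by (intro sum_mono) auto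
  also have "\<dots> = int (card S) * (40 * int n)" by simp
  also have "\<dots> \<le> int n * (40 * int n)" using card_S by (intro mult_right_mono) auto
  finally have Fn: "F \<le> 2960 * int n * int n" by (simp add: F_def)
  have F: "potential v S A h \<le> F" for A
    unfolding F_def by (rule potential_bounds(2)) (rule v0)
  \<comment> \<open>A lexicographic rank: an improvement raises the integral potential by at least
    1, worth \<open>Suc h\<close>, which outweighs the reset of \<open>i\<close> to 0; otherwise
    \<open>i\<close> advances and \<open>h - i\<close> drops.\<close>
  define rank where "rank = (\<lambda>A i. nat (F - potential v S A h) * Suc h + (h - i))"
  define Inv where "Inv = (\<lambda>r m'. agree ?X m m' \<and> (\<exists>A i. r = rank A i \<and> searching h i A m' \<and> i \<le> h \<and>
    (\<forall>i'<i. \<forall>C. config i' C \<longrightarrow> (\<Sum>l\<in>C. gain v A h i' l) \<le> (\<Sum>l\<in>A i'. gain v A h i' l))))"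
  show "runs g (Set cI (Const 0);; While (Var cI \<prec> Var cH) respond_com) m1
    (40 + Suc (2960 * n * n * Suc n + n) * (30 + respond_bound n))
    (\<lambda>m'. agree ?X m m' \<and> (\<exists>A. searching h h A m' \<and> locally_optimal h A))"
  proof (rule runs_Seq)
    show "runs g (Set cI (Const 0)) m1 7 (\<lambda>m2. m2 = m1(adr cI 0 := 0))"
      by (rule runs_loop_free) simp_all
    fix m2 assume m2: "m2 = m1(adr cI 0 := 0)"
    have inv: "Inv (rank (\<lambda>_. {}) 0) m2"
      using s2 ag2 unfolding Inv_def m2 by blast
    have "nat (F - potential v S (\<lambda>_. {}) h) \<le> 2960 * n * n"
      using Fn potential_bounds(1)[of S v "\<lambda>_. {}" h] v0 by (simp add: nat_le_iff)
    then have "rank (\<lambda>_. {}) 0 \<le> 2960 * n * n * Suc n + n"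
      unfolding rank_def using h(2) by (intro add_mono mult_le_mono) auto
    then have rk: "Suc (rank (\<lambda>_. {}) 0) * (30 + respond_bound n) \<le>
        Suc (2960 * n * n * Suc n + n) * (30 + respond_bound n)"
      by (intro mult_le_mono1) simp
    have "runs g (While (Var cI \<prec> Var cH) respond_com) m2
      (Suc (2960 * n * n * Suc n + n) * (30 + respond_bound n))
      (\<lambda>m'. expr_val (Var cI \<prec> Var cH) m' = 0 \<and> (\<exists>r. Inv r m'))"
    proof (rule runs_While[where Inv = Inv and k = "respond_bound n"])
      show "Inv (rank (\<lambda>_. {}) 0) m2" by (rule inv)
      show "Suc (rank (\<lambda>_. {}) 0) * (2 + esize (Var cI \<prec> Var cH) + respond_bound n)
        \<le> Suc (2960 * n * n * Suc n + n) * (30 + respond_bound n)"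
        by (rule order_trans[OF mult_le_mono2 rk]) simp
    next
      fix r m' assume "Inv r m'" "expr_val (Var cI \<prec> Var cH) m' \<noteq> 0"
      then obtain A i where ag: "agree ?X m m'" and r: "r = rank A i" and s: "searching h i A m'"
        and i: "i < h"
        and opt: "\<forall>i'<i. \<forall>C. config i' C \<longrightarrow> (\<Sum>l\<in>C. gain v A h i' l) \<le> (\<Sum>l\<in>A i'. gain v A h i' l)"
        by (auto simp: Inv_def searching_def split: if_splits)
      show "runs g respond_com m' (respond_bound n) (\<lambda>m''. \<exists>r'<r. Inv r' m'')"
      proof (rule runs_mono[OF respond_run[OF s i h(2)]])
        fix m'' assume "agree ?X m' m'' \<and>
          ((\<exists>C. config i C \<and> (\<Sum>l\<in>A i. gain v A h i l) < (\<Sum>l\<in>C. gain v A h i l) \<and>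
              searching h 0 (A(i := C)) m'') \<or>
           (\<forall>C. config i C \<longrightarrow> (\<Sum>l\<in>C. gain v A h i l) \<le> (\<Sum>l\<in>A i. gain v A h i l)) \<and>
              searching h (Suc i) A m'')"
        then have ag': "agree ?X m m''"
          and "(\<exists>C. config i C \<and> (\<Sum>l\<in>A i. gain v A h i l) < (\<Sum>l\<in>C. gain v A h i l) \<and>
              searching h 0 (A(i := C)) m'') \<or>
           (\<forall>C. config i C \<longrightarrow> (\<Sum>l\<in>C. gain v A h i l) \<le> (\<Sum>l\<in>A i. gain v A h i l)) \<and>
              searching h (Suc i) A m''"
          using agree_trans[OF ag] by auto
        then show "\<exists>r'<r. Inv r' m''"
        proof (elim disjE exE conjE)
          fix C assume C: "config i C" "(\<Sum>l\<in>A i. gain v A h i l) < (\<Sum>l\<in>C. gain v A h i l)"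
            "searching h 0 (A(i := C)) m''"
          have "config i (A i)" using s i by (simp add: searching_def)
          then have "potential v S (A(i := C)) h =
            potential v S A h + (\<Sum>j\<in>C. gain v A h i j) - (\<Sum>j\<in>A i. gain v A h i j)"
            by (intro potential_upd finite_S config_S[of i] C(1) i)
          then have "nat (F - potential v S (A(i := C)) h) + 1 \<le> nat (F - potential v S A h)"
            using C(2) F[of "A(i := C)"] by linarith
          then have "(nat (F - potential v S (A(i := C)) h) + 1) * Suc h \<le> nat (F - potential v S A h) * Suc h"
            by (intro mult_le_mono1)
          then have "rank (A(i := C)) 0 < rank A i" using i unfolding rank_def by simp
          moreover have "Inv (rank (A(i := C)) 0) m''" using C(3) ag' unfolding Inv_def by blast
          ultimately show ?thesis using r by blast
        next
          assume o: "\<forall>C. config i C \<longrightarrow> (\<Sum>l\<in>C. gain v A h i l) \<le> (\<Sum>l\<in>A i. gain v A h i l)"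
            and s': "searching h (Suc i) A m''"
          have "Inv (rank A (Suc i)) m''"
            unfolding Inv_def using s' ag' i opt o by (intro conjI exI[of _ A] exI[of _ "Suc i"]) (auto simp: less_Suc_eq)
          moreover have "rank A (Suc i) < rank A i" using i by (simp add: rank_def)
          ultimately show ?thesis using r by blast
        qed
      qed simp
    qed simp_all
    then show "runs g (While (Var cI \<prec> Var cH) respond_com) m2
      (Suc (2960 * n * n * Suc n + n) * (30 + respond_bound n))
      (\<lambda>m'. agree ?X m m' \<and> (\<exists>A. searching h h A m' \<and> locally_optimal h A))"
    proof (rule runs_mono)
      fix m' assume "expr_val (Var cI \<prec> Var cH) m' = 0 \<and> (\<exists>r. Inv r m')"
      then have "expr_val (Var cI \<prec> Var cH) m' = 0" and "\<exists>A i. agree ?X m m' \<and> searching h i A m' \<and> i \<le> h \<and>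
          (\<forall>i'<i. \<forall>C. config i' C \<longrightarrow> (\<Sum>l\<in>C. gain v A h i' l) \<le> (\<Sum>l\<in>A i'. gain v A h i' l))"
        unfolding Inv_def by blast+
      then obtain A i where ag: "agree ?X m m'" and s: "searching h i A m'" and "i \<le> h"
        and stop: "expr_val (Var cI \<prec> Var cH) m' = 0"
        and opt: "\<forall>i'<i. \<forall>C. config i' C \<longrightarrow> (\<Sum>l\<in>C. gain v A h i' l) \<le> (\<Sum>l\<in>A i'. gain v A h i' l)"
        by blast
      have "i = h" using stop s \<open>i \<le> h\<close> by (simp add: searching_def split: if_splits)
      then show "agree ?X m m' \<and> (\<exists>A. searching h h A m' \<and> locally_optimal h A)"
        using ag s opt unfolding locally_optimal_def by blast
    qed simp
  qed simp
next
  show "1 + Suc h * 100 + (40 + Suc (2960 * n * n * Suc n + n) * (30 + respond_bound n)) \<le> search_bound n"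
    using h(2) unfolding search_bound_def by simp
qed

section \<open>First fit and the labels of the items\<close>

lemma first_fit_insert:
  assumes ff: "first_fit R lb k" and R: "finite R" "j \<notin> R" and b: "b \<le> k"
    and before: "\<And>b'. b' < b \<Longrightarrow> D < (\<Sum>i | i \<in> R \<and> lb i = b'. w i) + w j"
    and fits: "(\<Sum>i | i \<in> R \<and> lb i = b. w i) + w j \<le> D" and wj: "0 \<le> w j"
  shows "first_fit (insert j R) (lb(j := b)) (if b = k then Suc k else k)"
    and "(\<Sum>i | i \<in> insert j R \<and> (lb(j := b)) i = c. w i) =
      (\<Sum>i | i \<in> R \<and> lb i = c. w i) + (if c = b then w j else 0)"
proof -
  show sum: "(\<Sum>i | i \<in> insert j R \<and> (lb(j := b)) i = c. w i) =
      (\<Sum>i | i \<in> R \<and> lb i = c. w i) + (if c = b then w j else 0)" for c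
  proof -
    have "{i. i \<in> insert j R \<and> (lb(j := b)) i = c} = (if c = b then {j} else {}) \<union> {i. i \<in> R \<and> lb i = c}"
      using R(2) by auto
    then show ?thesis using R by simp
  qed
  \<comment> \<open>Loads only grow, so that a bin too full for an earlier item remains too full for
    it.\<close>
  have le: "(\<Sum>i | i \<in> R \<and> lb i = c. w i) \<le> (\<Sum>i | i \<in> insert j R \<and> (lb(j := b)) i = c. w i)" for c
    unfolding sum using wj by simp
  show "first_fit (insert j R) (lb(j := b)) (if b = k then Suc k else k)"
    unfolding first_fit_def
  proof (intro conjI ballI allI impI)
    fix i assume "i \<in> insert j R"
    then show "(lb(j := b)) i < (if b = k then Suc k else k)"
      using ff b by (auto simp: first_fit_def less_Suc_eq)
  next
    fix c assume c: "c < (if b = k then Suc k else k)"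
    show "\<exists>i\<in>insert j R. (lb(j := b)) i = c"
    proof (cases "c = b")
      case True
      then show ?thesis by auto
    next
      case False
      then have "c < k" using c by (auto split: if_splits)
      then obtain i where "i \<in> R" "lb i = c" using ff by (auto simp: first_fit_def)
      then show ?thesis using R(2) by (intro bexI[of _ i]) auto
    qed
  next
    fix i c assume i: "i \<in> insert j R" "c < (lb(j := b)) i"
    show "D < (\<Sum>i | i \<in> insert j R \<and> (lb(j := b)) i = c. w i) + w i"
    proof (cases "i = j")
      case True
      then show ?thesis using before[of c] le[of c] i(2) by simp
    next
      case False
      then have "D < (\<Sum>i | i \<in> R \<and> lb i = c. w i) + w i" using i ff by (auto simp: first_fit_def)
      then show ?thesis using le[of c] by linarith
    qed
  next
    fix c
    show "(\<Sum>i | i \<in> insert j R \<and> (lb(j := b)) i = c. w i) \<le> D"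
      unfolding sum using fits ff by (auto simp: first_fit_def)
  qed
qed

definition hit :: "(nat \<Rightarrow> nat set) \<Rightarrow> nat \<Rightarrow> nat \<Rightarrow> bool" where
  "hit A a j \<longleftrightarrow> a < length ks \<and> ks ! a = j \<or> j \<in> A a"

lemma find_run:
  assumes s: "searching h i A m" and j: "j < n" "m (adr cJ 0) = int j" and pw: "m (adr cPW 0) = 2 ^ j"
  shows "runs g find_com m (50 + Suc h * 300) (\<lambda>m'. agree {cA, cLAB} m m' \<and>
    (\<forall>l. l \<noteq> j \<longrightarrow> m' (adr cLAB (int l)) = m (adr cLAB (int l))) \<and>
    (m' (adr cLAB (int j)) = - 1 \<and> (\<forall>a<h. \<not> hit A a j) \<or>
     (\<exists>a<h. m' (adr cLAB (int j)) = int a \<and> hit A a j)))" (is "runs _ _ _ _ ?Q")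
  unfolding find_com_def
proof (rule runs_Seq)
  show "runs g (Put cLAB (Var cJ) (Const (- 1))) m 30 (\<lambda>m1. m1 = m(adr cLAB (int j) := - 1))"
    by (rule runs_loop_free) (simp_all add: j)
  fix m1 assume m1: "m1 = m(adr cLAB (int j) := - 1)"
  define Inv where "Inv = (\<lambda>c m'. agree {cA, cLAB} m m' \<and>
    (\<forall>l. l \<noteq> j \<longrightarrow> m' (adr cLAB (int l)) = m (adr cLAB (int l))) \<and>
    (m' (adr cLAB (int j)) = - 1 \<and> (\<forall>a<c. \<not> hit A a j) \<or>
     (\<exists>a<c. m' (adr cLAB (int j)) = int a \<and> hit A a j)))"
  let ?c = "Cond ((Var cA \<prec> Var cC) \<otimes> (Arr cKIT (Var cA) \<doteq> Var cJ)) (Put cLAB (Var cJ) (Var cA))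
         (Cond (bit_expr (Arr cBIN (Var cA))) (Put cLAB (Var cJ) (Var cA)) Skip)"
  have "runs g (For cA (Var cH) ?c) m1 (Suc h * 300) (\<lambda>m'. m' (adr cA 0) = int h \<and> Inv h m')"
  proof (rule runs_For)
    show "Inv 0 (m1(adr cA 0 := 0))" by (simp add: Inv_def m1)
  next
    fix a m' assume "Inv a m'"
    then have ag: "agree {cA, cLAB} m m'" by (simp add: Inv_def)
    show "expr_ok g (Var cH) m' \<and> expr_val (Var cH) m' = int h"
      using s by (simp add: agreeD[OF ag] searching_def)
  next
    fix a m' assume a: "a < h" "Inv a m'" "m' (adr cA 0) = int a"
    then have ag: "agree {cA, cLAB} m m'" by (simp add: Inv_def)
    have f: "m' (adr cC 0) = int (length ks)" "a < length ks \<Longrightarrow> m' (adr cKIT (int a)) = int (ks ! a)"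
      "m' (adr cBIN (int a)) = code (A a)" "finite (A a)" "m' (adr cJ 0) = int j" "m' (adr cPW 0) = 2 ^ j"
      using s a(1) j pw config_finite by (auto simp: searching_def prepared_def agreeD[OF ag])
    have post: "post ?c m' = (if hit A a j then m'(adr cLAB (int j) := int a) else m')"
      by (cases "a < length ks") (auto simp: f a(3) code_bit hit_def)
    show "runs g ?c m' 200 (\<lambda>m''. m'' (adr cA 0) = int a \<and> Inv (Suc a) (m''(adr cA 0 := int (Suc a))))"
    proof (rule runs_loop_free)
      show "post ?c m' (adr cA 0) = int a \<and> Inv (Suc a) ((post ?c m')(adr cA 0 := int (Suc a)))"
        unfolding post using a ag by (auto simp: Inv_def less_Suc_eq)
    qed (simp_all add: f a(3))
  qed simp_all
  then show "runs g (For cA (Var cH) ?c) m1 (Suc h * 300) ?Q"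
    by (rule runs_mono) (simp_all add: Inv_def)
qed simp

text \<open>The loop looking for a bin needs no test for the end: bin \<open>k\<close> is still
  empty and every single item fits into it. With \<open>k < n\<close> this bin is among the cells of
  \<open>cFILL\<close> that have been cleared.\<close>

lemma place_run:
  assumes s: "searching h i A m" and j: "j < n" "m (adr cJ 0) = int j"
    and R: "finite R" "j \<notin> R" and k: "m (adr cK 0) = int k" "k < n"
    and fill: "\<And>b. b \<le> n \<Longrightarrow> m (adr cFILL (int b)) = (\<Sum>i | i \<in> R \<and> lb i = b. w i)"
    and ff: "first_fit R lb k"
  shows "runs g place_com m (400 + Suc n * 100) (\<lambda>m'. agree {cA, cFILL, cLAB, cK} m m' \<and>
    (\<forall>l. l \<noteq> j \<longrightarrow> m' (adr cLAB (int l)) = m (adr cLAB (int l))) \<and>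
    (\<exists>b k'. m' (adr cLAB (int j)) = int (h + b) \<and> m' (adr cK 0) = int k' \<and> k' \<le> Suc k \<and>
       (\<forall>c\<le>n. m' (adr cFILL (int c)) = (\<Sum>i | i \<in> insert j R \<and> (lb(j := b)) i = c. w i)) \<and>
       first_fit (insert j R) (lb(j := b)) k'))" (is "runs _ _ _ _ ?Q")
  unfolding place_com_def
proof (rule runs_Seq)
  define fl where "fl = (\<lambda>b. \<Sum>i | i \<in> R \<and> lb i = b. w i)"
  have fl0: "fl k = 0"
  proof -
    have empty: "{i. i \<in> R \<and> lb i = k} = {}" using ff by (auto simp: first_fit_def)
    show ?thesis unfolding fl_def empty by simp
  qed
  have f: "m (adr cD 0) = D" "m (adr cSZ (int j)) = w j" "m (adr cH 0) = int h"
    using s j(1) by (simp_all add: searching_def prepared_def)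
  have flm: "m (adr cFILL (int b)) = fl b" if "b \<le> n" for b using fill[OF that] by (simp add: fl_def)
  show "runs g (Set cA (Const 0)) m 7 (\<lambda>m1. m1 = m(adr cA 0 := 0))"
    by (rule runs_loop_free) simp_all
  fix m1 assume m1: "m1 = m(adr cA 0 := 0)"
  define Inv where "Inv = (\<lambda>r m'. \<exists>a\<le>k. r = k - a \<and> m' = m(adr cA 0 := int a) \<and> (\<forall>b<a. D < fl b + w j))"
  let ?e = "Var cD \<prec> Arr cFILL (Var cA) \<oplus> Arr cSZ (Var cJ)"
  let ?t = "Put cFILL (Var cA) (Arr cFILL (Var cA) \<oplus> Arr cSZ (Var cJ));;
     Put cLAB (Var cJ) (Var cH \<oplus> Var cA);;
     Cond (Var cA \<doteq> Var cK) (Set cK (Var cK \<oplus> Const 1)) Skip"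
  show "runs g (While ?e (Set cA (Var cA \<oplus> Const 1));; ?t) m1 (350 + Suc n * 100) ?Q"
  proof (rule runs_Seq)
    show "runs g (While ?e (Set cA (Var cA \<oplus> Const 1))) m1 (Suc n * 100)
      (\<lambda>m'. expr_val ?e m' = 0 \<and> (\<exists>r. Inv r m'))"
    proof (rule runs_While[where k = 30 and i = k])
      show "Inv k m1" unfolding Inv_def m1 by (intro exI[of _ 0]) simp
    next
      fix r m' assume "Inv r m'" "expr_val ?e m' \<noteq> 0"
      then obtain a where a: "a \<le> k" "r = k - a" "m' = m(adr cA 0 := int a)" "\<forall>b<a. D < fl b + w j"
        and "D < fl a + w j"
        using k(2) by (auto simp: Inv_def f flm j split: if_splits)
      then have "a \<noteq> k" using fl0 w_le_D[OF j(1)] by auto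
      have inv: "Inv (k - Suc a) (m(adr cA 0 := int (Suc a)))"
        unfolding Inv_def using a \<open>a \<noteq> k\<close> \<open>D < fl a + w j\<close>
        by (intro exI[of _ "Suc a"]) (auto simp: less_Suc_eq)
      show "runs g (Set cA (Var cA \<oplus> Const 1)) m' 30 (\<lambda>m''. \<exists>r'<r. Inv r' m'')"
      proof (rule runs_loop_free)
        have "post (Set cA (Var cA \<oplus> Const 1)) m' = m(adr cA 0 := int (Suc a))"
          using a(3) by (simp add: add.commute)
        then show "\<exists>r'<r. Inv r' (post (Set cA (Var cA \<oplus> Const 1)) m')"
          using inv a(1,2) \<open>a \<noteq> k\<close> by (intro exI[of _ "k - Suc a"]) simp
      qed simp_all
    qed (use k(2) in simp_all)
    fix m2 assume "expr_val ?e m2 = 0 \<and> (\<exists>r. Inv r m2)"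
    then obtain a where a: "a \<le> k" "m2 = m(adr cA 0 := int a)" "\<forall>b<a. D < fl b + w j"
      and fits: "fl a + w j \<le> D"
      using k(2) by (auto simp: Inv_def f flm j split: if_splits)
    define k' where "k' = (if a = k then Suc k else k)"
    have an: "a \<le> n" using a(1) k(2) by simp
    have new: "first_fit (insert j R) (lb(j := a)) k'"
      "(\<Sum>i | i \<in> insert j R \<and> (lb(j := a)) i = c. w i) = fl c + (if c = a then w j else 0)" for c
      using first_fit_insert[OF ff R a(1)] a(3) fits w_nonneg[OF j(1)]
      unfolding fl_def k'_def by auto
    show "runs g ?t m2 300 ?Q"
    proof (rule runs_loop_free)
      have post: "post ?t m2 = m(adr cA 0 := int a, adr cFILL (int a) := fl a + w j,
          adr cLAB (int j) := int (h + a), adr cK 0 := int k')"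
        using an by (cases "a = k") (auto simp: a(2) j f k flm k'_def fun_upd_def add.commute)
      have fill': "post ?t m2 (adr cFILL (int c)) = (\<Sum>i | i \<in> insert j R \<and> (lb(j := a)) i = c. w i)"
        if "c \<le> n" for c
        unfolding post new(2) using that by (simp add: flm)
      have "\<exists>b k'. post ?t m2 (adr cLAB (int j)) = int (h + b) \<and> post ?t m2 (adr cK 0) = int k' \<and> k' \<le> Suc k \<and>
       (\<forall>c\<le>n. post ?t m2 (adr cFILL (int c)) = (\<Sum>i | i \<in> insert j R \<and> (lb(j := b)) i = c. w i)) \<and>
       first_fit (insert j R) (lb(j := b)) k'"
        by (rule exI[of _ a], rule exI[of _ k'], intro conjI allI impI fill' new(1))
          (use a(1) in \<open>simp_all only: post, simp_all add: k'_def\<close>)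
      then show "?Q (post ?t m2)" unfolding post by simp
    qed (simp_all add: a(2) j)
  qed simp
qed simp

end


definition assign_bound :: "nat \<Rightarrow> nat" where
  "assign_bound n = 300 + Suc (Suc n) * 100 + Suc n * ((50 + Suc n * 300) + (400 + Suc n * 100) + 300)"

definition main_bound :: "nat \<Rightarrow> nat" where
  "main_bound n = 100 + Suc (Suc n) * (search_bound n + assign_bound n + 300)"

context ram_split
begin

lemma uncovered_iff_hit:
  assumes "searching h i A m" "length ks \<le> h" "j < n"
  shows "j \<in> uncovered h A \<longleftrightarrow> (\<forall>a<h. \<not> hit A a j)"
proof
  assume "j \<in> uncovered h A"
  then show "\<forall>a<h. \<not> hit A a j" by (auto simp: uncovered_def S_def hit_def)
next
  assume *: "\<forall>a<h. \<not> hit A a j"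
  have "j \<notin> set ks"
  proof
    assume "j \<in> set ks"
    then obtain a where "a < length ks" "ks ! a = j" by (auto simp: in_set_conv_nth)
    then show False using * assms(2) by (auto simp: hit_def)
  qed
  then show "j \<in> uncovered h A" using * assms(3) by (auto simp: uncovered_def S_def hit_def)
qed

lemma assign_run:
  assumes s: "searching h i A m" and h: "length ks \<le> h" "h \<le> n"
  shows "runs g assign_com m (assign_bound n) (\<lambda>m'. agree {cA, cJ, cK, cPW, cLAB, cFILL} m m' \<and>
    (\<exists>lb k. m' (adr cK 0) = int k \<and> first_fit (uncovered h A) lb k \<and>
      (\<forall>l<n. (l \<in> uncovered h A \<longrightarrow> m' (adr cLAB (int l)) = int (h + lb l)) \<and>
        (l \<notin> uncovered h A \<longrightarrow> (\<exists>a<h. m' (adr cLAB (int l)) = int a \<and> hit A a l)))))" (is "runs _ _ _ _ ?Q")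
  unfolding assign_com_def
proof (rule runs_Seq)
  define U where "U = uncovered h A"
  define X where "X = {cA, cJ, cK, cPW, cLAB, cFILL}"
  have tr: "searching h i A m'" if "agree X m m'" for m'
    by (rule searching_agree[OF s that]) (simp add: X_def)
  have nN: "m' (adr cN 0) = int n" if "agree X m m'" for m'
    using tr[OF that] by (simp add: searching_def prepared_def)
  show "runs g (Set cK (Const 0)) m 7 (\<lambda>m1. m1 = m(adr cK 0 := 0))"
    by (rule runs_loop_free) simp_all
  fix m1 assume m1: "m1 = m(adr cK 0 := 0)"
  define Inv0 where "Inv0 = (\<lambda>c m'. agree X m m' \<and> m' (adr cK 0) = 0 \<and> (\<forall>b<c. m' (adr cFILL (int b)) = 0))"
  let ?body = "find_com;; Cond (Arr cLAB (Var cJ) \<prec> Const 0) place_com Skip;; Set cPW (Var cPW \<oplus> Var cPW)"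
  let ?k = "Suc n * ((50 + Suc n * 300) + (400 + Suc n * 100) + 300)"
  show "runs g (For cJ (Var cN \<oplus> Const 1) (Put cFILL (Var cJ) (Const 0));; Set cPW (Const 1);;
    For cJ (Var cN) ?body) m1 (Suc (Suc n) * 100 + ?k + 100) ?Q"
  proof (rule runs_Seq)
    show "runs g (For cJ (Var cN \<oplus> Const 1) (Put cFILL (Var cJ) (Const 0))) m1 (Suc (Suc n) * 100)
      (\<lambda>m'. m' (adr cJ 0) = int (Suc n) \<and> Inv0 (Suc n) m')"
    proof (rule runs_For)
      show "Inv0 0 (m1(adr cJ 0 := 0))" by (simp add: Inv0_def m1 X_def)
    next
      fix j m' assume "Inv0 j m'"
      then show "expr_ok g (Var cN \<oplus> Const 1) m' \<and> expr_val (Var cN \<oplus> Const 1) m' = int (Suc n)"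
        using nN by (simp add: Inv0_def)
    next
      fix j m' assume "j < Suc n" "Inv0 j m'" "m' (adr cJ 0) = int j"
      then show "runs g (Put cFILL (Var cJ) (Const 0)) m' 30
        (\<lambda>m''. m'' (adr cJ 0) = int j \<and> Inv0 (Suc j) (m''(adr cJ 0 := int (Suc j))))"
        by (intro runs_loop_free) (auto simp: Inv0_def less_Suc_eq X_def)
    qed simp_all
    fix m2 assume m2: "m2 (adr cJ 0) = int (Suc n) \<and> Inv0 (Suc n) m2"
    show "runs g (Set cPW (Const 1);; For cJ (Var cN) ?body) m2 (?k + 50) ?Q"
    proof (rule runs_Seq)
      show "runs g (Set cPW (Const 1)) m2 7 (\<lambda>m3. m3 = m2(adr cPW 0 := 1))"
        by (rule runs_loop_free) simp_all
      fix m3 assume m3: "m3 = m2(adr cPW 0 := 1)"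
      define spec where "spec = (\<lambda>lb m' l. (l \<in> U \<longrightarrow> m' (adr cLAB (int l)) = int (h + lb l)) \<and>
        (l \<notin> U \<longrightarrow> (\<exists>a<h. m' (adr cLAB (int l)) = int a \<and> hit A a l)))"
      \<comment> \<open>The conjunct \<open>k \<le> j\<close> says that each open bin has been paid
        for by an item; it keeps the next bin within the cleared part of
        \<open>cFILL\<close>.\<close>
      define Inv where "Inv = (\<lambda>j m'. agree X m m' \<and> m' (adr cPW 0) = 2 ^ j \<and>
        (\<exists>lb k. m' (adr cK 0) = int k \<and> k \<le> j \<and> first_fit (U \<inter> {..<j}) lb k \<and>
          (\<forall>b\<le>n. m' (adr cFILL (int b)) = (\<Sum>l | l \<in> U \<inter> {..<j} \<and> lb l = b. w l)) \<and>
          (\<forall>l<j. spec lb m' l)))"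
      have "runs g (For cJ (Var cN) ?body) m3 ?k (\<lambda>m'. m' (adr cJ 0) = int n \<and> Inv n m')"
      proof (rule runs_For)
        have "agree X m (m3(adr cJ 0 := 0))" using m2 by (simp add: m3 Inv0_def X_def)
        then show "Inv 0 (m3(adr cJ 0 := 0))"
          unfolding Inv_def using m2 D_pos
          by (intro conjI exI[of _ "\<lambda>_. 0"] exI[of _ 0]) (auto simp: m3 Inv0_def first_fit_def)
      next
        fix j m' assume "Inv j m'"
        then show "expr_ok g (Var cN) m' \<and> expr_val (Var cN) m' = int n"
          using nN by (simp add: Inv_def)
      next
        fix j m' assume j: "j < n" "Inv j m'" "m' (adr cJ 0) = int j"
        then obtain lb k where ag: "agree X m m'" and pw: "m' (adr cPW 0) = 2 ^ j"
          and k: "m' (adr cK 0) = int k" "k \<le> j" and ff: "first_fit (U \<inter> {..<j}) lb k"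
          and fill: "\<And>b. b \<le> n \<Longrightarrow> m' (adr cFILL (int b)) = (\<Sum>l | l \<in> U \<inter> {..<j} \<and> lb l = b. w l)"
          and sp: "\<And>l. l < j \<Longrightarrow> spec lb m' l"
          unfolding Inv_def by blast
        note s' = tr[OF ag]
        let ?P = "\<lambda>m''. m'' (adr cJ 0) = int j \<and> Inv (Suc j) (m''(adr cJ 0 := int (Suc j)))"
        let ?P2 = "\<lambda>m''. agree X m m'' \<and> m'' (adr cJ 0) = int j \<and> m'' (adr cPW 0) = 2 ^ j \<and>
          (\<exists>lb k. m'' (adr cK 0) = int k \<and> k \<le> Suc j \<and> first_fit (U \<inter> {..<Suc j}) lb k \<and>
          (\<forall>b\<le>n. m'' (adr cFILL (int b)) = (\<Sum>l | l \<in> U \<inter> {..<Suc j} \<and> lb l = b. w l)) \<and>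
          (\<forall>l<Suc j. spec lb m'' l))"
        show "runs g ?body m' ((50 + Suc n * 300) + (400 + Suc n * 100) + 200) ?P"
        proof (rule runs_Seq[OF find_run[OF s' j(1,3) pw]])
          fix m4 assume m4: "agree {cA, cLAB} m' m4 \<and>
            (\<forall>l. l \<noteq> j \<longrightarrow> m4 (adr cLAB (int l)) = m' (adr cLAB (int l))) \<and>
            (m4 (adr cLAB (int j)) = - 1 \<and> (\<forall>a<h. \<not> hit A a j) \<or>
             (\<exists>a<h. m4 (adr cLAB (int j)) = int a \<and> hit A a j))"
          then have ag4: "agree {cA, cLAB} m' m4"
            and lab4: "\<And>l. l \<noteq> j \<Longrightarrow> m4 (adr cLAB (int l)) = m' (adr cLAB (int l))"
            and labj: "m4 (adr cLAB (int j)) = - 1 \<and> (\<forall>a<h. \<not> hit A a j) \<or>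
             (\<exists>a<h. m4 (adr cLAB (int j)) = int a \<and> hit A a j)" by auto
          have agX4: "agree X m m4" by (rule agree_ext[OF ag ag4]) (simp add: X_def)
          note s4 = tr[OF agX4]
          have j4: "m4 (adr cJ 0) = int j" by (simp add: agreeD[OF ag4] j)
          have sp4: "spec lb m4 l" if "l < j" for l using sp[OF that] lab4[of l] that by (simp add: spec_def)
          note U_iff = uncovered_iff_hit[OF s h(1) j(1), folded U_def]
          show "runs g (Cond (Arr cLAB (Var cJ) \<prec> Const 0) place_com Skip;; Set cPW (Var cPW \<oplus> Var cPW)) m4
            (400 + Suc n * 100 + 100) ?P"
          proof (rule runs_Seq)
            show "runs g (Cond (Arr cLAB (Var cJ) \<prec> Const 0) place_com Skip) m4
              (400 + Suc n * 100 + 50) ?P2"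
            proof (rule runs_Cond)
              assume "expr_val (Arr cLAB (Var cJ) \<prec> Const 0) m4 \<noteq> 0"
              then have "m4 (adr cLAB (int j)) < 0" by (simp add: j4 split: if_splits)
              then have jU: "j \<in> U" using labj U_iff by auto
              have eq: "U \<inter> {..<Suc j} = insert j (U \<inter> {..<j})" using jU by (auto simp: less_Suc_eq)
              have R: "finite (U \<inter> {..<j})" "j \<notin> U \<inter> {..<j}" by auto
              have k4: "m4 (adr cK 0) = int k" "k < n" using k j(1) by (simp_all add: agreeD[OF ag4])
              show "runs g place_com m4 (400 + Suc n * 100) ?P2"
              proof (rule runs_mono[OF place_run[OF s4 j(1) j4 R k4 _ ff]])
                show "m4 (adr cFILL (int b)) = (\<Sum>i | i \<in> U \<inter> {..<j} \<and> lb i = b. w i)" if "b \<le> n" for b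
                  using fill[OF that] by (simp add: agreeD[OF ag4])
              next
                fix m5 assume m5: "agree {cA, cFILL, cLAB, cK} m4 m5 \<and>
                  (\<forall>l. l \<noteq> j \<longrightarrow> m5 (adr cLAB (int l)) = m4 (adr cLAB (int l))) \<and>
                  (\<exists>b k'. m5 (adr cLAB (int j)) = int (h + b) \<and> m5 (adr cK 0) = int k' \<and> k' \<le> Suc k \<and>
                    (\<forall>c\<le>n. m5 (adr cFILL (int c)) =
                       (\<Sum>i | i \<in> insert j (U \<inter> {..<j}) \<and> (lb(j := b)) i = c. w i)) \<and>
                    first_fit (insert j (U \<inter> {..<j})) (lb(j := b)) k')"
                then obtain b k' where ag5: "agree {cA, cFILL, cLAB, cK} m4 m5"
                  and lab5: "\<And>l. l \<noteq> j \<Longrightarrow> m5 (adr cLAB (int l)) = m4 (adr cLAB (int l))"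
                  and b: "m5 (adr cLAB (int j)) = int (h + b)" "m5 (adr cK 0) = int k'" "k' \<le> Suc k"
                    "\<forall>c\<le>n. m5 (adr cFILL (int c)) =
                       (\<Sum>i | i \<in> insert j (U \<inter> {..<j}) \<and> (lb(j := b)) i = c. w i)"
                    "first_fit (insert j (U \<inter> {..<j})) (lb(j := b)) k'"
                  by blast
                have "agree X m m5" by (rule agree_ext[OF agX4 ag5]) (simp add: X_def)
                moreover have "m5 (adr cJ 0) = int j" "m5 (adr cPW 0) = 2 ^ j"
                  by (simp_all add: agreeD[OF ag5] agreeD[OF ag4] j pw)
                moreover have "spec (lb(j := b)) m5 l" if "l < Suc j" for l
                proof (cases "l = j")
                  case True
                  then show ?thesis using b(1) jU by (simp add: spec_def)
                next
                  case False
                  then show ?thesis using sp4[of l] that lab5[of l] by (simp add: spec_def)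
                qed
                ultimately show "?P2 m5" unfolding eq using b k(2)
                  by (intro conjI exI[of _ "lb(j := b)"] exI[of _ k']) auto
              qed simp
            next
              assume "expr_val (Arr cLAB (Var cJ) \<prec> Const 0) m4 = 0"
              then have "\<not> m4 (adr cLAB (int j)) < 0" by (simp add: j4 split: if_splits)
              then obtain a where a: "a < h" "m4 (adr cLAB (int j)) = int a" "hit A a j" using labj by auto
              then have jU: "j \<notin> U" using U_iff by auto
              have eq: "U \<inter> {..<Suc j} = U \<inter> {..<j}" using jU by (auto simp: less_Suc_eq)
              have "spec lb m4 l" if "l < Suc j" for l
              proof (cases "l = j")
                case True
                then show ?thesis using a jU by (auto simp: spec_def)
              next
                case False
                then show ?thesis using sp4[of l] that by simp
              qed
              then have P2: "?P2 m4" unfolding eq using k ff fill agX4 pw j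
                by (intro conjI exI[of _ lb] exI[of _ k]) (auto simp: agreeD[OF ag4])
              show "runs g Skip m4 (400 + Suc n * 100) ?P2"
                by (rule runs_Skip[where Q = ?P2, OF P2]) simp
            qed simp_all
            fix m5 assume m5: "?P2 m5"
            then have agX: "agree X m (m5(adr cPW 0 := a, adr cJ 0 := c))" for a c by (simp add: X_def)
            show "runs g (Set cPW (Var cPW \<oplus> Var cPW)) m5 30 ?P"
            proof (rule runs_loop_free)
              have "post (Set cPW (Var cPW \<oplus> Var cPW)) m5 = m5(adr cPW 0 := 2 ^ Suc j)"
                using m5 by simp
              moreover have "Inv (Suc j) (m5(adr cPW 0 := 2 ^ Suc j, adr cJ 0 := int (Suc j)))"
                unfolding Inv_def using m5 agX by (simp add: spec_def)
              ultimately show "?P (post (Set cPW (Var cPW \<oplus> Var cPW)) m5)" using m5 by simp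
            qed simp_all
          qed simp
        qed (use h(2) in simp)
      qed (simp_all add: algebra_simps)
      then show "runs g (For cJ (Var cN) ?body) m3 ?k ?Q"
      proof (rule runs_mono)
        fix m' assume inv: "m' (adr cJ 0) = int n \<and> Inv n m'"
        have "U \<inter> {..<n} = U" using S_n by (auto simp: U_def uncovered_def)
        then show "?Q m'" using inv unfolding Inv_def spec_def X_def U_def by auto
      qed simp
    qed simp
  qed simp
qed (simp add: assign_bound_def)

section \<open>The search for the number of bins\<close>

definition solved :: "nat \<Rightarrow> memory \<Rightarrow> bool" where
  "solved h m \<longleftrightarrow> (\<exists>k lab. valid_labels (h + k) lab \<and> 34 * k \<le> 25 * h \<and>
     (\<forall>j<n. m (adr cLAB (int j)) = int (lab j)))"

text \<open>The optimum occurs in the analysis only. If the test rejects \<open>h\<close>, then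
  \<open>first_fit_count\<close> rules out \<open>h = opt\<close>, so the next value is still at
  most \<open>opt\<close>. If the test accepts, the labels are valid no matter whether
  \<open>h\<close> bins would suffice for a packing.\<close>

lemma iteration_run:
  assumes p: "prepared m" and h: "m (adr cH 0) = int h" "length ks \<le> h" "h \<le> n"
    and hmax: "h \<le> opt" "valid_labels opt labo" and go: "m (adr cGO 0) = 1"
  shows "runs g (search_com;; assign_com;;
        Cond (Const 25 \<otimes> Var cH \<prec> Const 34 \<otimes> Var cK) (Set cH (Var cH \<oplus> Const 1)) (Set cGO (Const 0)))
    m (search_bound n + assign_bound n + 200) (\<lambda>m'. prepared m' \<and>
      (m' (adr cGO 0) = 1 \<and> h < opt \<and> m' (adr cH 0) = int (Suc h) \<or>
       m' (adr cGO 0) = 0 \<and> solved h m'))" (is "runs _ _ _ _ ?Q")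
proof (rule runs_Seq[OF search_run[OF p h(1,3)]])
  let ?X = "{cJ, cA, cCNT, cGAIN, cCUR, cP, cPW, cQ, cTT, cMK, cU, cBEST, cI, cBIN}"
  let ?Y = "{cA, cJ, cK, cPW, cLAB, cFILL}"
  let ?t = "Cond (Const 25 \<otimes> Var cH \<prec> Const 34 \<otimes> Var cK) (Set cH (Var cH \<oplus> Const 1)) (Set cGO (Const 0))"
  fix m1 assume "agree ?X m m1 \<and> (\<exists>A. searching h h A m1 \<and> locally_optimal h A)"
  then obtain A where ag1: "agree ?X m m1" and s: "searching h h A m1" and lo: "locally_optimal h A" by blast
  have cfg: "\<And>i. i < h \<Longrightarrow> config i (A i)" using s by (simp add: searching_def)
  show "runs g (assign_com;; ?t) m1 (assign_bound n + 199) ?Q"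
  proof (rule runs_Seq[OF assign_run[OF s h(2,3)]])
    fix m2 assume "agree ?Y m1 m2 \<and> (\<exists>lb k. m2 (adr cK 0) = int k \<and> first_fit (uncovered h A) lb k \<and>
      (\<forall>l<n. (l \<in> uncovered h A \<longrightarrow> m2 (adr cLAB (int l)) = int (h + lb l)) \<and>
        (l \<notin> uncovered h A \<longrightarrow> (\<exists>a<h. m2 (adr cLAB (int l)) = int a \<and> hit A a l))))"
    then obtain lb k where ag2: "agree ?Y m1 m2" and k: "m2 (adr cK 0) = int k"
      and ff: "first_fit (uncovered h A) lb k"
      and lab_u: "\<And>l. l < n \<Longrightarrow> l \<in> uncovered h A \<Longrightarrow> m2 (adr cLAB (int l)) = int (h + lb l)"
      and lab_c: "\<And>l. l < n \<Longrightarrow> l \<notin> uncovered h A \<Longrightarrow> \<exists>a<h. m2 (adr cLAB (int l)) = int a \<and> hit A a l"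
      by blast
    define lab where "lab = (\<lambda>l. nat (m2 (adr cLAB (int l))))"
    have U: "uncovered h A \<subseteq> S" by (auto simp: uncovered_def)
    have lab_int: "m2 (adr cLAB (int l)) = int (lab l)" if "l < n" for l
      using lab_u[OF that] lab_c[OF that] unfolding lab_def by (cases "l \<in> uncovered h A") auto
    have valid: "valid_labels (h + k) lab"
    proof (rule first_fit_valid[OF cfg h(2) ff])
      fix i assume i: "i < length ks"
      have ksn: "ks ! i < n" by (rule ks_nth[OF i])
      have nS: "ks ! i \<notin> S" using i by (simp add: S_def)
      then obtain a where a: "a < h" "m2 (adr cLAB (int (ks ! i))) = int a" "hit A a (ks ! i)"
        using lab_c[OF ksn] U by blast
      moreover have "ks ! i \<notin> A a" using config_S[OF cfg[OF a(1)]] nS by blast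
      ultimately have "a < length ks" "ks ! a = ks ! i" by (auto simp: hit_def)
      then have "a = i" using ks(1) i by (simp add: nth_eq_iff_index_eq)
      then show "lab (ks ! i) = i" using a(2) by (simp add: lab_def)
    next
      fix j assume j: "j \<in> S" "j \<notin> uncovered h A"
      then have "j < n" using S_n by blast
      then obtain a where a: "a < h" "m2 (adr cLAB (int j)) = int a" "hit A a j"
        using lab_c j(2) by blast
      then have "j \<in> A a" using j(1) by (auto simp: hit_def S_def)
      then show "lab j < h \<and> j \<in> A (lab j)" using a by (simp add: lab_def)
    next
      fix j assume "j \<in> uncovered h A"
      moreover from this have "j < n" using U S_n by blast
      ultimately show "lab j = h + lb j" using lab_u[of j] by (simp add: lab_def)
    qed
    have p1: "prepared m1" using s by (simp add: searching_def)
    have p2: "prepared m2" by (rule prepared_agree[OF p1 ag2]) simp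
    have m2: "m2 (adr cH 0) = int h" "m2 (adr cGO 0) = 1"
      by (simp_all add: agreeD[OF ag2] agreeD[OF ag1] h go)
    show "runs g ?t m2 100 ?Q"
    proof (rule runs_loop_free)
      show "?Q (post ?t m2)"
      proof (cases "25 * h < 34 * k")
        case True
        have "h \<noteq> opt" using first_fit_count[OF hmax(2)] cfg lo ff True by fastforce
        then have "h < opt" using hmax(1) by simp
        moreover have "25 * int h < 34 * int k" using True by linarith
        then have "post ?t m2 = m2(adr cH 0 := int (Suc h))" by (simp add: m2 k add.commute)
        moreover have "prepared (m2(adr cH 0 := int (Suc h)))"
          by (rule prepared_agree[OF p2, of "{cH}"]) simp_all
        ultimately show ?thesis using m2 by simp
      next
        case False
        then have "\<not> 25 * int h < 34 * int k" by linarith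
        then have "post ?t m2 = m2(adr cGO 0 := 0)" by (simp add: m2 k)
        moreover have "prepared (m2(adr cGO 0 := 0))"
          by (rule prepared_agree[OF p2, of "{cGO}"]) simp_all
        moreover have "solved h (m2(adr cGO 0 := 0))"
          unfolding solved_def using valid False lab_int by (intro exI[of _ k] exI[of _ lab]) simp
        ultimately show ?thesis by simp
      qed
    qed simp_all
  qed simp
qed simp

lemma main_run:
  assumes p: "prepared m" and opt: "opt \<le> n" "valid_labels opt labo"
  shows "runs g main_com m (main_bound n) (\<lambda>m'. m' (adr cN 0) = int n \<and> (\<exists>h\<le>opt. solved h m'))" (is "runs _ _ _ _ ?Q")
  unfolding main_com_def
proof (rule runs_Seq)
  let ?body = "search_com;; assign_com;;
    Cond (Const 25 \<otimes> Var cH \<prec> Const 34 \<otimes> Var cK) (Set cH (Var cH \<oplus> Const 1)) (Set cGO (Const 0))"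
  \<comment> \<open>Starting with the size of the clique is safe: its items are pairwise in
    conflict, so \<open>opt\<close> cannot be smaller.\<close>
  have c: "length ks \<le> opt" using valid_labels_assignment[OF opt(2)] by blast
  have ms: "m (adr cC 0) = int (length ks)" using p by (simp add: prepared_def)
  show "runs g (Set cH (Var cC)) m 20 (\<lambda>m1. m1 = m(adr cH 0 := int (length ks)))"
    by (rule runs_loop_free) (simp_all add: ms)
  fix m1 assume m1: "m1 = m(adr cH 0 := int (length ks))"
  have p1: "prepared m1" unfolding m1 by (rule prepared_agree[OF p, of "{cH}"]) simp_all
  \<comment> \<open>The rank counts the values of \<open>h\<close> that are left up to
    \<open>opt\<close>, and rank 0 is reserved for the state after success.\<close>
  define Inv where "Inv = (\<lambda>r m'. prepared m' \<and> (\<exists>h. length ks \<le> h \<and> h \<le> opt \<and>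
    (m' (adr cGO 0) = 1 \<and> r = Suc (opt - h) \<and> m' (adr cH 0) = int h \<or>
     m' (adr cGO 0) = 0 \<and> r = 0 \<and> solved h m')))"
  show "runs g (Set cGO (Const 1);; While (Var cGO) ?body) m1
    (50 + Suc (Suc n) * (search_bound n + assign_bound n + 300)) ?Q"
  proof (rule runs_Seq)
    show "runs g (Set cGO (Const 1)) m1 7 (\<lambda>m2. m2 = m1(adr cGO 0 := 1))"
      by (rule runs_loop_free) simp_all
    fix m2 assume m2: "m2 = m1(adr cGO 0 := 1)"
    have p2: "prepared m2" unfolding m2 by (rule prepared_agree[OF p1, of "{cGO}"]) simp_all
    have inv: "Inv (Suc (opt - length ks)) m2"
      unfolding Inv_def using p2 c by (auto simp: m2 m1)
    have "runs g (While (Var cGO) ?body) m2 (Suc (Suc n) * (search_bound n + assign_bound n + 300))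
      (\<lambda>m'. expr_val (Var cGO) m' = 0 \<and> (\<exists>r. Inv r m'))"
    proof (rule runs_While[where Inv = Inv and k = "search_bound n + assign_bound n + 200"])
      show "Inv (Suc (opt - length ks)) m2" by (rule inv)
      show "Suc (Suc (opt - length ks)) * (2 + esize (Var cGO) + (search_bound n + assign_bound n + 200))
        \<le> Suc (Suc n) * (search_bound n + assign_bound n + 300)"
        using opt(1) by (intro mult_le_mono) auto
    next
      fix r m' assume "Inv r m'" "expr_val (Var cGO) m' \<noteq> 0"
      then obtain h where h: "prepared m'" "length ks \<le> h" "h \<le> opt" "m' (adr cGO 0) = 1"
        "r = Suc (opt - h)" "m' (adr cH 0) = int h"
        by (auto simp: Inv_def)
      have "h \<le> n" using h(3) opt(1) by simp
      show "runs g ?body m' (search_bound n + assign_bound n + 200) (\<lambda>m''. \<exists>r'<r. Inv r' m'')"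
      proof (rule runs_mono[OF iteration_run[OF h(1,6,2) \<open>h \<le> n\<close> h(3) opt(2) h(4)]])
        fix m'' assume "prepared m'' \<and>
          (m'' (adr cGO 0) = 1 \<and> h < opt \<and> m'' (adr cH 0) = int (Suc h) \<or>
           m'' (adr cGO 0) = 0 \<and> solved h m'')"
        then show "\<exists>r'<r. Inv r' m''"
        proof (elim conjE disjE)
          assume *: "prepared m''" "m'' (adr cGO 0) = 1" "h < opt" "m'' (adr cH 0) = int (Suc h)"
          then have "Inv (Suc (opt - Suc h)) m''"
            unfolding Inv_def using h(2) by (intro conjI exI[of _ "Suc h"]) auto
          then show ?thesis using *(3) h(5) by (intro exI[of _ "Suc (opt - Suc h)"]) auto
        next
          assume "prepared m''" "m'' (adr cGO 0) = 0" "solved h m''"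
          then have "Inv 0 m''" unfolding Inv_def using h(2,3) by auto
          then show ?thesis using h(5) by auto
        qed
      qed simp
    qed simp_all
    then show "runs g (While (Var cGO) ?body) m2
      (Suc (Suc n) * (search_bound n + assign_bound n + 300)) ?Q"
      by (rule runs_mono) (auto simp: Inv_def prepared_def)
  qed simp
qed (simp add: main_bound_def)

text \<open>The labels and the loop variables live in negative cells, so overwriting the input with
  the output disturbs neither.\<close>

lemma output_run:
  assumes nN: "m (adr cN 0) = int n"
  shows "runs g output_com m (Suc n * 100) (\<lambda>m'. \<forall>j<n. m' (int j) = m (adr cLAB (int j)))"
proof -
  define Inv where "Inv = (\<lambda>j m'. m' (adr cN 0) = int n \<and>
    (\<forall>l. m' (adr cLAB (int l)) = m (adr cLAB (int l))) \<and> (\<forall>l<j. m' (int l) = m (adr cLAB (int l))))"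
  have "runs g output_com m (Suc n * 100) (\<lambda>m'. m' (adr cJ 0) = int n \<and> Inv n m')"
    unfolding output_com_def
  proof (rule runs_For)
    show "Inv 0 (m(adr cJ 0 := 0))" by (simp add: Inv_def nN)
  next
    fix j m' assume "Inv j m'"
    then show "expr_ok g (Var cN) m' \<and> expr_val (Var cN) m' = int n" by (simp add: Inv_def)
  next
    fix j m' assume "j < n" "Inv j m'" "m' (adr cJ 0) = int j"
    then show "runs g (Store (Var cJ) (Arr cLAB (Var cJ))) m' 40
      (\<lambda>m''. m'' (adr cJ 0) = int j \<and> Inv (Suc j) (m''(adr cJ 0 := int (Suc j))))"
      by (intro runs_loop_free) (auto simp: Inv_def less_Suc_eq)
  qed simp_all
  then show ?thesis by (rule runs_mono) (auto simp: Inv_def)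
qed

end


section \<open>Preprocessing: integer sizes, profits and the split partition\<close>

definition scale_bound :: "nat \<Rightarrow> nat" where
  "scale_bound n = 100 + Suc n * 200 + Suc n * 300"

definition split_bound :: "nat \<Rightarrow> nat" where
  "split_bound n = Suc n * (Suc n * (Suc n * 400 + 100) + 400)"

definition total_bound :: "nat \<Rightarrow> nat" where
  "total_bound n = 10 + scale_bound n + split_bound n + main_bound n + Suc n * 100"

context ram_data
begin

text \<open>The capacity \<open>D\<close> becomes a long number, but each multiplication has an
  input word, \<open>n\<close> or a constant as one factor, which is what keeps the growth of bit
  lengths linear.\<close>

lemma scale_run:
  assumes io: "input_ok m" and m0: "m 0 = int n"
  shows "runs g scale_com m (scale_bound n) (\<lambda>m'. agree {cN, cD, cC, cJ, cSZ, cVAL} m m' \<and>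
    m' (adr cN 0) = int n \<and> m' (adr cD 0) = D \<and> m' (adr cC 0) = 0 \<and>
    (\<forall>j<n. m' (adr cSZ (int j)) = w j \<and> m' (adr cVAL (int j)) = v j))" (is "runs _ _ _ _ ?Q")
proof -
  let ?X = "{cN, cD, cC, cJ, cSZ, cVAL}"
  let ?mult = "For cJ (Var cN) (Set cD (Var cD \<otimes> den_expr (Var cJ)))"
  let ?c = "Put cSZ (Var cJ) (num_expr (Var cJ) \<otimes> (Var cD \<oslash> den_expr (Var cJ)));;
        Put cVAL (Var cJ) ((Const 38 \<otimes> (Var cN \<otimes> num_expr (Var cJ))) \<oslash> den_expr (Var cJ)
          \<oplus> Var cN \<otimes> (den_expr (Var cJ) \<prec> Const 2 \<otimes> num_expr (Var cJ)) \<oplus> Const 1)"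
  let ?m1 = "post (Set cC (Const 0)) (post (Set cD (Const 1)) (post (Set cN (Load (Const 0))) m))"
  define Inv1 where "Inv1 = (\<lambda>j m'. agree ?X m m' \<and> m' (adr cN 0) = int n \<and> m' (adr cC 0) = 0 \<and>
    m' (adr cD 0) = (\<Prod>l<j. den l))"
  define Inv2 where "Inv2 = (\<lambda>j m'. agree ?X m m' \<and> m' (adr cN 0) = int n \<and> m' (adr cC 0) = 0 \<and>
    m' (adr cD 0) = D \<and> (\<forall>l<j. m' (adr cSZ (int l)) = w l \<and> m' (adr cVAL (int l)) = v l))"
  have first: "runs g ?mult ?m1 (Suc n * 200) (\<lambda>m'. m' (adr cJ 0) = int n \<and> Inv1 n m')"
  proof (rule runs_For)
    show "Inv1 0 (?m1(adr cJ 0 := 0))" by (simp add: Inv1_def m0)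
  next
    fix j m' assume "Inv1 j m'"
    then show "expr_ok g (Var cN) m' \<and> expr_val (Var cN) m' = int n" by (simp add: Inv1_def)
  next
    fix j m' assume j: "j < n" "Inv1 j m'" "m' (adr cJ 0) = int j"
    then have nN: "m' (adr cN 0) = int n" and ag: "agree ?X m m'" by (simp_all add: Inv1_def)
    have io': "input_ok m'" by (rule input_ok_agree[OF io ag])
    show "runs g (Set cD (Var cD \<otimes> den_expr (Var cJ))) m' 100
      (\<lambda>m''. m'' (adr cJ 0) = int j \<and> Inv1 (Suc j) (m''(adr cJ 0 := int (Suc j))))"
      by (rule runs_loop_free)
        (use j in \<open>simp_all add: Inv1_def input_exprs[OF io' nN] expr_ok_input[of m', OF nN] mult.commute\<close>)
  qed simp_all
  have second: "runs g (For cJ (Var cN) ?c) m2 (Suc n * 300) (\<lambda>m'. m' (adr cJ 0) = int n \<and> Inv2 n m')"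
    if m2: "Inv1 n m2" for m2
  proof (rule runs_For)
    show "Inv2 0 (m2(adr cJ 0 := 0))" using m2 by (simp add: Inv1_def Inv2_def D_def)
  next
    fix j m' assume "Inv2 j m'"
    then show "expr_ok g (Var cN) m' \<and> expr_val (Var cN) m' = int n" by (simp add: Inv2_def)
  next
    fix j m' assume j: "j < n" "Inv2 j m'" "m' (adr cJ 0) = int j"
    then have nN: "m' (adr cN 0) = int n" and ag: "agree ?X m m'" by (simp_all add: Inv2_def)
    have io': "input_ok m'" by (rule input_ok_agree[OF io ag])
    let ?m = "m'(adr cSZ (int j) := w j)"
    have io'': "input_ok ?m" using io' by (simp add: input_ok_def)
    have nN': "?m (adr cN 0) = int n" using nN by simp
    have D': "m' (adr cD 0) = D" using j(2) by (simp add: Inv2_def)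
    have p1: "post (Put cSZ (Var cJ) (num_expr (Var cJ) \<otimes> (Var cD \<oslash> den_expr (Var cJ)))) m' = ?m"
      using j D' by (simp add: input_exprs[OF io' nN] w_def)
    have p2: "post ?c m' = m'(adr cSZ (int j) := w j, adr cVAL (int j) := v j)"
      unfolding post.simps p1 using j by (simp add: input_exprs[OF io'' nN'] nN v_def)
    show "runs g ?c m' 250
      (\<lambda>m''. m'' (adr cJ 0) = int j \<and> Inv2 (Suc j) (m''(adr cJ 0 := int (Suc j))))"
    proof (rule runs_loop_free)
      show "post ?c m' (adr cJ 0) = int j \<and> Inv2 (Suc j) ((post ?c m')(adr cJ 0 := int (Suc j)))"
        unfolding p2 using j by (auto simp: Inv2_def less_Suc_eq)
      show "com_ok g ?c m'"
        unfolding com_ok.simps p1 using j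
        by (simp add: input_exprs[OF io' nN] expr_ok_input[of m', OF nN] input_exprs[OF io'' nN']
            expr_ok_input[of ?m, OF nN'] nN)
    qed simp_all
  qed simp_all
  have main: "runs g (?mult;; For cJ (Var cN) ?c) ?m1 (1 + Suc n * 200 + Suc n * 300) ?Q"
  proof (rule runs_Seq[OF first])
    fix m2 assume "m2 (adr cJ 0) = int n \<and> Inv1 n m2"
    then show "runs g (For cJ (Var cN) ?c) m2 (Suc n * 300) ?Q"
      by (intro runs_mono[OF second]) (auto simp: Inv2_def)
  qed simp
  show ?thesis
    unfolding scale_com_def
    by (rule runs_mono[OF runs_Seq_loop_free[OF _ _ _
        runs_Seq_loop_free[OF _ _ _ runs_Seq_loop_free[OF _ _ _ main]]]])
      (simp_all add: scale_bound_def)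
qed

definition bad_pair :: "nat set \<Rightarrow> nat \<Rightarrow> nat \<Rightarrow> nat \<Rightarrow> bool" where
  "bad_pair Q j a b \<longleftrightarrow> \<not> adj j a \<and> (a \<in> Q \<or> \<not> adj j b \<and> adj a b)"

lemma check_run:
  assumes io: "input_ok m" and nN: "m (adr cN 0) = int n" and j: "j < n" "m (adr cJ 0) = int j"
    and ink: "\<And>a. a < n \<Longrightarrow> m (adr cINK (int a)) = (if a \<in> Q then 1 else 0)"
    and S: "m (adr cS 0) = 1"
  shows "runs g check_com m (Suc n * (Suc n * 400 + 100)) (\<lambda>m'. agree {cA, cB, cS} m m' \<and>
    m' (adr cS 0) = (if \<exists>a<n. \<exists>b<n. bad_pair Q j a b then 0 else 1))"
proof -
  let ?X = "{cA, cB, cS}"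
  let ?c = "Cond ((adj_expr (Var cJ) (Var cA) \<doteq> Const 0) \<otimes> (Arr cINK (Var cA) \<oplus>
           (adj_expr (Var cJ) (Var cB) \<doteq> Const 0) \<otimes> adj_expr (Var cA) (Var cB)))
         (Set cS (Const 0)) Skip"
  \<comment> \<open>\<open>row\<close> and \<open>cell\<close> record whether a bad pair has been
    met before row \<open>a\<close>, or before the pair of \<open>a\<close> and \<open>b\<close>;
    the flag \<open>cS\<close> is their negation.\<close>
  define row where "row = (\<lambda>a. \<exists>a'<a. \<exists>b<n. bad_pair Q j a' b)"
  define cell where "cell = (\<lambda>a b. row a \<or> (\<exists>b'<b. bad_pair Q j a b'))"
  have flags: "\<not> row 0" "row (Suc a) = cell a n" "cell a 0 = row a"
    "cell a (Suc b) \<longleftrightarrow> cell a b \<or> bad_pair Q j a b" for a b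
    unfolding row_def cell_def by (auto simp: less_Suc_eq)
  define Inv where "Inv = (\<lambda>a m'. agree ?X m m' \<and> m' (adr cS 0) = (if row a then 0 else 1))"
  define Inv' where "Inv' = (\<lambda>a b m'. agree ?X m m' \<and> m' (adr cA 0) = int a \<and>
    m' (adr cS 0) = (if cell a b then 0 else 1))"
  have nN': "m' (adr cN 0) = int n" if "agree ?X m m'" for m' by (simp add: agreeD[OF that] nN)
  have "runs g check_com m (Suc n * (Suc n * 400 + 100)) (\<lambda>m'. m' (adr cA 0) = int n \<and> Inv n m')"
    unfolding check_com_def
  proof (rule runs_For)
    show "Inv 0 (m(adr cA 0 := 0))" by (simp add: Inv_def S flags)
  next
    fix a m' assume "Inv a m'"
    then show "expr_ok g (Var cN) m' \<and> expr_val (Var cN) m' = int n" using nN' by (simp add: Inv_def)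
  next
    fix a m' assume a: "a < n" "Inv a m'" "m' (adr cA 0) = int a"
    have "runs g (For cB (Var cN) ?c) m' (Suc n * 400) (\<lambda>m''. m'' (adr cB 0) = int n \<and> Inv' a n m'')"
    proof (rule runs_For)
      show "Inv' a 0 (m'(adr cB 0 := 0))" using a by (simp add: Inv_def Inv'_def flags)
    next
      fix b m'' assume "Inv' a b m''"
      then show "expr_ok g (Var cN) m'' \<and> expr_val (Var cN) m'' = int n" using nN' by (simp add: Inv'_def)
    next
      fix b m'' assume b: "b < n" "Inv' a b m''" "m'' (adr cB 0) = int b"
      then have ag: "agree ?X m m''" and A: "m'' (adr cA 0) = int a" by (simp_all add: Inv'_def)
      note n'' = nN'[OF ag]
      note io'' = input_ok_agree[OF io ag]
      have f: "m'' (adr cJ 0) = int j" "m'' (adr cINK (int a)) = (if a \<in> Q then 1 else 0)"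
        using a(1) by (simp_all add: agreeD[OF ag] j ink)
      have post: "post ?c m'' = (if bad_pair Q j a b then m''(adr cS 0 := 0) else m'')"
        using a(1) b(1) j(1)
        by (simp add: input_exprs[OF io'' n''] f A b(3) bad_pair_def)
      show "runs g ?c m'' 300 (\<lambda>m3. m3 (adr cB 0) = int b \<and> Inv' a (Suc b) (m3(adr cB 0 := int (Suc b))))"
      proof (rule runs_loop_free)
        show "post ?c m'' (adr cB 0) = int b \<and> Inv' a (Suc b) ((post ?c m'')(adr cB 0 := int (Suc b)))"
          unfolding post using b ag A by (simp add: Inv'_def flags)
        show "com_ok g ?c m''"
          using a(1) b(1) j(1)
          by (simp add: input_exprs[OF io'' n''] expr_ok_input[of m'', OF n''] f A b(3))
      qed simp_all
    qed simp_all
    then show "runs g (For cB (Var cN) ?c) m' (Suc n * 400)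
      (\<lambda>m''. m'' (adr cA 0) = int a \<and> Inv (Suc a) (m''(adr cA 0 := int (Suc a))))"
      by (rule runs_mono) (simp_all add: Inv_def Inv'_def flags)
  qed (simp_all add: algebra_simps)
  then show ?thesis by (rule runs_mono) (simp_all add: Inv_def row_def)
qed

definition good :: "nat \<Rightarrow> bool" where
  "good x \<longleftrightarrow> (\<forall>a<n. \<forall>b<n. \<not> adj x a \<and> \<not> adj x b \<longrightarrow> \<not> adj a b)"

text \<open>A rejected item stays rejected: its nonneighbour in the list remains there, and
  \<open>good\<close> does not depend on the list. One greedy pass thus yields the maximal clique of
  good items that \<open>split_partition\<close> asks for, while \<open>K\<close> and
  \<open>S\<close> are known only to exist.\<close>

lemma split_run:
  assumes io: "input_ok m" and nN: "m (adr cN 0) = int n" and C: "m (adr cC 0) = 0"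
    and ink: "\<And>a. a < n \<Longrightarrow> m (adr cINK (int a)) = 0"
    and split: "K \<union> S = {..<n}"
      "\<And>a b. a \<in> K \<Longrightarrow> b \<in> K \<Longrightarrow> a \<noteq> b \<Longrightarrow> adj a b" "\<And>a b. a \<in> S \<Longrightarrow> b \<in> S \<Longrightarrow> a \<noteq> b \<Longrightarrow> \<not> adj a b"
  shows "runs g split_com m (split_bound n) (\<lambda>m'. agree {cJ, cA, cB, cS, cC, cKIT, cINK} m m' \<and>
    (\<exists>ks. bpc_split n num den adj ks \<and> m' (adr cC 0) = int (length ks) \<and>
       (\<forall>i<length ks. m' (adr cKIT (int i)) = int (ks ! i)) \<and>
       (\<forall>j<n. m' (adr cINK (int j)) = (if j \<in> set ks then 1 else 0))))"
proof -
  let ?X = "{cJ, cA, cB, cS, cC, cKIT, cINK}"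
  define P where "P = (\<lambda>j ks. distinct ks \<and> set ks \<subseteq> {..<j} \<and>
    (\<forall>a\<in>set ks. \<forall>b\<in>set ks. a \<noteq> b \<longrightarrow> adj a b) \<and> (\<forall>a\<in>set ks. good a) \<and>
    (\<forall>x<j. x \<notin> set ks \<longrightarrow> good x \<longrightarrow> (\<exists>a\<in>set ks. \<not> adj x a)))"
  define R where "R = (\<lambda>ks m'. m' (adr cC 0) = int (length ks) \<and>
       (\<forall>i<length ks. m' (adr cKIT (int i)) = int (ks ! i)) \<and>
       (\<forall>j<n. m' (adr cINK (int j)) = (if j \<in> set ks then 1 else 0)))"
  define Inv where "Inv = (\<lambda>j m'. agree ?X m m' \<and> (\<exists>ks. P j ks \<and> R ks m'))"
  have nN': "m' (adr cN 0) = int n" if "agree ?X m m'" for m' by (simp add: agreeD[OF that] nN)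
  let ?add = "Cond (Var cS) (Put cKIT (Var cC) (Var cJ);; Put cINK (Var cJ) (Const 1);;
      Set cC (Var cC \<oplus> Const 1)) Skip"
  let ?k = "Suc n * (Suc n * 400 + 100)"
  have "runs g split_com m (split_bound n) (\<lambda>m'. m' (adr cJ 0) = int n \<and> Inv n m')"
    unfolding split_com_def
  proof (rule runs_For)
    show "Inv 0 (m(adr cJ 0 := 0))"
      unfolding Inv_def by (intro conjI exI[of _ "[]"]) (auto simp: P_def R_def C ink)
  next
    fix j m' assume "Inv j m'"
    then show "expr_ok g (Var cN) m' \<and> expr_val (Var cN) m' = int n" using nN' by (simp add: Inv_def)
  next
    fix j m' assume j: "j < n" "Inv j m'" "m' (adr cJ 0) = int j"
    then obtain ks where ag: "agree ?X m m'" and P: "P j ks" and R: "R ks m'" by (auto simp: Inv_def)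
    show "runs g (Set cS (Const 1);; check_com;; ?add) m' (?k + 200)
      (\<lambda>m''. m'' (adr cJ 0) = int j \<and> Inv (Suc j) (m''(adr cJ 0 := int (Suc j))))"
    proof (rule runs_Seq)
      show "runs g (Set cS (Const 1)) m' 7 (\<lambda>m1. m1 = m'(adr cS 0 := 1))"
        by (rule runs_loop_free) simp_all
      fix m1 assume m1: "m1 = m'(adr cS 0 := 1)"
      have ag1: "agree ?X m m1" using ag by (simp add: m1)
      have R1: "R ks m1" using R by (simp add: R_def m1)
      show "runs g (check_com;; ?add) m1 (?k + 180)
        (\<lambda>m''. m'' (adr cJ 0) = int j \<and> Inv (Suc j) (m''(adr cJ 0 := int (Suc j))))"
      proof (rule runs_Seq[OF check_run[OF input_ok_agree[OF io ag1] nN'[OF ag1] j(1), of "set ks"]])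
        show "m1 (adr cJ 0) = int j" "m1 (adr cS 0) = 1" by (simp_all add: m1 j)
        show "m1 (adr cINK (int a)) = (if a \<in> set ks then 1 else 0)" if "a < n" for a
          using R1 that by (simp add: R_def)
        fix m2 assume m2: "agree {cA, cB, cS} m1 m2 \<and>
          m2 (adr cS 0) = (if \<exists>a<n. \<exists>b<n. bad_pair (set ks) j a b then 0 else 1)"
        then have ag12: "agree {cA, cB, cS} m1 m2" by blast
        have ag2: "agree ?X m m2" by (rule agree_ext[OF ag1 ag12]) auto
        have R2: "R ks m2" using R1 by (simp add: R_def agreeD[OF ag12])
        have j2: "m2 (adr cJ 0) = int j" by (simp add: agreeD[OF ag12] m1 j)
        have ksn: "set ks \<subseteq> {..<j}" using P by (simp add: P_def)
        have bad: "(\<exists>a<n. \<exists>b<n. bad_pair (set ks) j a b) \<longleftrightarrow> (\<exists>a\<in>set ks. \<not> adj j a) \<or> \<not> good j"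
        proof
          assume "\<exists>a<n. \<exists>b<n. bad_pair (set ks) j a b"
          then show "(\<exists>a\<in>set ks. \<not> adj j a) \<or> \<not> good j"
            unfolding bad_pair_def good_def by blast
        next
          have n: "a < n" if "a \<in> set ks" for a using ksn j(1) that by auto
          assume "(\<exists>a\<in>set ks. \<not> adj j a) \<or> \<not> good j"
          then show "\<exists>a<n. \<exists>b<n. bad_pair (set ks) j a b"
            unfolding bad_pair_def good_def using n by blast
        qed
        show "runs g ?add m2 150
          (\<lambda>m''. m'' (adr cJ 0) = int j \<and> Inv (Suc j) (m''(adr cJ 0 := int (Suc j))))"
        proof (rule runs_loop_free)
          show "post ?add m2 (adr cJ 0) = int j \<and> Inv (Suc j) ((post ?add m2)(adr cJ 0 := int (Suc j)))"
          proof (cases "(\<exists>a\<in>set ks. \<not> adj j a) \<or> \<not> good j")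
            case True
            then have "post ?add m2 = m2" using m2 bad by simp
            moreover have "P (Suc j) ks" using P True by (auto simp: P_def less_Suc_eq)
            moreover have "R ks (m2(adr cJ 0 := int (Suc j)))" using R2 by (simp add: R_def)
            ultimately show ?thesis using j2 ag2 by (auto simp: Inv_def)
          next
            case False
            let ?m = "m2(adr cKIT (int (length ks)) := int j, adr cINK (int j) := 1,
                adr cC 0 := int (Suc (length ks)))"
            have "m2 (adr cC 0) = int (length ks)" "m2 (adr cS 0) = 1"
              using R2 m2 bad False by (simp_all add: R_def)
            then have post: "post ?add m2 = ?m" using j2 by (simp add: add.commute)
            have "adj j a" "adj a j" if "a \<in> set ks" for a using False that adj_sym[of j a] by auto
            then have P': "P (Suc j) (ks @ [j])"
              using P False unfolding P_def by (auto simp: less_Suc_eq)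
            have R': "R (ks @ [j]) (?m(adr cJ 0 := int (Suc j)))"
              using R2 by (auto simp: R_def nth_append less_Suc_eq)
            have "agree ?X m (?m(adr cJ 0 := int (Suc j)))" using ag2 by simp
            then have "Inv (Suc j) (?m(adr cJ 0 := int (Suc j)))" unfolding Inv_def using P' R' by blast
            then show ?thesis unfolding post using j2 by simp
          qed
        qed simp_all
      qed simp
    qed simp
  next
    show "Suc n * (?k + 200 + esize (Var cN) + 40) \<le> split_bound n"
      unfolding split_bound_def by (intro mult_le_mono2) simp
  qed simp_all
  then show ?thesis
  proof (rule runs_mono)
    fix m' assume "m' (adr cJ 0) = int n \<and> Inv n m'"
    then obtain ks where ag: "agree ?X m m'" and P: "P n ks" and R: "R ks m'" by (auto simp: Inv_def)
    have d: "set ks \<subseteq> {..<n}" "\<And>a. a \<in> set ks \<Longrightarrow> good a"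
      "\<And>a b. a \<in> set ks \<Longrightarrow> b \<in> set ks \<Longrightarrow> a \<noteq> b \<Longrightarrow> adj a b"
      "\<And>x. x < n \<Longrightarrow> x \<notin> set ks \<Longrightarrow> good x \<Longrightarrow> \<exists>a\<in>set ks. \<not> adj x a"
      using P unfolding P_def by blast+
    have indep: "\<not> adj a b" if "a < n" "b < n" "a \<notin> set ks" "b \<notin> set ks" for a b
      by (rule split_partition[OF adj_sym split adj_irrefl d[unfolded good_def] that])
    have "distinct ks" using P by (simp add: P_def)
    then have "bpc_split n num den adj ks"
      using d indep by (intro bpc_split.intro bpc_data_axioms bpc_split_axioms.intro)
    then show "agree ?X m m' \<and> (\<exists>ks. bpc_split n num den adj ks \<and> m' (adr cC 0) = int (length ks) \<and>
       (\<forall>i<length ks. m' (adr cKIT (int i)) = int (ks ! i)) \<and>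
       (\<forall>j<n. m' (adr cINK (int j)) = (if j \<in> set ks then 1 else 0)))"
      using ag R unfolding R_def by (intro conjI exI[of _ ks]) simp_all
  qed simp
qed

lemma split_packing_run:
  assumes io: "input_ok m" and m0: "m 0 = int n" "\<And>u. u < 0 \<Longrightarrow> m u = 0"
    and split: "K \<union> S = {..<n}"
      "\<And>a b. a \<in> K \<Longrightarrow> b \<in> K \<Longrightarrow> a \<noteq> b \<Longrightarrow> adj a b" "\<And>a b. a \<in> S \<Longrightarrow> b \<in> S \<Longrightarrow> a \<noteq> b \<Longrightarrow> \<not> adj a b"
    and opt: "opt \<le> n" "valid_labels opt labo"
  shows "runs g split_packing m (total_bound n) (\<lambda>m'. \<exists>h k lab. h \<le> opt \<and> 34 * k \<le> 25 * h \<and>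
    valid_labels (h + k) lab \<and> (\<forall>j<n. m' (int j) = int (lab j)))" (is "runs _ _ _ _ ?Q")
  unfolding split_packing_def
proof (rule runs_Seq[OF scale_run[OF io m0(1)]])
  fix m1 assume "agree {cN, cD, cC, cJ, cSZ, cVAL} m m1 \<and>
    m1 (adr cN 0) = int n \<and> m1 (adr cD 0) = D \<and> m1 (adr cC 0) = 0 \<and>
    (\<forall>j<n. m1 (adr cSZ (int j)) = w j \<and> m1 (adr cVAL (int j)) = v j)"
  then have ag1: "agree {cN, cD, cC, cJ, cSZ, cVAL} m m1" and m1: "m1 (adr cN 0) = int n"
    "m1 (adr cD 0) = D" "m1 (adr cC 0) = 0"
    "\<And>j. j < n \<Longrightarrow> m1 (adr cSZ (int j)) = w j" "\<And>j. j < n \<Longrightarrow> m1 (adr cVAL (int j)) = v j" by auto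
  have io1: "input_ok m1" by (rule input_ok_agree[OF io ag1])
  \<comment> \<open>The program does not initialize \<open>cINK\<close>; it relies on the cells
    outside the input being 0 at the start.\<close>
  have ink1: "m1 (adr cINK (int a)) = 0" for a
    using m0(2)[OF adr_neg] by (simp add: agreeD[OF ag1])
  show "runs g (split_com;; main_com;; output_com) m1 (1 + split_bound n + (main_bound n + Suc n * 100 + 2)) ?Q"
  proof (rule runs_Seq[OF split_run[OF io1 m1(1,3) ink1 split]])
    fix m2 assume "agree {cJ, cA, cB, cS, cC, cKIT, cINK} m1 m2 \<and>
      (\<exists>ks. bpc_split n num den adj ks \<and> m2 (adr cC 0) = int (length ks) \<and>
       (\<forall>i<length ks. m2 (adr cKIT (int i)) = int (ks ! i)) \<and>
       (\<forall>j<n. m2 (adr cINK (int j)) = (if j \<in> set ks then 1 else 0)))"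
    then obtain ks where ag2: "agree {cJ, cA, cB, cS, cC, cKIT, cINK} m1 m2"
      and ks: "bpc_split n num den adj ks" "m2 (adr cC 0) = int (length ks)"
       "\<forall>i<length ks. m2 (adr cKIT (int i)) = int (ks ! i)"
       "\<forall>j<n. m2 (adr cINK (int j)) = (if j \<in> set ks then 1 else 0)" by blast
    \<comment> \<open>The list \<open>ks\<close> is a result of the run so far, hence the locale
      that fixes it can be interpreted only here.\<close>
    interpret sp: ram_split n num den adj g ks
      using ks(1) ram_data_axioms by (rule ram_split.intro[rotated])
    have p: "sp.prepared m2"
      using input_ok_agree[OF io1 ag2] ks m1 unfolding sp.prepared_def
      by (simp add: agreeD[OF ag2])
    show "runs g (main_com;; output_com) m2 (main_bound n + Suc n * 100 + 2) ?Q"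
    proof (rule runs_Seq[OF sp.main_run[OF p opt]])
      fix m3 assume "m3 (adr cN 0) = int n \<and> (\<exists>h\<le>opt. sp.solved h m3)"
      then obtain h k lab where h: "h \<le> opt" "34 * k \<le> 25 * h" "valid_labels (h + k) lab"
        "\<And>j. j < n \<Longrightarrow> m3 (adr cLAB (int j)) = int (lab j)" and nN: "m3 (adr cN 0) = int n"
        unfolding sp.solved_def by blast
      show "runs g output_com m3 (Suc n * 100) ?Q"
        by (rule runs_mono[OF sp.output_run[of m3, OF nN]]) (use h in auto)
    qed simp
  qed simp_all
qed (simp add: total_bound_def)

end


section \<open>Encoded instances\<close>

lemma nth_concat_uniform:
  assumes "\<And>y. y \<in> set ys \<Longrightarrow> length y = c" "i < length ys" "k < c"
  shows "concat ys ! (i * c + k) = ys ! i ! k"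
  using assms
proof (induction ys arbitrary: i)
  case (Cons y ys)
  then show ?case by (cases i) (auto simp: nth_append add.assoc)
qed simp

lemma length_concat_uniform:
  assumes "\<And>y. y \<in> set ys \<Longrightarrow> length y = c"
  shows "length (concat ys) = length ys * c"
  using assms by (induction ys) auto

lemma encode_nth:
  fixes xs :: "'a list" and s :: "'a \<Rightarrow> rat" and E :: "'a set set"
  defines "ws \<equiv> encode_instance xs s E" and "n \<equiv> length xs"
  shows "length ws = 1 + 2 * n + n * n" and "ws ! 0 = int n"
    and "j < n \<Longrightarrow> ws ! (1 + 2 * j) = fst (quotient_of (s (xs ! j)))"
    and "j < n \<Longrightarrow> ws ! (2 + 2 * j) = snd (quotient_of (s (xs ! j)))"
    and "a < n \<Longrightarrow> b < n \<Longrightarrow> ws ! (1 + 2 * n + a * n + b) = (if {xs ! a, xs ! b} \<in> E then 1 else 0)"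
proof -
  define ps where "ps = map (\<lambda>x. [fst (quotient_of (s x)), snd (quotient_of (s x))]) xs"
  define rs where "rs = map (\<lambda>x. map (\<lambda>y. if {x, y} \<in> E then 1 else 0 :: int) xs) xs"
  have ws: "ws = [int n] @ concat ps @ concat rs"
    by (simp add: ws_def encode_instance_def n_def ps_def rs_def)
  have l: "length (concat ps) = 2 * n" "length (concat rs) = n * n"
  proof -
    have "length (concat ps) = length ps * 2" by (rule length_concat_uniform) (auto simp: ps_def)
    then show "length (concat ps) = 2 * n" by (simp add: ps_def n_def)
    have "length (concat rs) = length rs * n" by (rule length_concat_uniform) (auto simp: rs_def n_def)
    then show "length (concat rs) = n * n" by (simp add: rs_def n_def)
  qed
  show "length ws = 1 + 2 * n + n * n" "ws ! 0 = int n" by (simp_all add: ws l)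
  have p: "ws ! (1 + 2 * j + k) = ps ! j ! k" if "j < n" "k < 2" for j k
  proof -
    have "concat ps ! (j * 2 + k) = ps ! j ! k"
      by (rule nth_concat_uniform) (use that in \<open>auto simp: ps_def n_def\<close>)
    moreover have "j * 2 + k < length (concat ps)" using that by (simp add: l)
    ultimately show ?thesis by (simp add: ws nth_append mult.commute)
  qed
  show "ws ! (1 + 2 * j) = fst (quotient_of (s (xs ! j)))" if "j < n"
    using p[OF that, of 0] that by (simp add: ps_def n_def)
  show "ws ! (2 + 2 * j) = snd (quotient_of (s (xs ! j)))" if "j < n"
    using p[OF that, of 1] that by (simp add: ps_def n_def)
  show "ws ! (1 + 2 * n + a * n + b) = (if {xs ! a, xs ! b} \<in> E then 1 else 0)" if "a < n" "b < n"
  proof -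
    have "concat rs ! (a * n + b) = rs ! a ! b"
      by (rule nth_concat_uniform) (use that in \<open>auto simp: rs_def n_def\<close>)
    then show ?thesis using that by (simp add: ws nth_append l rs_def n_def add.assoc)
  qed
qed

lemma int_size_word: "x \<in> set ws \<Longrightarrow> int_size x \<le> input_size ws"
  unfolding input_size_def by (intro member_le_sum_list) auto

lemma length_le_input_size: "length ws \<le> input_size ws"
  unfolding input_size_def
proof (induction ws)
  case (Cons x ws)
  then show ?case using int_size_pos[of x] by simp
qed simp

locale encoded_instance =
  fixes I :: "'a set" and s :: "'a \<Rightarrow> rat" and E :: "'a set set" and xs :: "'a list"
  assumes inst: "bpc_instance I s E" and xs: "set xs = I" "distinct xs"
begin

definition num :: "nat \<Rightarrow> int" where "num j = fst (quotient_of (s (xs ! j)))"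
definition den :: "nat \<Rightarrow> int" where "den j = snd (quotient_of (s (xs ! j)))"
definition adj :: "nat \<Rightarrow> nat \<Rightarrow> bool" where "adj a b \<longleftrightarrow> {xs ! a, xs ! b} \<in> E"

lemma size_eq: "s (xs ! j) = of_int (num j) / of_int (den j)"
  unfolding num_def den_def by (rule quotient_of_div) simp

lemma den_gt_0: "0 < den j"
  unfolding den_def by (rule quotient_of_denom_pos')

sublocale bpc_data "length xs" num den adj
proof
  fix j
  show "0 < den j" by (rule den_gt_0)
next
  fix j assume j: "j < length xs"
  have d: "(0::rat) < of_int (den j)" using den_gt_0 by simp
  have "0 \<le> s (xs ! j)" "s (xs ! j) \<le> 1"
    using inst xs(1) nth_mem[OF j] by (auto simp: bpc_instance_def)
  then have "(0::rat) \<le> of_int (num j)" "(of_int (num j)::rat) \<le> of_int (den j)"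
    using d by (simp_all add: size_eq zero_le_divide_iff divide_le_eq)
  then show "0 \<le> num j" "num j \<le> den j" by simp_all
next
  show "adj a b \<longleftrightarrow> adj b a" for a b by (simp add: adj_def insert_commute)
  show "\<not> adj a a" for a
    using inst by (auto simp: adj_def bpc_instance_def nsets_def)
qed

abbreviation "n \<equiv> length xs"

lemma w_size: "j < n \<Longrightarrow> of_int (w j) = s (xs ! j) * of_int D"
proof -
  assume "j < n"
  then have "(of_int (w j * den j) :: rat) = of_int (num j * D)" by (simp only: w_den)
  then show ?thesis using den_gt_0[of j] by (simp add: size_eq field_simps)
qed

text \<open>Scaling by the common denominator is exact, so feasible bins correspond in both
  directions and no rounding of sizes enters.\<close>

lemma sum_w_size:
  assumes "J \<subseteq> {..<n}"
  shows "(\<Sum>j\<in>J. w j) \<le> D \<longleftrightarrow> sum s ((!) xs ` J) \<le> 1"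
proof -
  have inj: "inj_on ((!) xs) J" using assms xs(2) by (intro inj_on_nth) auto
  have "(of_int (\<Sum>j\<in>J. w j) :: rat) = (\<Sum>j\<in>J. s (xs ! j) * of_int D)"
    using assms by (auto simp: w_size intro!: sum.cong)
  also have "\<dots> = sum s ((!) xs ` J) * of_int D"
    by (simp add: sum.reindex[OF inj] sum_distrib_right)
  finally have eq: "(of_int (\<Sum>j\<in>J. w j) :: rat) = sum s ((!) xs ` J) * of_int D" .
  have "(\<Sum>j\<in>J. w j) \<le> D \<longleftrightarrow> (of_int (\<Sum>j\<in>J. w j) :: rat) \<le> 1 * of_int D"
    by (simp only: of_int_le_iff mult_1)
  also have "\<dots> \<longleftrightarrow> sum s ((!) xs ` J) \<le> 1"
    unfolding eq using D_pos by (subst mult_le_cancel_right_pos) auto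
  finally show ?thesis .
qed

lemma valid_labels_packing:
  assumes lab: "valid_labels h lab" and m: "\<And>j. j < n \<Longrightarrow> m (int j) = int (lab j)"
  shows "is_packing I s E (output_bins xs m)" "card (output_bins xs m) \<le> h"
proof -
  define B where "B = (\<lambda>b. (!) xs ` {j. j < n \<and> lab j = b})"
  have out: "output_bins xs m = B ` lab ` {..<n}"
    unfolding output_bins_def image_image
  proof (rule image_cong[OF refl])
    fix i assume "i \<in> {..<n}"
    then have "(j < n \<and> m (int j) = m (int i)) \<longleftrightarrow> (j < n \<and> lab j = lab i)" for j
      using m[of i] m[of j] by auto
    then show "{xs ! j |j. j < n \<and> m (int j) = m (int i)} = B (lab i)"
      unfolding B_def by (simp add: setcompr_eq_image)
  qed
  have "card (output_bins xs m) \<le> card (lab ` {..<n})" unfolding out by (rule card_image_le) simp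
  also have "\<dots> \<le> card {..<h}" using lab by (intro card_mono) (auto simp: valid_labels_def)
  finally show "card (output_bins xs m) \<le> h" by simp
  have "partition_on I (output_bins xs m)"
    unfolding partition_on_def
  proof (intro conjI)
    show "\<Union> (output_bins xs m) = I"
    proof -
      have "\<Union> (output_bins xs m) = (!) xs ` {..<n}" unfolding out B_def by blast
      also have "\<dots> = set xs" using nth_image[of n xs] by (simp add: atLeast0LessThan)
      finally show ?thesis using xs(1) by simp
    qed
    show "disjoint (output_bins xs m)"
    proof (rule disjointI)
      fix X Y assume "X \<in> output_bins xs m" "Y \<in> output_bins xs m" "X \<noteq> Y"
      then obtain b c where bc: "X = B b" "Y = B c" unfolding out image_iff by metis
      then have "b \<noteq> c" using \<open>X \<noteq> Y\<close> by blast
      show "X \<inter> Y = {}"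
      proof (rule ccontr)
        assume "X \<inter> Y \<noteq> {}"
        then obtain x where "x \<in> B b" "x \<in> B c" using bc by blast
        then obtain i j where "i < n" "j < n" "lab i = b" "lab j = c" "xs ! i = xs ! j"
          unfolding B_def image_iff by (metis (mono_tags, lifting) mem_Collect_eq)
        then show False using \<open>b \<noteq> c\<close> nth_eq_iff_index_eq[OF xs(2)] by metis
      qed
    qed
    show "{} \<notin> output_bins xs m" unfolding out B_def by blast
  qed
  moreover have "indep (B b) E" for b
    unfolding indep_def
  proof (intro ballI impI)
    fix x y assume "x \<in> B b" "y \<in> B b"
    obtain i where i: "i < n" "lab i = b" "x = xs ! i" using \<open>x \<in> B b\<close> unfolding B_def by auto
    obtain j where j: "j < n" "lab j = b" "y = xs ! j" using \<open>y \<in> B b\<close> unfolding B_def by auto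
    have "\<not> adj i j" using lab i(1,2) j(1,2) by (simp add: valid_labels_def)
    then show "{x, y} \<notin> E" by (simp add: adj_def i(3) j(3))
  qed
  moreover have "sum s (B b) \<le> 1" for b
  proof -
    have "(\<Sum>j | j < n \<and> lab j = b. w j) \<le> D" using lab unfolding valid_labels_def by blast
    then show ?thesis unfolding B_def by (subst (asm) sum_w_size) auto
  qed
  ultimately show "is_packing I s E (output_bins xs m)" unfolding is_packing_def out by simp
qed

text \<open>Applied to an optimal packing, this supplies the labels whose existence the analysis
  presupposes and which the program never sees.\<close>

lemma packing_valid_labels:
  assumes P: "is_packing I s E P"
  shows "\<exists>lab. valid_labels (card P) lab"
proof -
  have part: "partition_on I P" using P by (simp add: is_packing_def)
  have "finite I" using inst by (simp add: bpc_instance_def)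
  then have "finite P" using part by (rule finite_elements)
  then obtain f where f: "bij_betw f P {..<card P}" using ex_bij_betw_finite_nat[of P]
    by (auto simp: atLeast0LessThan)
  have "\<exists>B\<in>P. xs ! j \<in> B" if "j < n" for j
    using nth_mem[OF that] xs(1) part by (auto simp: partition_on_def)
  then obtain bin where bin: "\<And>j. j < n \<Longrightarrow> bin j \<in> P \<and> xs ! j \<in> bin j" by metis
  have same: "bin i = bin j" if "i < n" "j < n" "f (bin i) = f (bin j)" for i j
    using f bin that by (auto simp: bij_betw_def inj_on_def)
  have "valid_labels (card P) (\<lambda>j. f (bin j))"
    unfolding valid_labels_def
  proof (intro conjI allI impI)
    show "f (bin j) < card P" if "j < n" for j using f bin[OF that] by (auto simp: bij_betw_def)
  next
    fix i j assume ij: "i < n" "j < n" "f (bin i) = f (bin j)"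
    have B: "xs ! i \<in> bin j" "xs ! j \<in> bin j" "indep (bin j) E"
      using bin[OF ij(1)] bin[OF ij(2)] same[OF ij] P by (auto simp: is_packing_def)
    show "\<not> adj i j"
    proof (cases "i = j")
      case True
      then show ?thesis using adj_irrefl by simp
    next
      case False
      then have "xs ! i \<noteq> xs ! j" using ij xs(2) by (simp add: nth_eq_iff_index_eq)
      then show ?thesis using B by (auto simp: indep_def adj_def)
    qed
  next
    fix b
    show "(\<Sum>j | j < n \<and> f (bin j) = b. w j) \<le> D"
    proof (cases "\<exists>i<n. f (bin i) = b")
      case True
      then obtain i where i: "i < n" "f (bin i) = b" by blast
      have Bi: "sum s (bin i) \<le> 1" "bin i \<subseteq> I"
        using bin[OF i(1)] P part by (auto simp: is_packing_def partition_on_def)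
      have "(!) xs ` {j. j < n \<and> f (bin j) = b} \<subseteq> bin i"
      proof
        fix x assume "x \<in> (!) xs ` {j. j < n \<and> f (bin j) = b}"
        then obtain j where j: "j < n" "f (bin j) = b" "x = xs ! j" by blast
        then show "x \<in> bin i" using bin[OF j(1)] same[of j i] i by simp
      qed
      then have "sum s ((!) xs ` {j. j < n \<and> f (bin j) = b}) \<le> sum s (bin i)"
        using inst Bi(2) by (intro sum_mono2) (auto simp: bpc_instance_def intro: finite_subset)
      then show ?thesis using Bi(1) by (subst sum_w_size) auto
    next
      case False
      then have "{j. j < n \<and> f (bin j) = b} = {}" by auto
      then show ?thesis using D_pos by (simp only: sum.empty)
    qed
  qed
  then show ?thesis by blast
qed

lemma OPT_le_n: "bpc_OPT I s E \<le> n"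
proof -
  have "bpc_OPT I s E \<le> card ((\<lambda>x. {x}) ` I)"
    unfolding bpc_OPT_def using is_packing_singletons[OF inst] by (intro Least_le) blast
  also have "\<dots> \<le> card I" using inst by (intro card_image_le) (simp add: bpc_instance_def)
  also have "\<dots> = n" using distinct_card[OF xs(2)] xs(1) by simp
  finally show ?thesis .
qed

end


section \<open>The approximation guarantee\<close>

text \<open>Eight terms of the series at -1 sum to 103/280, and the remainder is nonnegative because
  its order is even; hence e is at most 280/103, which is below 68/25. The bound 68/25 is what
  \<open>25 / 34 \<le> 2 / exp 1\<close> amounts to.\<close>

lemma exp_1_le: "exp 1 \<le> (68 / 25 :: real)"
proof -
  obtain t :: real where t: "exp (- 1) = (\<Sum>m<8. (- 1) ^ m / fact m) + exp t / fact 8 * (- 1) ^ 8"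
    using Maclaurin_exp_le[of "- 1" 8] by blast
  have "(\<Sum>m<8. (- 1) ^ m / fact m) = (103 / 280 :: real)"
    by (simp add: numeral_eq_Suc fact_numeral)
  then have "103 / 280 \<le> exp (- 1 :: real)" using t by simp
  then have "(103 / 280) * exp 1 \<le> exp (- 1) * exp (1::real)" by (intro mult_right_mono) auto
  then show ?thesis by (simp flip: exp_add)
qed

lemma poly_nat_mono: "a \<le> b \<Longrightarrow> poly p a \<le> poly p b" for p :: "nat poly"
  by (induction p) (auto intro: add_mono mult_le_mono)

lemma poly_bounded_total: "poly_bounded total_bound"
proof -
  have "poly_bounded (\<lambda>n. Suc n * 1)" for n
    using poly_bounded_intros(3)[OF poly_bounded_const[of 1] poly_bounded_id] by simp
  then have suc: "poly_bounded f \<Longrightarrow> poly_bounded (\<lambda>n. Suc (f n))" for f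
    using poly_bounded_add[OF poly_bounded_const[of 1]] by simp
  show ?thesis
    unfolding total_bound_def scale_bound_def split_bound_def main_bound_def assign_bound_def
      search_bound_def respond_bound_def max_gain_def
    by (intro poly_bounded_intros suc)
qed

theorem theorem2:
  shows "\<exists>(alg :: com) (p :: nat poly).
    \<forall>(I :: nat set) (s :: nat \<Rightarrow> rat) (E :: nat set set) (xs :: nat list).
      bpc_instance I s E \<and> split_graph I E \<and> set xs = I \<and> distinct xs \<longrightarrow>
      (\<exists>t m. exec alg (input_memory (encode_instance xs s E)) t m
        \<and> t \<le> poly p (input_size (encode_instance xs s E))
        \<and> is_packing I s E (output_bins xs m)
        \<and> real (card (output_bins xs m)) \<le> (1 + 2 / exp 1) * real (bpc_OPT I s E))"
proof -
  obtain q where q: "\<And>n. total_bound n \<le> poly q n"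
    using poly_bounded_total unfolding poly_bounded_def by blast
  \<comment> \<open>This is the time bound \<open>k * (b + g * k)\<close> of \<open>runs\<close> at
    \<open>k = poly q L\<close>, \<open>b = L + 1\<close> and \<open>g = L + 8\<close>, for input
    size \<open>L\<close>; the 8 makes room for the constants of the program.\<close>
  define p where "p = q * ([:1, 1:] + [:8, 1:] * q)"
  show ?thesis
  proof (intro exI[of _ split_packing] exI[of _ p] allI impI)
    fix I :: "nat set" and s :: "nat \<Rightarrow> rat" and E :: "nat set set" and xs :: "nat list"
    assume asm: "bpc_instance I s E \<and> split_graph I E \<and> set xs = I \<and> distinct xs"
    interpret encoded_instance I s E xs using asm by unfold_locales auto
    define ws where "ws = encode_instance xs s E"
    define L where "L = input_size ws"
    note enc = encode_nth[where xs = xs and s = s and E = E, folded ws_def]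
    have word: "int_size (ws ! i) \<le> L + 8" if "i < length ws" for i
      using int_size_word[OF nth_mem[OF that]] by (simp add: L_def)
    interpret ram: ram_data n num den adj "L + 8"
    proof unfold_locales
      show "int_size (int n) \<le> L + 8" using word[of 0] enc(1,2) by simp
      show "int_size (num j) \<le> L + 8" if "j < n" for j
        using word[of "1 + 2 * j"] enc(1,3) that by (simp add: num_def)
      show "int_size (den j) \<le> L + 8" if "j < n" for j
        using word[of "2 + 2 * j"] enc(1,4) that by (simp add: den_def)
    qed simp
    let ?m = "input_memory ws"
    have mem: "?m (int i) = ws ! i" if "i < length ws" for i
      using that by (simp add: input_memory_def)
    have io: "ram.input_ok ?m"
      unfolding ram.input_ok_def
    proof (intro conjI allI impI)
      fix j assume j: "j < n"
      show "?m (1 + 2 * int j) = num j"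
        using mem[of "1 + 2 * j"] enc(1,3) j by (simp add: num_def)
      show "?m (2 + 2 * int j) = den j"
        using mem[of "2 + 2 * j"] enc(1,4) j by (simp add: den_def)
    next
      fix a b assume ab: "a < n" "b < n"
      have "a * n + b < n * n"
      proof -
        have "a * n + b < Suc a * n" using ab by simp
        also have "\<dots> \<le> n * n" using ab by (intro mult_le_mono1) simp
        finally show ?thesis .
      qed
      then have lt: "1 + 2 * n + a * n + b < length ws" using enc(1) by simp
      have eq: "1 + 2 * int n + int a * int n + int b = int (1 + 2 * n + a * n + b)" by simp
      show "?m (1 + 2 * int n + int a * int n + int b) = (if adj a b then 1 else 0)"
        unfolding eq mem[OF lt] enc(5)[OF ab] adj_def by simp
    qed
    have m0: "?m 0 = int n" using mem[of 0] enc(1,2) by simp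
    have neg: "?m u = 0" if "u < 0" for u using that by (simp add: input_memory_def)
    obtain K0 S0 where KS: "K0 \<union> S0 = I" "K0 \<inter> S0 = {}" "clique K0 E" "indep S0 E"
      using asm by (auto simp: split_graph_def)
    define K S where "K = {j. j < n \<and> xs ! j \<in> K0}" and "S = {j. j < n \<and> xs ! j \<in> S0}"
    have split: "K \<union> S = {..<n}" "\<And>a b. a \<in> K \<Longrightarrow> b \<in> K \<Longrightarrow> a \<noteq> b \<Longrightarrow> adj a b"
      "\<And>a b. a \<in> S \<Longrightarrow> b \<in> S \<Longrightarrow> a \<noteq> b \<Longrightarrow> \<not> adj a b"
      using KS nth_mem[of _ xs] xs unfolding K_def S_def clique_def indep_def adj_def
      by (auto simp: nth_eq_iff_index_eq)
    let ?opt = "bpc_OPT I s E"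
    obtain P where "is_packing I s E P" "card P = ?opt" using bpc_OPT_attained[OF inst] by blast
    then obtain labo where labo: "valid_labels ?opt labo" using packing_valid_labels by metis
    \<comment> \<open>The cells outside the input hold 0, which has size 1 and not 0.\<close>
    have b: "\<forall>a. int_size (?m a) \<le> L + 1"
    proof
      fix a
      show "int_size (?m a) \<le> L + 1"
      proof (cases "0 \<le> a \<and> nat a < length ws")
        case True
        then show ?thesis using int_size_word[OF nth_mem, of "nat a" ws]
          by (simp add: input_memory_def L_def)
      next
        case False
        then have "?m a = 0" by (auto simp: input_memory_def)
        then show ?thesis by (simp add: int_size_def floorlog_def)
      qed
    qed
    obtain t m where t: "exec split_packing ?m t m"
      "t \<le> total_bound n * (L + 1 + (L + 8) * total_bound n)"
      and "\<exists>h k lab. h \<le> ?opt \<and> 34 * k \<le> 25 * h \<and> valid_labels (h + k) lab \<and>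
        (\<forall>j<n. m (int j) = int (lab j))"
      using ram.split_packing_run[OF io m0 neg split OPT_le_n labo] b unfolding runs_def by blast
    then obtain h k lab where h: "h \<le> ?opt" "34 * k \<le> 25 * h" "valid_labels (h + k) lab"
      "\<And>j. j < n \<Longrightarrow> m (int j) = int (lab j)" by blast
    have "n \<le> L" using length_le_input_size[of ws] enc(1) by (simp add: L_def)
    then have T: "total_bound n \<le> poly q L" using q poly_nat_mono order_trans by blast
    have "t \<le> poly q L * (L + 1 + (L + 8) * poly q L)"
      by (rule order_trans[OF t(2)]) (intro mult_le_mono add_mono order_refl T)
    then have "t \<le> poly p L" by (simp add: p_def algebra_simps)
    moreover have "is_packing I s E (output_bins xs m)" "card (output_bins xs m) \<le> h + k"
      by (rule valid_labels_packing[OF h(3,4)]; assumption)+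
    moreover have "real (h + k) \<le> (1 + 2 / exp 1) * real ?opt"
    proof -
      have "25 / 34 \<le> 2 / exp (1::real)" using exp_1_le by (simp add: field_simps)
      then have "(1 + 25 / 34) * real ?opt \<le> (1 + 2 / exp 1) * real ?opt"
        by (intro mult_right_mono) auto
      moreover have "real (h + k) \<le> (1 + 25 / 34) * real ?opt"
      proof -
        have "34 * (h + k) \<le> 59 * ?opt" using h(1,2) by simp
        then have "34 * real (h + k) \<le> 59 * real ?opt" by (metis of_nat_le_iff of_nat_mult of_nat_numeral)
        then show ?thesis by simp
      qed
      ultimately show ?thesis by linarith
    qed
    ultimately show "\<exists>t m. exec split_packing (input_memory (encode_instance xs s E)) t m
        \<and> t \<le> poly p (input_size (encode_instance xs s E))
        \<and> is_packing I s E (output_bins xs m)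
        \<and> real (card (output_bins xs m)) \<le> (1 + 2 / exp 1) * real (bpc_OPT I s E)"
      using t(1) unfolding ws_def L_def
      by (intro exI[of _ t] exI[of _ m]) (auto intro: order_trans)
  qed
qed

end
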